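(* Assume the heat hypothesis and the moment condition of order $p>0$. Let $h\in H$, $h\neq0$, and $t_\varepsilon=\frac{1}{\lambda_{N_h}}|\ln\varepsilon|$ for $\varepsilon\in(0,1)$. Then for every $\varrho\in\mathbb{R}$, \[ \lim_{\varepsilon\to0}\frac{\mathcal{W}_p(X^\varepsilon_{t_\varepsilon+\varrho}(h),\mu^\varepsilon)}{\varepsilon^{1\wedge p}}=\mathcal{W}_p\big(e^{-\varrho\lambda_{N_h}}v_h+\widetilde L_\infty,\widetilde L_\infty\big)=:\mathcal{P}_{p,h}(\varrho)\in(0,\infty). \]
   Context: $H$ is a real separable infinite-dimensional Hilbert space with inner product $\langle\cdot,\cdot\rangle$, norm $|\cdot|$. Heat hypothesis: $A$ is self-adjoint, strictly negative with domain $D(A)\subset H$, with an orthonormal basis $(e_n)_{n\in\mathbb{N}_0}\subset D(A)$, $Ae_n=-\lambda_ne_n$, $0<\lambda_0\leqslant\lambda_1\leqslant\cdots$, $\lambda_n\to\infty$; $S(t)=e^{tA}$. For $h\neq0$: $\mathcal{K}_h=\{k:\langle e_k,h\rangle\neq0\}$, $N_h=\min\mathcal{K}_h$, $\mathcal{M}_h=\{k\in\mathcal{K}_h:\lambda_k=\lambda_{N_h}\}$, $v_h=\sum_{k\in\mathcal{M}_h}\langle e_k,h\rangle e_k$. $L$ is an $H$-valued Lévy process with characteristics $(b,Q,\nu)$ and $\int_{|x|>1}|x|^p\nu(\mathrm{d}x)<\infty$ (moment condition). For $\varepsilon\in(0,1]$, $X^\varepsilon_t(h)=S(t)h+\varepsilon\int_0^tS(t-s)\,\mathrm{d}L_s$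 (mild solution of $\mathrm{d}X=AX\mathrm{d}t+\varepsilon\mathrm{d}L$, $X_0=h$); $\widetilde L_t=\int_0^tS(t-s)\mathrm{d}L_s$ converges in distribution to $\widetilde L_\infty$; $\mu^\varepsilon$ is the law of $\varepsilon\widetilde L_\infty$, the unique invariant probability measure. $\mathcal{W}_p(\mu_1,\mu_2)=\inf_{\Pi}\left(\int_{H\times H}|u-v|^p\,\Pi(\mathrm{d}u,\mathrm{d}v)\right)^{\min\{1,1/p\}}$ over couplings $\Pi$; for random vectors it refers to their laws. $a\wedge b=\min\{a,b\}$. *)

theory Defs
  imports "HOL-Probability.Probability"
begin

text \<open>The operator A is described by an orthonormal basis e of eigenvectors with
  A e n = - lam n * e n.  Only this spectral data enters the statement.\<close>

definition heat_hyp :: "(nat \<Rightarrow> 'a::real_inner) \<Rightarrow> (nat \<Rightarrow> real) \<Rightarrow> bool" where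
  "heat_hyp e lam \<longleftrightarrow>
     (\<forall>i j. inner (e i) (e j) = (if i = j then 1 else 0)) \<and>
     (\<forall>x. (\<lambda>n. \<Sum>k<n. inner (e k) x *\<^sub>R e k) \<longlonglongrightarrow> x) \<and>
     0 < lam 0 \<and> mono lam \<and> filterlim lam at_top sequentially"

definition heat_sg :: "(nat \<Rightarrow> 'a::real_inner) \<Rightarrow> (nat \<Rightarrow> real) \<Rightarrow> real \<Rightarrow> 'a \<Rightarrow> 'a" where
  "heat_sg e lam t h = (\<Sum>n. (exp (- lam n * t) * inner (e n) h) *\<^sub>R e n)"

definition Kset :: "(nat \<Rightarrow> 'a::real_inner) \<Rightarrow> 'a \<Rightarrow> nat set" where
  "Kset e h = {k. inner (e k) h \<noteq> 0}"

definition Nidx :: "(nat \<Rightarrow> 'a::real_inner) \<Rightarrow> 'a \<Rightarrow> nat" where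
  "Nidx e h = (LEAST k. k \<in> Kset e h)"

definition Mset :: "(nat \<Rightarrow> 'a::real_inner) \<Rightarrow> (nat \<Rightarrow> real) \<Rightarrow> 'a \<Rightarrow> nat set" where
  "Mset e lam h = {k \<in> Kset e h. lam k = lam (Nidx e h)}"

definition vvec :: "(nat \<Rightarrow> 'a::real_inner) \<Rightarrow> (nat \<Rightarrow> real) \<Rightarrow> 'a \<Rightarrow> 'a" where
  "vvec e lam h = (\<Sum>k\<in>Mset e lam h. inner (e k) h *\<^sub>R e k)"

definition levy_measure :: "'a::{real_normed_vector, second_countable_topology} measure \<Rightarrow> bool" where
  "levy_measure \<nu> \<longleftrightarrow> sets \<nu> = sets borel \<and> emeasure \<nu> {0} = 0 \<and>
     (\<integral>\<^sup>+ x. ennreal (min 1 ((norm x)\<^sup>2)) \<partial>\<nu>) < \<infinity>"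

definition cov_operator :: "(nat \<Rightarrow> 'a::real_inner) \<Rightarrow> ('a \<Rightarrow> 'a) \<Rightarrow> bool" where
  "cov_operator e Q \<longleftrightarrow> bounded_linear Q \<and> (\<forall>x y. inner (Q x) y = inner x (Q y)) \<and>
     (\<forall>x. 0 \<le> inner (Q x) x) \<and> summable (\<lambda>n. inner (Q (e n)) (e n))"

definition levy_exponent ::
  "'a::{real_inner, second_countable_topology} \<Rightarrow> ('a \<Rightarrow> 'a) \<Rightarrow> 'a measure \<Rightarrow> 'a \<Rightarrow> complex" where
  "levy_exponent b Q \<nu> u =
     \<i> * complex_of_real (inner b u) - complex_of_real (inner (Q u) u / 2) +
     (\<integral>x. (cis (inner u x) - 1 - \<i> * complex_of_real (inner u x * indicator (cball 0 1) x)) \<partial>\<nu>)"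

definition levy_process ::
  "'w measure \<Rightarrow> (real \<Rightarrow> 'w \<Rightarrow> 'a::{real_inner, second_countable_topology}) \<Rightarrow> bool" where
  "levy_process M L \<longleftrightarrow> prob_space M \<and>
     (\<forall>t. L t \<in> borel_measurable M) \<and>
     (AE \<omega> in M. L 0 \<omega> = 0) \<and>
     (\<forall>(n::nat) (t::nat \<Rightarrow> real). 0 \<le> t 0 \<and> (\<forall>i<n. t i \<le> t (Suc i)) \<longrightarrow>
        prob_space.indep_vars M (\<lambda>_. borel) (\<lambda>i \<omega>. L (t (Suc i)) \<omega> - L (t i) \<omega>) {..<n}) \<and>
     (\<forall>s t. 0 \<le> s \<and> 0 \<le> t \<longrightarrow>
        distr M borel (\<lambda>\<omega>. L (s + t) \<omega> - L s \<omega>) = distr M borel (L t)) \<and>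
     (AE \<omega> in M. \<forall>t\<ge>0. continuous (at_right t) (\<lambda>s. L s \<omega>) \<and>
                        (t > 0 \<longrightarrow> (\<exists>l. ((\<lambda>s. L s \<omega>) \<longlongrightarrow> l) (at_left t))))"

definition levy_char :: "'w measure \<Rightarrow> (real \<Rightarrow> 'w \<Rightarrow> 'a::{real_inner, second_countable_topology})
    \<Rightarrow> 'a \<Rightarrow> ('a \<Rightarrow> 'a) \<Rightarrow> 'a measure \<Rightarrow> bool" where
  "levy_char M L b Q \<nu> \<longleftrightarrow>
     (\<forall>t\<ge>0. \<forall>u. (\<integral>\<omega>. cis (inner u (L t \<omega>)) \<partial>M) = exp (complex_of_real t * levy_exponent b Q \<nu> u))"

text \<open>Coordinates of tilde L_t = int_0^t S(t-s) dL_s, computed pathwise by integration by parts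
  (deterministic C^1 integrand): <e_n, tilde L_t> = <e_n, L_t> - lam_n int_0^t e^{-lam_n (t-s)} <e_n, L_s> ds.\<close>
definition stoch_conv :: "(nat \<Rightarrow> 'a::real_inner) \<Rightarrow> (nat \<Rightarrow> real) \<Rightarrow> (real \<Rightarrow> 'w \<Rightarrow> 'a) \<Rightarrow> real \<Rightarrow> 'w \<Rightarrow> 'a" where
  "stoch_conv e lam L t \<omega> =
     (\<Sum>n. (inner (e n) (L t \<omega>) -
            lam n * set_lebesgue_integral lborel {0..t} (\<lambda>s. exp (- lam n * (t - s)) * inner (e n) (L s \<omega>)))
          *\<^sub>R e n)"

definition weak_conv_at_top :: "(real \<Rightarrow> 'a::topological_space measure) \<Rightarrow> 'a measure \<Rightarrow> bool" where
  "weak_conv_at_top \<mu>s \<mu> \<longleftrightarrow>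
     (\<forall>f :: 'a \<Rightarrow> real. continuous_on UNIV f \<and> bounded (range f) \<longrightarrow>
        ((\<lambda>t. \<integral>x. f x \<partial>(\<mu>s t)) \<longlongrightarrow> (\<integral>x. f x \<partial>\<mu>)) at_top)"

definition couplings :: "'a::topological_space measure \<Rightarrow> 'a measure \<Rightarrow> ('a \<times> 'a) measure set" where
  "couplings \<mu>1 \<mu>2 = {\<pi>. sets \<pi> = sets (borel :: ('a \<times> 'a) measure) \<and> prob_space \<pi> \<and>
       distr \<pi> borel fst = \<mu>1 \<and> distr \<pi> borel snd = \<mu>2}"

definition Wcost :: "real \<Rightarrow> 'a::metric_space measure \<Rightarrow> 'a measure \<Rightarrow> ennreal" where
  "Wcost p \<mu>1 \<mu>2 = (INF \<pi>\<in>couplings \<mu>1 \<mu>2. \<integral>\<^sup>+ z. ennreal (dist (fst z) (snd z) powr p) \<partial>\<pi>)"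

definition Wass :: "real \<Rightarrow> 'a::metric_space measure \<Rightarrow> 'a measure \<Rightarrow> ennreal" where
  "Wass p \<mu>1 \<mu>2 = (if Wcost p \<mu>1 \<mu>2 = \<top> then \<top>
                    else ennreal (enn2real (Wcost p \<mu>1 \<mu>2) powr min 1 (1 / p)))"

end

theory Submission
  imports Defs
begin

text \<open>
  Dividing by \<open>\<epsilon>\<close>, the rescaled distance is \<open>W_p(u_\<epsilon> + L~_t, L~_\<infinity>)\<close> with \<open>u_\<epsilon> = S(t) h / \<epsilon>\<close>,
  and \<open>u_\<epsilon> \<rightarrow> exp(-\<rho> \<lambda>) v_h\<close> by the spectral gap above \<open>\<lambda>\<close>. It remains to see that
  \<open>W_p(L~_t, L~_\<infinity>) \<rightarrow> 0\<close>. Reversing time, \<open>L~_t\<close> has the law of \<open>Z_t = \<integral>_0^t S(s) dL_s\<close>, whose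
  increments over \<open>[a, a + 1]\<close> have \<open>p\<close>-th moment at most \<open>C exp(-\<lambda>_0 p a)\<close>; hence \<open>Z_t\<close> converges in
  \<open>L^p\<close>, and the coupling of \<open>Z_t\<close> with its limit gives the claim.

  The moment bound uses only the characteristic function. Averaging it over a Gaussian frequency yields
  the Laplace transform of \<open>|P_n X|^2\<close> for the increments \<open>X\<close> of \<open>L\<close> over a grid of mesh \<open>\<tau> / N\<close>, and
  Weierstrass approximation turns this into bounds of order \<open>1 / N\<close> for the truncated moments of \<open>X\<close>.
  A Gronwall recursion for \<open>E (1 + |S_j|^2)^(p/2)\<close> along the partial sums then bounds the weighted sums
  of increments uniformly in \<open>n\<close> and \<open>N\<close>.
\<close>

section \<open>The transport cost\<close>

text \<open>Since \<open>p\<close> may lie below 1 and the jumps may have infinite variance, the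
  integrals are controlled through \<open>lyap\<close>, a power regularised at the origin, rather
  than through an isometry. Its recursion asks three things of one increment, each of order 1 / N:
  the truncated second moment, the truncated p-th moment and the truncated mean. The first two are
  radial, and a Gaussian frequency is chosen because it turns 1 - cos into a radial function;
  integer variances then generate polynomials in a single variable. The mean is not radial and is
  read off from the imaginary part of the characteristic function. Moments of the increments are a
  conclusion, not an input, so large increments are cut off at a level R. This is harmless only for
  a bounded functional, hence an extra cap K on the norm. No constant depends on n, R or K, which
  permits the limits in N, then in n and K. Convergence of the distance is proved for the cost,
  before any root, by a quasi-triangle inequality valid for all p > 0; one of its factors must be
  close to 1 for the limit to be exact.\<close>

lemma powr_add_le_weighted:
  fixes p \<eta> :: real
  assumes "0 < p" "0 < \<eta>"
  obtains C where "0 \<le> C"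
    "\<And>a b. 0 \<le> a \<Longrightarrow> 0 \<le> b \<Longrightarrow> (a + b) powr p \<le> (1 + \<eta>) * a powr p + C * b powr p"
proof -
  \<comment> \<open>\<open>\<theta>\<close> solves (1 + \<theta>)^p = 1 + \<eta>. If b \<le>
    \<theta> a, then b is absorbed into the factor of a; otherwise a < b / \<theta> and b alone pays
    for the sum. This treats convex and concave powers alike.\<close>
  define \<theta> where "\<theta> = (1 + \<eta>) powr (1 / p) - 1"
  have "1 < (1 + \<eta>) powr (1 / p)"
    using assms by (intro gr_one_powr) auto
  then have \<theta>: "0 < \<theta>" by (simp add: \<theta>_def)
  have \<theta>p: "(1 + \<theta>) powr p = 1 + \<eta>"
    using assms by (simp add: \<theta>_def powr_powr)
  show ?thesis
  proof
    show "0 \<le> (1 / \<theta> + 1) powr p" by simp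
    fix a b :: real assume ab: "0 \<le> a" "0 \<le> b"
    show "(a + b) powr p \<le> (1 + \<eta>) * a powr p + (1 / \<theta> + 1) powr p * b powr p"
    proof (cases "b \<le> \<theta> * a")
      case True
      have "(a + b) powr p \<le> ((1 + \<theta>) * a) powr p"
        using ab True assms by (intro powr_mono2) (auto simp: algebra_simps)
      also have "\<dots> = (1 + \<eta>) * a powr p"
        using ab \<theta> by (simp add: powr_mult \<theta>p)
      finally show ?thesis by (simp add: add_increasing2)
    next
      case False
      have "(a + b) powr p \<le> ((1 / \<theta> + 1) * b) powr p"
        using ab False assms \<theta> by (intro powr_mono2) (auto simp: field_simps)
      also have "\<dots> = (1 / \<theta> + 1) powr p * b powr p"
        using ab \<theta> by (simp add: powr_mult)
      finally show ?thesis using assms by (simp add: add_increasing)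
    qed
  qed
qed

lemma powr_add_le:
  fixes p a b :: real
  assumes "0 \<le> p" "0 \<le> a" "0 \<le> b"
  shows "(a + b) powr p \<le> 2 powr p * (a powr p + b powr p)"
proof -
  have "(a + b) powr p \<le> (2 * max a b) powr p"
    using assms by (intro powr_mono2) auto
  also have "\<dots> = 2 powr p * max a b powr p"
    using assms by (simp add: powr_mult)
  also have "max a b powr p \<le> a powr p + b powr p"
    by (auto simp: max_def)
  finally show ?thesis by simp
qed

lemma couplingsD:
  assumes "\<pi> \<in> couplings \<mu> \<nu>"
  shows "sets \<pi> = sets borel" "prob_space \<pi>" "distr \<pi> borel fst = \<mu>" "distr \<pi> borel snd = \<nu>"
  using assms by (auto simp: couplings_def)

text \<open>The two couplings are glued only along the cells of a countable partition of small mesh,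
  which replaces disintegration and costs the additive error \<open>\<delta>\<close>.\<close>

lemma approximate_gluing:
  fixes \<alpha> \<beta> \<gamma> :: "'a::polish_space measure"
  assumes \<pi>1: "\<pi>1 \<in> couplings \<alpha> \<beta>" and \<pi>2: "\<pi>2 \<in> couplings \<beta> \<gamma>" and \<delta>: "0 < \<delta>"
    and p: "0 < p" and \<eta>: "0 < \<eta>" and C: "0 \<le> C"
    and ineq: "\<And>a b. 0 \<le> a \<Longrightarrow> 0 \<le> b \<Longrightarrow> (a + b) powr p \<le> (1 + \<eta>) * a powr p + C * b powr p"
  shows "Wcost p \<alpha> \<gamma> \<le> ennreal (1 + \<eta>) * (\<integral>\<^sup>+z. ennreal (dist (fst z) (snd z) powr p) \<partial>\<pi>1)
      + ennreal C * (\<integral>\<^sup>+z. ennreal ((\<delta> + dist (fst z) (snd z)) powr p) \<partial>\<pi>2)"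
proof -
  interpret P1: prob_space \<pi>1 by (rule couplingsD[OF \<pi>1])
  interpret P2: prob_space \<pi>2 by (rule couplingsD[OF \<pi>2])
  interpret PP: pair_sigma_finite \<pi>1 \<pi>2 ..
  have [measurable_cong]: "sets \<pi>1 = sets (borel \<Otimes>\<^sub>M borel)" "sets \<pi>2 = sets (borel \<Otimes>\<^sub>M borel)"
    unfolding borel_prod using couplingsD(1)[OF \<pi>1] couplingsD(1)[OF \<pi>2] by auto
  have [measurable]: "fst \<in> borel_measurable (borel :: ('a \<times> 'a) measure)"
      "snd \<in> borel_measurable (borel :: ('a \<times> 'a) measure)"
    by (intro borel_measurable_continuous_onI continuous_intros)+
  obtain D0 :: "'a set" where D0: "countable D0" "\<And>X. open X \<Longrightarrow> X \<noteq> {} \<Longrightarrow> \<exists>d\<in>D0. d \<in> X"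
    by (rule countable_dense_setE) blast
  have "D0 \<noteq> {}" using D0(2)[of UNIV] by auto
  define D where "D = from_nat_into D0"
  have D: "\<exists>i. dist y (D i) < \<delta> / 2" for y
  proof -
    obtain d where d: "d \<in> D0" "d \<in> ball y (\<delta> / 2)"
      using D0(2)[of "ball y (\<delta> / 2)"] \<delta> by auto
    then obtain i where "D i = d"
      using D0(1) unfolding D_def by (metis from_nat_into_surj)
    with d show ?thesis by auto
  qed
  \<comment> \<open>\<open>idx\<close> sends a point to the first dense point within \<delta> / 2,
    so its fibres form a countable Borel partition into cells of diameter at most \<delta>.\<close>
  define idx where "idx y = (LEAST i. dist y (D i) < \<delta> / 2)" for y
  have idx: "dist y (D (idx y)) < \<delta> / 2" for y
    unfolding idx_def by (rule LeastI_ex[OF D])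
  have [measurable]: "idx \<in> measurable borel (count_space UNIV)"
    unfolding idx_def by measurable
  have close: "dist y y' \<le> \<delta>" if "idx y = idx y'" for y y'
    using idx[of y] idx[of y'] that dist_triangle2[of y y' "D (idx y)"] by simp
  define b where "b i = emeasure \<beta> {y. idx y = i}" for i
  \<comment> \<open>Both couplings have \<open>\<beta>\<close> as a marginal, so cells of mass 0 are
    avoided almost surely on either side, and the inverse mass normalises each of the
    others.\<close>
  have b1: "AE z in \<pi>. b (idx (f z)) \<noteq> 0"
    and b2: "b i \<noteq> 0 \<Longrightarrow> (\<integral>\<^sup>+z. (if idx (f z) = i then inverse (b i) else 0) \<partial>\<pi>) = 1"
    if "prob_space \<pi>" "f \<in> borel_measurable \<pi>" "distr \<pi> borel f = \<beta>" for f \<pi> i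
  proof -
    interpret prob_space \<pi> by fact
    note [measurable] = that(2)
    have bi: "b i = emeasure \<pi> {z \<in> space \<pi>. idx (f z) = i}" for i
      unfolding b_def that(3)[symmetric]
      by (subst emeasure_distr) (auto intro!: arg_cong[where f="emeasure \<pi>"])
    have "AE z in \<pi>. \<forall>i. b i = 0 \<longrightarrow> idx (f z) \<noteq> i"
      unfolding AE_all_countable
    proof
      fix i
      show "AE z in \<pi>. b i = 0 \<longrightarrow> idx (f z) \<noteq> i"
      proof (cases "b i = 0")
        case True
        then have "AE z in \<pi>. \<not> (idx (f z) = i)"
          by (subst AE_iff_measurable[OF _ refl]) (auto simp: bi)
        then show ?thesis by auto
      qed simp
    qed
    then show "AE z in \<pi>. b (idx (f z)) \<noteq> 0" by (rule AE_mp) auto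
    show "(\<integral>\<^sup>+z. (if idx (f z) = i then inverse (b i) else 0) \<partial>\<pi>) = 1" if "b i \<noteq> 0"
    proof -
      have "b i \<noteq> \<top>" unfolding bi by (simp)
      have "(\<integral>\<^sup>+z. (if idx (f z) = i then inverse (b i) else 0) \<partial>\<pi>)
        = (\<integral>\<^sup>+z. inverse (b i) * indicator {z \<in> space \<pi>. idx (f z) = i} z \<partial>\<pi>)"
        by (intro nn_integral_cong) (auto simp: indicator_def)
      also have "\<dots> = inverse (b i) * b i"
        unfolding bi by (subst nn_integral_cmult_indicator) auto
      also have "\<dots> = 1" using that \<open>b i \<noteq> \<top>\<close>
        by (metis ennreal_divide_self infinity_ennreal_def mult.commute divide_ennreal_def top.not_eq_extremum)
      finally show ?thesis .
    qed
  qed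
  have [measurable]: "b \<in> measurable (count_space UNIV) borel" by simp
  \<comment> \<open>The density \<open>g\<close> forces the two middle points into one cell and
    leaves the couplings independent given that cell. Integrating out either factor gives 1, so
    \<open>int1\<close> and \<open>int2\<close> preserve both couplings, while the middle points may
    disagree by at most \<delta>.\<close>
  define g where "g w = (if idx (snd (fst w)) = idx (fst (snd w)) then inverse (b (idx (fst (snd w)))) else 0)"
    for w :: "('a \<times> 'a) \<times> 'a \<times> 'a"
  have g_meas[measurable]: "g \<in> borel_measurable (\<pi>1 \<Otimes>\<^sub>M \<pi>2)"
  proof -
    have [measurable]: "(\<lambda>w. idx (snd (fst w))) \<in> measurable (\<pi>1 \<Otimes>\<^sub>M \<pi>2) (count_space UNIV)"
        "(\<lambda>w. idx (fst (snd w))) \<in> measurable (\<pi>1 \<Otimes>\<^sub>M \<pi>2) (count_space UNIV)"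
      by measurable
    have [measurable]: "(\<lambda>w. inverse (b (idx (fst (snd w))))) \<in> borel_measurable (\<pi>1 \<Otimes>\<^sub>M \<pi>2)"
      by (rule measurable_compose[where N = "count_space UNIV" and f = "\<lambda>w. idx (fst (snd w))"]) simp_all
    \<comment> \<open>Equality of two indices is written as a countable union of measurable
      conditions.\<close>
    have *: "g = (\<lambda>w. if \<exists>i. idx (snd (fst w)) = i \<and> idx (fst (snd w)) = i
        then inverse (b (idx (fst (snd w)))) else 0)"
      by (auto simp: g_def fun_eq_iff)
    show ?thesis by (subst *) measurable
  qed
  have int1: "(\<integral>\<^sup>+w. \<phi> (fst w) * g w \<partial>(\<pi>1 \<Otimes>\<^sub>M \<pi>2)) = (\<integral>\<^sup>+z. \<phi> z \<partial>\<pi>1)"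
    if [measurable]: "\<phi> \<in> borel_measurable \<pi>1" for \<phi> :: "'a \<times> 'a \<Rightarrow> ennreal"
  proof -
    have "(\<integral>\<^sup>+w. \<phi> (fst w) * g w \<partial>(\<pi>1 \<Otimes>\<^sub>M \<pi>2)) = (\<integral>\<^sup>+z1. \<integral>\<^sup>+z2. \<phi> z1 * g (z1, z2) \<partial>\<pi>2 \<partial>\<pi>1)"
      by (subst P2.nn_integral_fst[symmetric]) auto
    also have "\<dots> = (\<integral>\<^sup>+z1. \<phi> z1 \<partial>\<pi>1)"
    proof (rule nn_integral_cong_AE)
      have "AE z in \<pi>1. b (idx (snd z)) \<noteq> 0"
        by (rule b1) (use couplingsD[OF \<pi>1] in auto)
      then show "AE z1 in \<pi>1. (\<integral>\<^sup>+z2. \<phi> z1 * g (z1, z2) \<partial>\<pi>2) = \<phi> z1"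
      proof eventually_elim
        case (elim z1)
        have "(\<integral>\<^sup>+z2. \<phi> z1 * g (z1, z2) \<partial>\<pi>2)
          = \<phi> z1 * (\<integral>\<^sup>+z2. (if idx (fst z2) = idx (snd z1) then inverse (b (idx (snd z1))) else 0) \<partial>\<pi>2)"
          by (subst nn_integral_cmult[symmetric]) (auto simp: g_def intro!: nn_integral_cong)
        also have "\<dots> = \<phi> z1"
          by (subst b2) (use couplingsD[OF \<pi>2] elim in auto)
        finally show ?case .
      qed
    qed
    finally show ?thesis .
  qed
  have int2: "(\<integral>\<^sup>+w. \<phi> (snd w) * g w \<partial>(\<pi>1 \<Otimes>\<^sub>M \<pi>2)) = (\<integral>\<^sup>+z. \<phi> z \<partial>\<pi>2)"
    if [measurable]: "\<phi> \<in> borel_measurable \<pi>2" for \<phi> :: "'a \<times> 'a \<Rightarrow> ennreal"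
  proof -
    have "(\<integral>\<^sup>+w. \<phi> (snd w) * g w \<partial>(\<pi>1 \<Otimes>\<^sub>M \<pi>2)) = (\<integral>\<^sup>+z2. \<integral>\<^sup>+z1. \<phi> z2 * g (z1, z2) \<partial>\<pi>1 \<partial>\<pi>2)"
      by (subst PP.nn_integral_snd[symmetric]) auto
    also have "\<dots> = (\<integral>\<^sup>+z2. \<phi> z2 \<partial>\<pi>2)"
    proof (rule nn_integral_cong_AE)
      have "AE z in \<pi>2. b (idx (fst z)) \<noteq> 0"
        by (rule b1) (use couplingsD[OF \<pi>2] in auto)
      then show "AE z2 in \<pi>2. (\<integral>\<^sup>+z1. \<phi> z2 * g (z1, z2) \<partial>\<pi>1) = \<phi> z2"
      proof eventually_elim
        case (elim z2)
        have "(\<integral>\<^sup>+z1. \<phi> z2 * g (z1, z2) \<partial>\<pi>1)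
          = \<phi> z2 * (\<integral>\<^sup>+z1. (if idx (snd z1) = idx (fst z2) then inverse (b (idx (fst z2))) else 0) \<partial>\<pi>1)"
          by (subst nn_integral_cmult[symmetric]) (auto simp: g_def intro!: nn_integral_cong)
        also have "\<dots> = \<phi> z2"
          by (subst b2) (use couplingsD[OF \<pi>1] elim in auto)
        finally show ?case .
      qed
    qed
    finally show ?thesis .
  qed
  define h where "h w = (fst (fst w), snd (snd w))" for w :: "('a \<times> 'a) \<times> 'a \<times> 'a"
  have h_meas[measurable]: "h \<in> measurable (\<pi>1 \<Otimes>\<^sub>M \<pi>2) borel"
    unfolding h_def borel_prod[symmetric] by measurable
  define \<Gamma> where "\<Gamma> = distr (density (\<pi>1 \<Otimes>\<^sub>M \<pi>2) g) borel h"
  have int\<Gamma>: "(\<integral>\<^sup>+z. \<phi> z \<partial>\<Gamma>) = (\<integral>\<^sup>+w. \<phi> (h w) * g w \<partial>(\<pi>1 \<Otimes>\<^sub>M \<pi>2))"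
    if [measurable]: "\<phi> \<in> borel_measurable borel" for \<phi> :: "'a \<times> 'a \<Rightarrow> ennreal"
    unfolding \<Gamma>_def
    by (subst nn_integral_distr) (auto simp: nn_integral_density mult.commute)
  have "\<Gamma> \<in> couplings \<alpha> \<gamma>"
    unfolding couplings_def mem_Collect_eq
  proof (intro conjI)
    show "sets \<Gamma> = sets borel" by (simp add: \<Gamma>_def)
    show "prob_space \<Gamma>"
    proof
      have "emeasure \<Gamma> (space \<Gamma>) = (\<integral>\<^sup>+z. 1 \<partial>\<Gamma>)" by simp
      also have "\<dots> = (\<integral>\<^sup>+w. 1 * g w \<partial>(\<pi>1 \<Otimes>\<^sub>M \<pi>2))" by (rule int\<Gamma>) simp
      also have "\<dots> = 1" by (subst int1[of "\<lambda>_. 1"]) (auto simp: P1.emeasure_space_1)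
      finally show "emeasure \<Gamma> (space \<Gamma>) = 1" .
    qed
    show "distr \<Gamma> borel fst = \<alpha>"
    proof (rule measure_eqI)
      show "sets (distr \<Gamma> borel fst) = sets \<alpha>" using couplingsD(3)[OF \<pi>1] by auto
      fix B assume "B \<in> sets (distr \<Gamma> borel fst)"
      then have B[measurable]: "B \<in> sets borel" by simp
      have [measurable]: "fst \<in> borel_measurable \<Gamma>" by (simp add: \<Gamma>_def)
      have "emeasure (distr \<Gamma> borel fst) B = (\<integral>\<^sup>+x. indicator B x \<partial>distr \<Gamma> borel fst)" by simp
      also have "\<dots> = (\<integral>\<^sup>+z. indicator B (fst z) \<partial>\<Gamma>)"
        by (rule nn_integral_distr) auto
      also have "\<dots> = (\<integral>\<^sup>+w. indicator B (fst (fst w)) * g w \<partial>(\<pi>1 \<Otimes>\<^sub>M \<pi>2))"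
        by (subst int\<Gamma>) (auto simp: h_def)
      also have "\<dots> = (\<integral>\<^sup>+z. indicator B (fst z) \<partial>\<pi>1)"
        by (rule int1[of "\<lambda>z. indicator B (fst z)"]) auto
      also have "\<dots> = (\<integral>\<^sup>+x. indicator B x \<partial>distr \<pi>1 borel fst)"
        by (rule nn_integral_distr[symmetric]) auto
      also have "\<dots> = emeasure \<alpha> B"
        using couplingsD(3)[OF \<pi>1] B by (metis nn_integral_indicator sets_distr)
      finally show "emeasure (distr \<Gamma> borel fst) B = emeasure \<alpha> B" .
    qed
    show "distr \<Gamma> borel snd = \<gamma>"
    proof (rule measure_eqI)
      show "sets (distr \<Gamma> borel snd) = sets \<gamma>" using couplingsD(4)[OF \<pi>2] by auto
      fix B assume "B \<in> sets (distr \<Gamma> borel snd)"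
      then have B[measurable]: "B \<in> sets borel" by simp
      have [measurable]: "snd \<in> borel_measurable \<Gamma>" by (simp add: \<Gamma>_def)
      have "emeasure (distr \<Gamma> borel snd) B = (\<integral>\<^sup>+x. indicator B x \<partial>distr \<Gamma> borel snd)" by simp
      also have "\<dots> = (\<integral>\<^sup>+z. indicator B (snd z) \<partial>\<Gamma>)"
        by (rule nn_integral_distr) auto
      also have "\<dots> = (\<integral>\<^sup>+w. indicator B (snd (snd w)) * g w \<partial>(\<pi>1 \<Otimes>\<^sub>M \<pi>2))"
        by (subst int\<Gamma>) (auto simp: h_def)
      also have "\<dots> = (\<integral>\<^sup>+z. indicator B (snd z) \<partial>\<pi>2)"
        by (rule int2[of "\<lambda>z. indicator B (snd z)"]) auto
      also have "\<dots> = (\<integral>\<^sup>+x. indicator B x \<partial>distr \<pi>2 borel snd)"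
        by (rule nn_integral_distr[symmetric]) auto
      also have "\<dots> = emeasure \<gamma> B"
        using couplingsD(4)[OF \<pi>2] B by (metis nn_integral_indicator sets_distr)
      finally show "emeasure (distr \<Gamma> borel snd) B = emeasure \<gamma> B" .
    qed
  qed
  then have "Wcost p \<alpha> \<gamma> \<le> (\<integral>\<^sup>+z. ennreal (dist (fst z) (snd z) powr p) \<partial>\<Gamma>)"
    unfolding Wcost_def by (rule INF_lower)
  also have "\<dots> = (\<integral>\<^sup>+w. ennreal (dist (fst (fst w)) (snd (snd w)) powr p) * g w \<partial>(\<pi>1 \<Otimes>\<^sub>M \<pi>2))"
    by (subst int\<Gamma>) (auto simp: h_def)
  also have "\<dots> \<le> (\<integral>\<^sup>+w. (ennreal (1 + \<eta>) * ennreal (dist (fst (fst w)) (snd (fst w)) powr p)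
      + ennreal C * ennreal ((\<delta> + dist (fst (snd w)) (snd (snd w))) powr p)) * g w \<partial>(\<pi>1 \<Otimes>\<^sub>M \<pi>2))"
  proof (rule nn_integral_mono)
    fix w :: "('a \<times> 'a) \<times> 'a \<times> 'a"
    obtain x y y' z where w: "w = ((x, y), (y', z))" by (metis prod.collapse)
    show "ennreal (dist (fst (fst w)) (snd (snd w)) powr p) * g w
      \<le> (ennreal (1 + \<eta>) * ennreal (dist (fst (fst w)) (snd (fst w)) powr p)
      + ennreal C * ennreal ((\<delta> + dist (fst (snd w)) (snd (snd w))) powr p)) * g w"
    proof (cases "idx y = idx y'")
      case True
      have "dist x z \<le> dist x y + (\<delta> + dist y' z)"
        using close[OF True] dist_triangle[of x z y] dist_triangle[of y z y'] by linarith
      then have "dist x z powr p \<le> (dist x y + (\<delta> + dist y' z)) powr p"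
        using p by (intro powr_mono2) auto
      also have "\<dots> \<le> (1 + \<eta>) * dist x y powr p + C * (\<delta> + dist y' z) powr p"
        using \<delta> by (intro ineq) auto
      finally have "ennreal (dist x z powr p)
          \<le> ennreal (1 + \<eta>) * ennreal (dist x y powr p) + ennreal C * ennreal ((\<delta> + dist y' z) powr p)"
        using C \<eta> by (simp add: ennreal_mult[symmetric] ennreal_plus[symmetric] del: ennreal_plus)
      then show ?thesis by (auto simp: w intro!: mult_right_mono)
    qed (simp add: w g_def)
  qed
  also have "\<dots> = ennreal (1 + \<eta>) * (\<integral>\<^sup>+w. ennreal (dist (fst (fst w)) (snd (fst w)) powr p) * g w \<partial>(\<pi>1 \<Otimes>\<^sub>M \<pi>2))
      + ennreal C * (\<integral>\<^sup>+w. ennreal ((\<delta> + dist (fst (snd w)) (snd (snd w))) powr p) * g w \<partial>(\<pi>1 \<Otimes>\<^sub>M \<pi>2))"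
    by (simp add: distrib_right nn_integral_add nn_integral_cmult mult.assoc)
  also have "(\<integral>\<^sup>+w. ennreal (dist (fst (fst w)) (snd (fst w)) powr p) * g w \<partial>(\<pi>1 \<Otimes>\<^sub>M \<pi>2))
      = (\<integral>\<^sup>+z. ennreal (dist (fst z) (snd z) powr p) \<partial>\<pi>1)"
    by (rule int1[of "\<lambda>z. ennreal (dist (fst z) (snd z) powr p)"]) auto
  also have "(\<integral>\<^sup>+w. ennreal ((\<delta> + dist (fst (snd w)) (snd (snd w))) powr p) * g w \<partial>(\<pi>1 \<Otimes>\<^sub>M \<pi>2))
      = (\<integral>\<^sup>+z. ennreal ((\<delta> + dist (fst z) (snd z)) powr p) \<partial>\<pi>2)"
    by (rule int2[of "\<lambda>z. ennreal ((\<delta> + dist (fst z) (snd z)) powr p)"]) auto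
  finally show ?thesis .
qed

lemma joint_law_in_couplings:
  fixes X Y :: "'w \<Rightarrow> 'a::polish_space"
  assumes "prob_space M" and [measurable]: "X \<in> borel_measurable M" "Y \<in> borel_measurable M"
  shows "distr M borel (\<lambda>\<omega>. (X \<omega>, Y \<omega>)) \<in> couplings (distr M borel X) (distr M borel Y)"
proof -
  interpret prob_space M by fact
  have [measurable]: "fst \<in> borel_measurable (borel :: ('a \<times> 'a) measure)"
      "snd \<in> borel_measurable (borel :: ('a \<times> 'a) measure)"
    by (intro borel_measurable_continuous_onI continuous_intros)+
  have m: "(\<lambda>\<omega>. (X \<omega>, Y \<omega>)) \<in> borel_measurable M"
    unfolding borel_prod[symmetric] by measurable
  show ?thesis
    unfolding couplings_def
    using m by (auto simp: distr_distr comp_def intro!: prob_space_distr)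
qed

lemma Wcost_le_joint_law:
  fixes X Y :: "'w \<Rightarrow> 'a::polish_space"
  assumes "prob_space M" and [measurable]: "X \<in> borel_measurable M" "Y \<in> borel_measurable M"
  shows "Wcost p (distr M borel X) (distr M borel Y) \<le> (\<integral>\<^sup>+\<omega>. ennreal (dist (X \<omega>) (Y \<omega>) powr p) \<partial>M)"
proof -
  have [measurable]: "fst \<in> borel_measurable (borel :: ('a \<times> 'a) measure)"
      "snd \<in> borel_measurable (borel :: ('a \<times> 'a) measure)"
    by (intro borel_measurable_continuous_onI continuous_intros)+
  have m: "(\<lambda>\<omega>. (X \<omega>, Y \<omega>)) \<in> borel_measurable M"
    unfolding borel_prod[symmetric] by measurable
  have "Wcost p (distr M borel X) (distr M borel Y)
      \<le> (\<integral>\<^sup>+z. ennreal (dist (fst z) (snd z) powr p) \<partial>distr M borel (\<lambda>\<omega>. (X \<omega>, Y \<omega>)))"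
    unfolding Wcost_def by (rule INF_lower[OF joint_law_in_couplings]) fact+
  also have "\<dots> = (\<integral>\<^sup>+\<omega>. ennreal (dist (X \<omega>) (Y \<omega>) powr p) \<partial>M)"
    by (subst nn_integral_distr[OF m]) auto
  finally show ?thesis .
qed

lemma coupling_measurable:
  fixes \<pi> :: "('a::polish_space \<times> 'a) measure"
  assumes "\<pi> \<in> couplings \<mu> \<nu>"
  shows "fst \<in> borel_measurable \<pi>" "snd \<in> borel_measurable \<pi>"
proof -
  have "fst \<in> borel_measurable (borel :: ('a \<times> 'a) measure)"
      "snd \<in> borel_measurable (borel :: ('a \<times> 'a) measure)"
    by (intro borel_measurable_continuous_onI continuous_intros)+
  then show "fst \<in> borel_measurable \<pi>" "snd \<in> borel_measurable \<pi>"
    using couplingsD(1)[OF assms] by (auto cong: measurable_cong_sets)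
qed

lemma Wcost_commute:
  fixes \<mu> \<nu> :: "'a::polish_space measure"
  shows "Wcost p \<mu> \<nu> = Wcost p \<nu> \<mu>"
proof -
  have *: "Wcost p \<mu> \<nu> \<le> Wcost p \<nu> \<mu>" for \<mu> \<nu> :: "'a measure"
    unfolding Wcost_def[of p \<nu> \<mu>]
  proof (rule INF_greatest)
    fix \<pi> assume \<pi>: "\<pi> \<in> couplings \<nu> \<mu>"
    have "Wcost p (distr \<pi> borel snd) (distr \<pi> borel fst)
        \<le> (\<integral>\<^sup>+z. ennreal (dist (snd z) (fst z) powr p) \<partial>\<pi>)"
      using couplingsD(2)[OF \<pi>] coupling_measurable[OF \<pi>] by (intro Wcost_le_joint_law)
    then show "Wcost p \<mu> \<nu> \<le> (\<integral>\<^sup>+z. ennreal (dist (fst z) (snd z) powr p) \<partial>\<pi>)"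
      using couplingsD(3,4)[OF \<pi>] by (simp add: dist_commute)
  qed
  show ?thesis by (intro antisym *)
qed

text \<open>Bounds are found for one coupling at a time; an approximate minimiser with error e / a
  carries them over to the infimum.\<close>

lemma ennreal_le_mult_INF:
  fixes f :: "'b \<Rightarrow> ennreal" and w c :: ennreal
  assumes a: "0 < a" and le: "\<And>x. x \<in> A \<Longrightarrow> w \<le> ennreal a * f x + c"
  shows "w \<le> ennreal a * (INF x\<in>A. f x) + c"
proof (cases "(INF x\<in>A. f x) = \<top>")
  case True
  then show ?thesis using a by (simp add: ennreal_mult_top)
next
  case False
  show ?thesis
  proof (rule ennreal_le_epsilon)
    fix e :: real assume e: "0 < e"
    obtain x where x: "x \<in> A" "f x \<le> (INF x\<in>A. f x) + ennreal (e / a)"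
      using INF_approx_ennreal[of "e / a" _ f A, OF _ refl] False e a by (auto intro: less_imp_le)
    have "w \<le> ennreal a * ((INF x\<in>A. f x) + ennreal (e / a)) + c"
      by (rule order_trans[OF le[OF x(1)]]) (intro add_right_mono mult_left_mono x(2), simp)
    also have "\<dots> = ennreal a * (INF x\<in>A. f x) + c + ennreal e"
      using a e by (simp add: distrib_left ennreal_mult[symmetric] ac_simps)
    finally show "w \<le> ennreal a * (INF x\<in>A. f x) + c + ennreal e" .
  qed
qed

text \<open>Stands in for the triangle inequality, on the level of costs. The weight on the first
  leg is arbitrarily close to 1 and \<open>C\<close> does not depend on the measures, so a vanishing
  second leg disappears in the limit while the first keeps its exact value.\<close>

lemma Wcost_quasi_triangle:
  fixes p \<eta> :: real
  assumes p: "0 < p" and \<eta>: "0 < \<eta>"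
  obtains C :: real where "0 < C"
    "\<And>\<alpha> \<beta> \<gamma> :: 'a::polish_space measure. Wcost p \<alpha> \<gamma> \<le> ennreal (1 + \<eta>) * Wcost p \<alpha> \<beta> + ennreal C * Wcost p \<beta> \<gamma>"
proof -
  obtain C0 where C0: "0 \<le> C0"
    "\<And>a b. 0 \<le> a \<Longrightarrow> 0 \<le> b \<Longrightarrow> (a + b) powr p \<le> (1 + \<eta>) * a powr p + C0 * b powr p"
    by (rule powr_add_le_weighted[OF p \<eta>]) blast
  \<comment> \<open>The factor 2 powr p comes from splitting (\<delta> + dist)^p; the summand 1
    makes \<open>C\<close> positive, so that one may divide by it.\<close>
  define C where "C = C0 * 2 powr p + 1"
  have C: "0 < C" "C0 * 2 powr p \<le> C" using C0 by (auto simp: C_def add_nonneg_pos)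
  show ?thesis
  proof
    show "0 < C" by fact
    fix \<alpha> \<beta> \<gamma> :: "'a measure"
    have "Wcost p \<alpha> \<gamma> \<le> ennreal (1 + \<eta>) * (\<integral>\<^sup>+z. ennreal (dist (fst z) (snd z) powr p) \<partial>\<pi>1)
      + ennreal C * (\<integral>\<^sup>+z. ennreal (dist (fst z) (snd z) powr p) \<partial>\<pi>2)"
      if \<pi>1: "\<pi>1 \<in> couplings \<alpha> \<beta>" and \<pi>2: "\<pi>2 \<in> couplings \<beta> \<gamma>" for \<pi>1 \<pi>2
    proof (rule ennreal_le_epsilon)
      fix e :: real assume e: "0 < e"
      interpret P2: prob_space \<pi>2 by (rule couplingsD[OF \<pi>2])
      note [measurable] = coupling_measurable[OF \<pi>2]
      \<comment> \<open>The mesh of the gluing is chosen so that its contribution C \<delta>^p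
        equals the allowed error \<open>e\<close>.\<close>
      define \<delta> where "\<delta> = (e / C) powr (1 / p)"
      have \<delta>: "0 < \<delta>" "\<delta> powr p = e / C" using e C p by (auto simp: \<delta>_def powr_powr)
      let ?I = "\<integral>\<^sup>+z. ennreal (dist (fst z) (snd z) powr p) \<partial>\<pi>2"
      have "(\<integral>\<^sup>+z. ennreal ((\<delta> + dist (fst z) (snd z)) powr p) \<partial>\<pi>2)
        \<le> (\<integral>\<^sup>+z. ennreal (2 powr p) * (ennreal (\<delta> powr p) + ennreal (dist (fst z) (snd z) powr p)) \<partial>\<pi>2)"
      proof (rule nn_integral_mono)
        fix z :: "'a \<times> 'a"
        have "ennreal ((\<delta> + dist (fst z) (snd z)) powr p) \<le> ennreal (2 powr p * (\<delta> powr p + dist (fst z) (snd z) powr p))"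
          using powr_add_le[of p \<delta> "dist (fst z) (snd z)"] \<delta> p by (intro ennreal_leI) auto
        then show "ennreal ((\<delta> + dist (fst z) (snd z)) powr p)
            \<le> ennreal (2 powr p) * (ennreal (\<delta> powr p) + ennreal (dist (fst z) (snd z) powr p))"
          by (simp add: ennreal_mult)
      qed
      also have "\<dots> = ennreal (2 powr p) * (ennreal (e / C) + ?I)"
        by (simp add: nn_integral_cmult nn_integral_add \<delta> P2.emeasure_space_1)
      finally have "ennreal C0 * (\<integral>\<^sup>+z. ennreal ((\<delta> + dist (fst z) (snd z)) powr p) \<partial>\<pi>2)
          \<le> ennreal C0 * (ennreal (2 powr p) * (ennreal (e / C) + ?I))"
        by (rule mult_left_mono) simp
      also have "\<dots> = ennreal (C0 * 2 powr p) * (ennreal (e / C) + ?I)"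
        using C0 by (simp add: ennreal_mult mult.assoc)
      also have "\<dots> \<le> ennreal C * (ennreal (e / C) + ?I)"
        using C by (intro mult_right_mono ennreal_leI) auto
      also have "\<dots> = ennreal C * ?I + ennreal e"
        using C e by (simp add: distrib_left ennreal_mult[symmetric] add.commute)
      finally have *: "ennreal C0 * (\<integral>\<^sup>+z. ennreal ((\<delta> + dist (fst z) (snd z)) powr p) \<partial>\<pi>2)
          \<le> ennreal C * ?I + ennreal e" .
      show "Wcost p \<alpha> \<gamma> \<le> ennreal (1 + \<eta>) * (\<integral>\<^sup>+z. ennreal (dist (fst z) (snd z) powr p) \<partial>\<pi>1)
          + ennreal C * ?I + ennreal e"
        using order_trans[OF approximate_gluing[OF \<pi>1 \<pi>2 \<delta>(1) p \<eta> C0] add_left_mono[OF *]]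
        by (simp add: add.assoc)
    qed
    then have "Wcost p \<alpha> \<gamma> \<le> ennreal C * Wcost p \<beta> \<gamma>
        + ennreal (1 + \<eta>) * (\<integral>\<^sup>+z. ennreal (dist (fst z) (snd z) powr p) \<partial>\<pi>1)"
      if "\<pi>1 \<in> couplings \<alpha> \<beta>" for \<pi>1
      unfolding Wcost_def[of p \<beta> \<gamma>] using C that by (intro ennreal_le_mult_INF) (auto simp: add.commute)
    then show "Wcost p \<alpha> \<gamma> \<le> ennreal (1 + \<eta>) * Wcost p \<alpha> \<beta> + ennreal C * Wcost p \<beta> \<gamma>"
      unfolding Wcost_def[of p \<alpha> \<beta>] using \<eta> by (intro ennreal_le_mult_INF) (auto simp: add.commute)
  qed
qed

section \<open>Scaling, continuity and positivity of the transport distance\<close>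

lemma Wcost_scaleR_le:
  fixes \<mu> \<nu> :: "'a::{real_inner, polish_space} measure"
  assumes \<epsilon>: "0 < \<epsilon>" and p: "0 < p"
  shows "Wcost p (distr \<mu> borel (\<lambda>x. \<epsilon> *\<^sub>R x)) (distr \<nu> borel (\<lambda>x. \<epsilon> *\<^sub>R x)) \<le> ennreal (\<epsilon> powr p) * Wcost p \<mu> \<nu>"
proof -
  have "Wcost p (distr \<mu> borel (\<lambda>x. \<epsilon> *\<^sub>R x)) (distr \<nu> borel (\<lambda>x. \<epsilon> *\<^sub>R x))
     \<le> ennreal (\<epsilon> powr p) * (\<integral>\<^sup>+z. ennreal (dist (fst z) (snd z) powr p) \<partial>\<pi>)"
    if \<pi>: "\<pi> \<in> couplings \<mu> \<nu>" for \<pi>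
  proof -
    note [measurable] = coupling_measurable[OF \<pi>]
    have "distr \<mu> borel (\<lambda>x. \<epsilon> *\<^sub>R x) = distr \<pi> borel (\<lambda>z. \<epsilon> *\<^sub>R fst z)"
      "distr \<nu> borel (\<lambda>x. \<epsilon> *\<^sub>R x) = distr \<pi> borel (\<lambda>z. \<epsilon> *\<^sub>R snd z)"
      by (subst couplingsD(3,4)[OF \<pi>, symmetric], subst distr_distr; simp add: comp_def)+
    then have "Wcost p (distr \<mu> borel (\<lambda>x. \<epsilon> *\<^sub>R x)) (distr \<nu> borel (\<lambda>x. \<epsilon> *\<^sub>R x))
      \<le> (\<integral>\<^sup>+z. ennreal (dist (\<epsilon> *\<^sub>R fst z) (\<epsilon> *\<^sub>R snd z) powr p) \<partial>\<pi>)"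
      using couplingsD(2)[OF \<pi>] by (simp add: Wcost_le_joint_law)
    also have "\<dots> = (\<integral>\<^sup>+z. ennreal (\<epsilon> powr p) * ennreal (dist (fst z) (snd z) powr p) \<partial>\<pi>)"
      using \<epsilon> by (intro nn_integral_cong)
        (simp add: dist_norm scaleR_diff_right[symmetric] powr_mult ennreal_mult[symmetric])
    also have "\<dots> = ennreal (\<epsilon> powr p) * (\<integral>\<^sup>+z. ennreal (dist (fst z) (snd z) powr p) \<partial>\<pi>)"
      by (rule nn_integral_cmult) auto
    finally show ?thesis .
  qed
  then show ?thesis
    unfolding Wcost_def[of p \<mu> \<nu>] using \<epsilon>
    by (intro ennreal_le_mult_INF[where c = 0 and a = "\<epsilon> powr p", simplified]) auto
qed

text \<open>The lower bound is the upper bound for the factor 1 / \<epsilon>, applied to the scaled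
  measures.\<close>

lemma Wcost_scaleR:
  fixes \<mu> \<nu> :: "'a::{real_inner, polish_space} measure"
  assumes \<epsilon>: "0 < \<epsilon>" and p: "0 < p" and s: "sets \<mu> = sets borel" "sets \<nu> = sets borel"
  shows "Wcost p (distr \<mu> borel (\<lambda>x. \<epsilon> *\<^sub>R x)) (distr \<nu> borel (\<lambda>x. \<epsilon> *\<^sub>R x)) = ennreal (\<epsilon> powr p) * Wcost p \<mu> \<nu>"
proof (rule antisym[OF Wcost_scaleR_le[OF \<epsilon> p]])
  have inv: "distr (distr \<mu> borel (\<lambda>x. \<epsilon> *\<^sub>R x)) borel (\<lambda>x. (1/\<epsilon>) *\<^sub>R x) = \<mu>"
    if s: "sets \<mu> = sets borel" for \<mu> :: "'a measure"
  proof -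
    have [measurable]: "(\<lambda>x. \<epsilon> *\<^sub>R x) \<in> borel_measurable \<mu>"
      using s by (subst measurable_cong_sets[OF s refl]) simp
    show ?thesis
      using \<epsilon> by (subst distr_distr) (auto simp: comp_def s intro!: distr_id2)
  qed
  have "Wcost p \<mu> \<nu> \<le> ennreal ((1/\<epsilon>) powr p) * Wcost p (distr \<mu> borel (\<lambda>x. \<epsilon> *\<^sub>R x)) (distr \<nu> borel (\<lambda>x. \<epsilon> *\<^sub>R x))"
    using Wcost_scaleR_le[of "1/\<epsilon>" p "distr \<mu> borel (\<lambda>x. \<epsilon> *\<^sub>R x)" "distr \<nu> borel (\<lambda>x. \<epsilon> *\<^sub>R x)"] \<epsilon> p
    by (simp add: inv[OF s(1)] inv[OF s(2)])
  then have "ennreal (\<epsilon> powr p) * Wcost p \<mu> \<nu> \<le> ennreal (\<epsilon> powr p) *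
     (ennreal ((1/\<epsilon>) powr p) * Wcost p (distr \<mu> borel (\<lambda>x. \<epsilon> *\<^sub>R x)) (distr \<nu> borel (\<lambda>x. \<epsilon> *\<^sub>R x)))"
    by (rule mult_left_mono) simp
  also have "\<dots> = Wcost p (distr \<mu> borel (\<lambda>x. \<epsilon> *\<^sub>R x)) (distr \<nu> borel (\<lambda>x. \<epsilon> *\<^sub>R x))"
    using \<epsilon> by (simp add: mult.assoc[symmetric] ennreal_mult[symmetric] powr_mult[symmetric])
  finally show "ennreal (\<epsilon> powr p) * Wcost p \<mu> \<nu> \<le> \<dots>" .
qed

text \<open>Origin of the normalisation in the theorem: the cost scales by \<epsilon>^p, the
  distance is its power min 1 (1 / p), and p * min 1 (1 / p) = min 1 p.\<close>

lemma Wass_scaleR: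
  fixes \<mu> \<nu> :: "'a::{real_inner, polish_space} measure"
  assumes \<epsilon>: "0 < \<epsilon>" and p: "0 < p" and s: "sets \<mu> = sets borel" "sets \<nu> = sets borel"
  shows "Wass p (distr \<mu> borel (\<lambda>x. \<epsilon> *\<^sub>R x)) (distr \<nu> borel (\<lambda>x. \<epsilon> *\<^sub>R x)) / ennreal (\<epsilon> powr min 1 p) = Wass p \<mu> \<nu>"
proof (cases "Wcost p \<mu> \<nu> = \<top>")
  case True
  then show ?thesis
    using \<epsilon> by (simp add: Wass_def Wcost_scaleR[OF assms] ennreal_mult_top ennreal_top_divide)
next
  case False
  have "p * min 1 (1 / p) = min 1 p" using p by (simp add: min_def field_simps)
  then have "(\<epsilon> powr p) powr min 1 (1 / p) = \<epsilon> powr min 1 p" by (simp add: powr_powr)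
  then show ?thesis
    using False \<epsilon>
    by (simp add: Wass_def Wcost_scaleR[OF assms] ennreal_mult_eq_top_iff enn2real_mult powr_mult
        divide_ennreal)
qed

text \<open>\<open>enn2real\<close> is continuous only below \<open>\<top>\<close>; a finite limit
  keeps the costs eventually finite, where the second branch of \<open>Wass\<close> applies.\<close>

lemma tendsto_Wass:
  assumes p: "0 < p" and c: "Wcost p \<mu> \<nu> \<noteq> \<top>"
    and lim: "((\<lambda>x. Wcost p (\<mu>s x) (\<nu>s x)) \<longlongrightarrow> Wcost p \<mu> \<nu>) F"
  shows "((\<lambda>x. Wass p (\<mu>s x) (\<nu>s x)) \<longlongrightarrow> Wass p \<mu> \<nu>) F"
proof -
  have ev: "eventually (\<lambda>x. Wcost p (\<mu>s x) (\<nu>s x) < \<top>) F"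
    using order_tendstoD(2)[OF lim, of \<top>] c by (simp add: less_top)
  have "((\<lambda>x. enn2real (Wcost p (\<mu>s x) (\<nu>s x))) \<longlongrightarrow> enn2real (Wcost p \<mu> \<nu>)) F"
    using c lim by (intro tendsto_enn2real) (auto simp: less_top)
  then have "((\<lambda>x. enn2real (Wcost p (\<mu>s x) (\<nu>s x)) powr min 1 (1 / p))
      \<longlongrightarrow> enn2real (Wcost p \<mu> \<nu>) powr min 1 (1 / p)) F"
    using p by (intro tendsto_powr') (auto intro!: tendsto_const)
  then have "((\<lambda>x. ennreal (enn2real (Wcost p (\<mu>s x) (\<nu>s x)) powr min 1 (1 / p)))
      \<longlongrightarrow> ennreal (enn2real (Wcost p \<mu> \<nu>) powr min 1 (1 / p))) F"
    by (rule tendsto_ennrealI)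
  then show ?thesis
  proof (rule Lim_transform_eventually[THEN tendsto_eq_rhs])
    show "eventually (\<lambda>x. ennreal (enn2real (Wcost p (\<mu>s x) (\<nu>s x)) powr min 1 (1 / p)) = Wass p (\<mu>s x) (\<nu>s x)) F"
      using ev by eventually_elim (simp add: Wass_def)
    show "ennreal (enn2real (Wcost p \<mu> \<nu>) powr min 1 (1 / p)) = Wass p \<mu> \<nu>"
      using c by (simp add: Wass_def)
  qed
qed

text \<open>The function x \<mapsto> arctan <w, x> is bounded, Lipschitz with constant |w| and
  strictly increased by the shift. Its means under the two laws therefore differ by some \<Delta> >
  0, which a coupling of too small a cost could not produce. Being bounded, it is integrable under
  any \<mu>.\<close>

lemma Wcost_translate_pos:
  fixes \<mu> :: "'a::{real_inner, polish_space} measure"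
  assumes \<mu>: "prob_space \<mu>" "sets \<mu> = sets borel" and w: "w \<noteq> 0" and p: "0 < p"
  shows "0 < Wcost p (distr \<mu> borel (\<lambda>x. w + x)) \<mu>"
proof (rule ccontr)
  assume "\<not> 0 < Wcost p (distr \<mu> borel (\<lambda>x. w + x)) \<mu>"
  then have z: "Wcost p (distr \<mu> borel (\<lambda>x. w + x)) \<mu> = 0" by simp
  interpret prob_space \<mu> by fact
  note [measurable_cong] = \<mu>(2)
  define g where "g x = arctan (inner w x)" for x
  have [measurable]: "g \<in> borel_measurable borel"
    unfolding g_def by (intro borel_measurable_continuous_onI continuous_intros)
  have gb: "\<bar>g x\<bar> \<le> 2" for x
    using arctan_bounded[of "inner w x"] pi_less_4 by (auto simp: g_def)
  have int: "integrable \<mu> (\<lambda>x. g (w + x))" "integrable \<mu> (\<lambda>x. g x)"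
    using gb by (auto intro!: integrable_const_bound[of _ 2])
  define \<Delta> where "\<Delta> = (\<integral>x. g (w + x) - g x \<partial>\<mu>)"
  have pos: "0 < g (w + x) - g x" for x
    using w by (simp add: g_def inner_add_right arctan_less_iff)
  have "\<Delta> \<noteq> 0"
  proof
    assume "\<Delta> = 0"
    then have "AE x in \<mu>. g (w + x) - g x = 0"
      unfolding \<Delta>_def using int pos
      by (subst (asm) integral_nonneg_eq_0_iff_AE) (auto simp: less_imp_le)
    then have "AE x in \<mu>. False" 
      by (rule AE_mp) (use less_imp_neq[OF pos] in auto)
    then show False by simp
  qed
  moreover have "0 \<le> \<Delta>" unfolding \<Delta>_def using pos by (intro integral_nonneg_AE) (auto simp: less_imp_le)
  ultimately have \<Delta>: "0 < \<Delta>" by simp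
  \<comment> \<open>Pairs at distance at most \<delta> change the test function by at most e =
    \<Delta> / 2. The others change it by at most 4 and, the cost being below \<Delta> / 16 *
    \<delta>^p, contribute at most \<Delta> / 4 in the mean.\<close>
  define e \<delta> where "e = \<Delta> / 2" and "\<delta> = e / norm w"
  have \<delta>: "0 < \<delta>" "0 < e" using \<Delta> w by (auto simp: e_def \<delta>_def)
  have "Wcost p (distr \<mu> borel (\<lambda>x. w + x)) \<mu> < ennreal (\<Delta> / 16 * \<delta> powr p)"
    using z \<Delta> \<delta> by simp
  then obtain \<pi> where \<pi>: "\<pi> \<in> couplings (distr \<mu> borel (\<lambda>x. w + x)) \<mu>"
    and c: "(\<integral>\<^sup>+z. ennreal (dist (fst z) (snd z) powr p) \<partial>\<pi>) < ennreal (\<Delta> / 16 * \<delta> powr p)"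
    unfolding Wcost_def INF_less_iff by blast
  interpret P: prob_space \<pi> by (rule couplingsD[OF \<pi>])
  note [measurable] = coupling_measurable[OF \<pi>]
  have di: "integrable \<pi> (\<lambda>z. dist (fst z) (snd z) powr p)"
    using c by (intro integrableI_nonneg) (auto intro: order.strict_trans)
  have dc: "(\<integral>z. dist (fst z) (snd z) powr p \<partial>\<pi>) \<le> \<Delta> / 16 * \<delta> powr p"
    using c di \<Delta> \<delta> by (subst (asm) nn_integral_eq_integral) (auto simp: ennreal_less_iff)
  have gi: "integrable \<pi> (\<lambda>z. g (fst z))" "integrable \<pi> (\<lambda>z. g (snd z))"
    using gb by (auto intro!: P.integrable_const_bound[of _ 2])
  have "\<Delta> = (\<integral>x. g x \<partial>distr \<mu> borel (\<lambda>x. w + x)) - (\<integral>x. g x \<partial>\<mu>)"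
    unfolding \<Delta>_def using int by (subst integral_distr) auto
  also have "(\<integral>x. g x \<partial>distr \<mu> borel (\<lambda>x. w + x)) = (\<integral>z. g (fst z) \<partial>\<pi>)"
    by (subst couplingsD(3)[OF \<pi>, symmetric], subst integral_distr) auto
  also have "(\<integral>x. g x \<partial>\<mu>) = (\<integral>z. g (snd z) \<partial>\<pi>)"
    by (subst couplingsD(4)[OF \<pi>, symmetric], subst integral_distr) auto
  also have "(\<integral>z. g (fst z) \<partial>\<pi>) - (\<integral>z. g (snd z) \<partial>\<pi>) = (\<integral>z. g (fst z) - g (snd z) \<partial>\<pi>)"
    using gi by simp
  also have "\<dots> \<le> (\<integral>z. e + 4 / \<delta> powr p * dist (fst z) (snd z) powr p \<partial>\<pi>)"
  proof (rule integral_mono)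
    fix z assume "z \<in> space \<pi>"
    obtain x y where zxy: "z = (x, y)" by (cases z)
    show "g (fst z) - g (snd z) \<le> e + 4 / \<delta> powr p * dist (fst z) (snd z) powr p"
    proof (cases "dist x y \<le> \<delta>")
      case True
      have "\<bar>g x - g y\<bar> \<le> \<bar>inner w x - inner w y\<bar>"
        unfolding g_def
        using field_differentiable_bound[of UNIV arctan "\<lambda>x. inverse (1 + x\<^sup>2)" 1 "inner w x" "inner w y"]
        by (auto simp: DERIV_arctan inverse_le_1_iff add_nonneg_eq_0_iff)
      also have "\<dots> \<le> norm w * dist x y"
        by (simp add: inner_diff_right[symmetric] dist_norm Cauchy_Schwarz_ineq2)
      also have "\<dots> \<le> norm w * \<delta>" using True by (intro mult_left_mono) auto
      also have "\<dots> = e" using w by (simp add: \<delta>_def)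
      finally show ?thesis using zxy \<delta> by (simp add: add_increasing2)
    next
      case False
      then have "1 \<le> dist x y powr p / \<delta> powr p"
        using \<delta> p by (simp add: powr_mono2)
      moreover have "g x - g y \<le> 4" using gb[of x] gb[of y] by (simp add: abs_le_iff)
      ultimately have "g x - g y \<le> 4 * (dist x y powr p / \<delta> powr p)" by linarith
      then show ?thesis using zxy \<delta> by simp
    qed
  qed (use gi di in auto)
  also have "\<dots> = e + 4 / \<delta> powr p * (\<integral>z. dist (fst z) (snd z) powr p \<partial>\<pi>)"
    using di by (simp add: P.prob_space)
  also have "\<dots> \<le> e + 4 / \<delta> powr p * (\<Delta> / 16 * \<delta> powr p)"
    using \<delta> by (intro add_left_mono mult_left_mono dc) auto
  also have "\<dots> < \<Delta>" using \<delta> \<Delta> by (simp add: e_def)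
  finally show False by simp
qed

section \<open>Orthonormal expansions and the heat semigroup\<close>

locale orthonormal_basis =
  fixes e :: "nat \<Rightarrow> 'a::{real_inner, polish_space}"
  assumes ortho: "inner (e i) (e j) = (if i = j then 1 else 0)"
    and expansion: "(\<lambda>n. \<Sum>k<n. inner (e k) x *\<^sub>R e k) \<longlonglongrightarrow> x"
begin

definition proj :: "nat \<Rightarrow> 'a \<Rightarrow> 'a" where
  "proj n x = (\<Sum>k<n. inner (e k) x *\<^sub>R e k)"

text \<open>The value 0 for sequences that are not square summable makes \<open>vec\<close> of
  random coordinates measurable on the whole space, although summability will be known only almost
  surely.\<close>

definition vec :: "(nat \<Rightarrow> real) \<Rightarrow> 'a" where
  "vec a = (if summable (\<lambda>k. (a k)\<^sup>2) then \<Sum>k. a k *\<^sub>R e k else 0)"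

lemma inner_basis_sum:
  assumes "finite A"
  shows "inner (e i) (\<Sum>k\<in>A. a k *\<^sub>R e k) = (if i \<in> A then a i else 0)"
proof -
  have "inner (e i) (\<Sum>k\<in>A. a k *\<^sub>R e k) = (\<Sum>k\<in>A. a k * inner (e i) (e k))"
    unfolding inner_sum_right inner_scaleR_right ..
  also have "\<dots> = (\<Sum>k\<in>A. if i = k then a k else 0)"
    unfolding ortho by (rule sum.cong) auto
  also have "\<dots> = (if i \<in> A then a i else 0)" using assms by simp
  finally show ?thesis .
qed

lemma norm_basis_sum:
  assumes "finite A"
  shows "(norm (\<Sum>k\<in>A. a k *\<^sub>R e k))\<^sup>2 = (\<Sum>k\<in>A. (a k)\<^sup>2)"
proof -
  have "(norm (\<Sum>k\<in>A. a k *\<^sub>R e k))\<^sup>2 = (\<Sum>i\<in>A. a i * inner (e i) (\<Sum>k\<in>A. a k *\<^sub>R e k))"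
    by (simp add: power2_norm_eq_inner inner_sum_left)
  also have "\<dots> = (\<Sum>k\<in>A. (a k)\<^sup>2)"
    using assms by (intro sum.cong) (auto simp: inner_basis_sum power2_eq_square)
  finally show ?thesis .
qed

lemma eq_if_coordinates_eq:
  assumes "\<And>k. inner (e k) x = inner (e k) y"
  shows "x = y"
  using expansion[of x] expansion[of y] assms LIMSEQ_unique by auto

lemma norm_proj: "(norm (proj n x))\<^sup>2 = (\<Sum>k<n. (inner (e k) x)\<^sup>2)"
  unfolding proj_def by (simp add: norm_basis_sum)

lemma coordinates_sums: "(\<lambda>k. (inner (e k) x)\<^sup>2) sums (norm x)\<^sup>2"
proof -
  have "(\<lambda>n. (norm (proj n x))\<^sup>2) \<longlonglongrightarrow> (norm x)\<^sup>2"
    unfolding proj_def by (intro tendsto_intros expansion)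
  then show ?thesis by (simp add: norm_proj sums_def)
qed

lemma norm_proj_le: "norm (proj n x) \<le> norm x"
proof -
  have "(norm (proj n x))\<^sup>2 \<le> (norm x)\<^sup>2"
    unfolding norm_proj using coordinates_sums[of x]
    by (metis sums_unique sums_summable sum_le_suminf finite_lessThan zero_le_power2)
  then show ?thesis by (simp add: power2_le_iff_abs_le)
qed

lemma proj_tendsto: "(\<lambda>n. proj n x) \<longlonglongrightarrow> x"
  unfolding proj_def by (rule expansion)

lemma inner_proj: "inner v (proj n x) = inner (proj n v) x"
  by (simp add: proj_def inner_sum_left inner_sum_right inner_commute mult.commute)

lemma continuous_proj: "continuous_on UNIV (proj n)"
  unfolding proj_def[abs_def] by (intro continuous_intros)

lemma borel_measurable_proj[measurable]: "proj n \<in> borel_measurable borel"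
  by (rule borel_measurable_continuous_onI[OF continuous_proj])

text \<open>Riesz-Fischer: the partial sums are Cauchy by Pythagoras, and a Polish type is
  complete.\<close>

lemma basis_series_sums:
  assumes "summable (\<lambda>k. (a k)\<^sup>2)"
  shows "(\<lambda>k. a k *\<^sub>R e k) sums vec a"
proof -
  define S where "S n = (\<Sum>k<n. a k *\<^sub>R e k)" for n
  have "Cauchy S"
  proof (rule metric_CauchyI)
    fix \<epsilon> :: real assume \<epsilon>: "0 < \<epsilon>"
    have "Cauchy (\<lambda>n. \<Sum>k<n. (a k)\<^sup>2)"
      using assms by (simp add: summable_iff_convergent convergent_Cauchy)
    then obtain N where N: "\<And>m n. N \<le> m \<Longrightarrow> N \<le> n \<Longrightarrow> \<bar>(\<Sum>k<m. (a k)\<^sup>2) - (\<Sum>k<n. (a k)\<^sup>2)\<bar> < \<epsilon>\<^sup>2"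
      using \<epsilon> unfolding Cauchy_def dist_real_def by (metis zero_less_power)
    have *: "dist (S m) (S n) < \<epsilon>" if "N \<le> m" "m \<le> n" for m n
    proof -
      have d: "(\<Sum>k<n. f k) - (\<Sum>k<m. f k) = (\<Sum>k\<in>{m..<n}. f k)" for f :: "nat \<Rightarrow> 'b::ab_group_add"
        using that by (metis sum_diff_nat_ivl le0 atLeast0LessThan)
      have "S n - S m = (\<Sum>k\<in>{m..<n}. a k *\<^sub>R e k)" unfolding S_def by (rule d)
      then have "(norm (S n - S m))\<^sup>2 = (\<Sum>k<n. (a k)\<^sup>2) - (\<Sum>k<m. (a k)\<^sup>2)"
        by (simp add: norm_basis_sum d)
      also have "\<dots> < \<epsilon>\<^sup>2" using N[of n m] that by simp
      finally have "norm (S n - S m) < \<epsilon>" using \<epsilon> by (simp add: power2_less_imp_less)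
      then show ?thesis by (simp add: dist_norm norm_minus_commute)
    qed
    show "\<exists>M. \<forall>m\<ge>M. \<forall>n\<ge>M. dist (S m) (S n) < \<epsilon>"
      using * by (metis dist_commute linear)
  qed
  then obtain l where "S \<longlonglongrightarrow> l" using Cauchy_convergent[of S] unfolding convergent_def by blast
  then have "(\<lambda>k. a k *\<^sub>R e k) sums l" by (simp add: sums_def S_def[abs_def])
  then show ?thesis using assms by (simp add: vec_def sums_iff)
qed

lemma coordinate_vec:
  assumes "summable (\<lambda>k. (a k)\<^sup>2)"
  shows "inner (e i) (vec a) = a i"
proof -
  have "(\<lambda>n. inner (e i) (\<Sum>k<n. a k *\<^sub>R e k)) \<longlonglongrightarrow> inner (e i) (vec a)"
    using basis_series_sums[OF assms] unfolding sums_def by (intro tendsto_intros)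
  moreover have "(\<lambda>n. inner (e i) (\<Sum>k<n. a k *\<^sub>R e k)) \<longlonglongrightarrow> a i"
    by (rule tendsto_eventually) (auto simp: inner_basis_sum eventually_sequentially intro!: exI[of _ "Suc i"])
  ultimately show ?thesis by (rule LIMSEQ_unique)
qed

lemma proj_vec:
  assumes "summable (\<lambda>k. (a k)\<^sup>2)"
  shows "proj n (vec a) = (\<Sum>k<n. a k *\<^sub>R e k)"
  by (simp add: proj_def coordinate_vec[OF assms])

lemma norm_le_if_coordinates_le:
  assumes "\<And>k. \<bar>inner (e k) x\<bar> \<le> c * \<bar>inner (e k) y\<bar>" and c: "0 \<le> c"
  shows "norm x \<le> c * norm y"
proof -
  have "(norm x)\<^sup>2 \<le> c\<^sup>2 * (norm y)\<^sup>2"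
  proof (rule sums_le[OF _ coordinates_sums sums_mult[OF coordinates_sums]])
    fix k
    show "(inner (e k) x)\<^sup>2 \<le> c\<^sup>2 * (inner (e k) y)\<^sup>2"
      using power_mono[OF assms(1)[of k], of 2] by (simp add: power_mult_distrib)
  qed
  then have "(norm x)\<^sup>2 \<le> (c * norm y)\<^sup>2" by (simp add: power_mult_distrib)
  then show ?thesis using c by (simp add: power2_le_iff_abs_le)
qed

lemma borel_measurable_vec[measurable (raw)]:
  assumes [measurable]: "\<And>k. f k \<in> borel_measurable M"
  shows "(\<lambda>\<omega>. vec (\<lambda>k. f k \<omega>)) \<in> borel_measurable M"
proof -
  define G where "G = {\<omega> \<in> space M. summable (\<lambda>k. (f k \<omega>)\<^sup>2)}"
  have [measurable]: "G \<in> sets M"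
  proof -
    \<comment> \<open>Square summability is finiteness of a nonnegative extended sum, and this is a
      measurable condition.\<close>
    have "summable (\<lambda>k. (f k \<omega>)\<^sup>2) \<longleftrightarrow> (\<Sum>k. ennreal ((f k \<omega>)\<^sup>2)) \<noteq> \<top>" for \<omega>
    proof
      assume "summable (\<lambda>k. (f k \<omega>)\<^sup>2)"
      then show "(\<Sum>k. ennreal ((f k \<omega>)\<^sup>2)) \<noteq> \<top>" by (rule ennreal_suminf_neq_top) simp
    next
      assume "(\<Sum>k. ennreal ((f k \<omega>)\<^sup>2)) \<noteq> \<top>"
      then show "summable (\<lambda>k. (f k \<omega>)\<^sup>2)" by (rule summable_suminf_not_top[rotated]) simp
    qed
    then have "G = {\<omega> \<in> space M. (\<Sum>k. ennreal ((f k \<omega>)\<^sup>2)) \<noteq> \<top>}" by (simp add: G_def)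
    also have "\<dots> \<in> sets M" by measurable
    finally show ?thesis .
  qed
  show ?thesis
  proof (rule borel_measurable_LIMSEQ_metric)
    fix n :: nat
    show "(\<lambda>\<omega>. indicator G \<omega> *\<^sub>R (\<Sum>k<n. f k \<omega> *\<^sub>R e k)) \<in> borel_measurable M"
      by measurable
  next
    fix \<omega> assume \<omega>: "\<omega> \<in> space M"
    show "(\<lambda>n. indicator G \<omega> *\<^sub>R (\<Sum>k<n. f k \<omega> *\<^sub>R e k)) \<longlonglongrightarrow> vec (\<lambda>k. f k \<omega>)"
    proof (cases "\<omega> \<in> G")
      case True
      then show ?thesis using basis_series_sums[of "\<lambda>k. f k \<omega>"] by (simp add: G_def sums_def)
    next
      case False
      then show ?thesis using \<omega> by (simp add: G_def vec_def)
    qed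
  qed
qed

end

lemma summable_square_weighted:
  fixes a w :: "nat \<Rightarrow> real"
  assumes "summable (\<lambda>k. (a k)\<^sup>2)" "\<And>k. \<bar>w k\<bar> \<le> c"
  shows "summable (\<lambda>k. (w k * a k)\<^sup>2)"
proof (rule summable_comparison_test'[where g="\<lambda>k. c\<^sup>2 * (a k)\<^sup>2" and N=0])
  show "summable (\<lambda>k. c\<^sup>2 * (a k)\<^sup>2)" using assms(1) by (rule summable_mult)
  fix k
  have "(w k)\<^sup>2 \<le> c\<^sup>2" using assms(2)[of k] by (metis abs_ge_zero power2_abs power_mono)
  then show "norm ((w k * a k)\<^sup>2) \<le> c\<^sup>2 * (a k)\<^sup>2" by (simp add: power_mult_distrib mult_right_mono)
qed

section \<open>The heat semigroup and its leading modes\<close>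

locale heat = orthonormal_basis e for e :: "nat \<Rightarrow> 'a::{real_inner, polish_space}" +
  fixes lam :: "nat \<Rightarrow> real"
  assumes lam0: "0 < lam 0" and lam_mono: "mono lam" and lam_top: "filterlim lam at_top sequentially"
begin

lemma lam_ge: "lam 0 \<le> lam k"
  using lam_mono by (simp add: monoD)

lemma lam_pos: "0 < lam k"
  using lam0 lam_ge[of k] by simp

lemma inner_heat_sg:
  assumes "0 \<le> t"
  shows "inner (e k) (heat_sg e lam t h) = exp (- lam k * t) * inner (e k) h"
proof -
  have "\<bar>exp (- lam k * t)\<bar> \<le> 1" for k using assms lam_pos[of k] by simp
  then have s: "summable (\<lambda>k. (exp (- lam k * t) * inner (e k) h)\<^sup>2)"
    by (intro summable_square_weighted sums_summable[OF coordinates_sums])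
  have "heat_sg e lam t h = vec (\<lambda>k. exp (- lam k * t) * inner (e k) h)"
    using s by (simp add: heat_sg_def vec_def)
  then show ?thesis using coordinate_vec[OF s] by simp
qed

lemma Nidx_in_Kset:
  assumes "h \<noteq> 0" shows "Nidx e h \<in> Kset e h"
proof -
  have "\<exists>k. k \<in> Kset e h"
    using eq_if_coordinates_eq[of h 0] assms by (auto simp: Kset_def)
  then show ?thesis unfolding Nidx_def by (metis LeastI)
qed

lemma Nidx_le: "k \<in> Kset e h \<Longrightarrow> Nidx e h \<le> k"
  unfolding Nidx_def by (rule Least_le)

lemma finite_lam_le: "finite {k. lam k \<le> c}"
proof -
  have "eventually (\<lambda>k. c + 1 \<le> lam k) sequentially"
    using lam_top by (simp add: filterlim_at_top)
  then obtain N where "\<And>k. N \<le> k \<Longrightarrow> c + 1 \<le> lam k" by (auto simp: eventually_sequentially)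
  then have "{k. lam k \<le> c} \<subseteq> {..<N}"
    by (auto simp: not_le[symmetric]) fastforce
  then show ?thesis by (rule finite_subset) simp
qed

lemma finite_Mset: "finite (Mset e lam h)"
  by (rule finite_subset[OF _ finite_lam_le[of "lam (Nidx e h)"]]) (auto simp: Mset_def)

lemma inner_vvec: "inner (e k) (vvec e lam h) = (if k \<in> Mset e lam h then inner (e k) h else 0)"
  unfolding vvec_def by (rule inner_basis_sum[OF finite_Mset])

lemma vvec_nonzero:
  assumes "h \<noteq> 0" shows "vvec e lam h \<noteq> 0"
proof
  assume "vvec e lam h = 0"
  then have "inner (e (Nidx e h)) (vvec e lam h) = 0" by simp
  then show False
    using Nidx_in_Kset[OF assms] unfolding inner_vvec by (auto simp: Mset_def Kset_def)
qed

text \<open>Only finitely many eigenvalues lie in (c, c + 1], because they tend to infinity; the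
  inserted 1 serves those beyond and keeps the minimum defined if there are none.\<close>

lemma spectral_gap:
  obtains \<gamma> where "0 < \<gamma>" "\<And>k. lam k > c \<Longrightarrow> c + \<gamma> \<le> lam k"
proof -
  define A where "A = (\<lambda>k. lam k - c) ` {k. lam k \<le> c + 1 \<and> c < lam k}"
  have "finite A"
    unfolding A_def by (intro finite_imageI finite_subset[OF _ finite_lam_le[of "c + 1"]]) auto
  show ?thesis
  proof
    show "0 < Min (insert 1 A)" using \<open>finite A\<close> by (auto simp: A_def)
    fix k assume "lam k > c"
    show "c + Min (insert 1 A) \<le> lam k"
    proof (cases "lam k \<le> c + 1")
      case True
      then have "Min (insert 1 A) \<le> lam k - c"
        using \<open>finite A\<close> \<open>lam k > c\<close> by (intro Min_le) (auto simp: A_def)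
      then show ?thesis by simp
    next
      case False
      have "Min (insert 1 A) \<le> 1" using \<open>finite A\<close> by (intro Min_le) auto
      then show ?thesis using False by simp
    qed
  qed
qed

lemma filterlim_log_time:
  fixes N \<rho> :: real
  assumes N: "0 < N"
  shows "filterlim (\<lambda>\<epsilon>. \<bar>ln \<epsilon>\<bar> / N + \<rho>) at_top (at_right (0::real))"
proof -
  have "filterlim (\<lambda>\<epsilon>. - ln \<epsilon>) at_top (at_right (0::real))"
    using ln_at_0 by (simp add: filterlim_uminus_at_top)
  then have "filterlim (\<lambda>\<epsilon>. \<bar>ln \<epsilon>\<bar>) at_top (at_right (0::real))"
    by (rule filterlim_at_top_mono) (auto intro!: always_eventually)
  then have "filterlim (\<lambda>\<epsilon>. \<rho> + (1 / N) * \<bar>ln \<epsilon>\<bar>) at_top (at_right 0)"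
    using N by (intro filterlim_tendsto_add_at_top[OF tendsto_const]
        filterlim_tendsto_pos_mult_at_top[OF tendsto_const]) auto
  then show ?thesis by (simp add: add.commute)
qed

text \<open>At this time the factor 1 / \<epsilon> cancels the decay of the eigenvalue
  \<open>N\<close> up to exp (- \<rho> N). Modes in \<open>Mset\<close> therefore already sit at
  their limit, smaller eigenvalues are absent from \<open>h\<close> by the choice of
  \<open>Nidx\<close>, and the remaining modes carry a factor exp (- \<gamma> T) from the spectral
  gap, uniformly in k.\<close>

lemma rescaled_heat_sg_tendsto:
  fixes h :: 'a and \<rho> :: real
  assumes h: "h \<noteq> 0"
  defines "N \<equiv> lam (Nidx e h)"
  shows "((\<lambda>\<epsilon>. (1 / \<epsilon>) *\<^sub>R heat_sg e lam (\<bar>ln \<epsilon>\<bar> / N + \<rho>) h) \<longlongrightarrow> exp (- \<rho> * N) *\<^sub>R vvec e lam h) (at_right 0)"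
proof -
  have N: "0 < N" by (simp add: N_def lam_pos)
  obtain \<gamma> where \<gamma>: "0 < \<gamma>" "\<And>k. lam k > N \<Longrightarrow> N + \<gamma> \<le> lam k"
    by (rule spectral_gap[of N]) blast
  define T where "T \<epsilon> = \<bar>ln \<epsilon>\<bar> / N + \<rho>" for \<epsilon> :: real
  have T: "filterlim T at_top (at_right 0)"
    unfolding T_def[abs_def] by (rule filterlim_log_time[OF N])
  have ev: "eventually (\<lambda>\<epsilon>. 0 \<le> T \<epsilon> \<and> 0 < \<epsilon> \<and> \<epsilon> < 1) (at_right (0::real))"
    using T by (auto simp: filterlim_at_top eventually_conj_iff eventually_at_right_less intro: eventually_at_rightI[of 0 1])
  have bd: "dist ((1 / \<epsilon>) *\<^sub>R heat_sg e lam (T \<epsilon>) h) (exp (- \<rho> * N) *\<^sub>R vvec e lam h)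
      \<le> exp (- \<rho> * N) * exp (- \<gamma> * T \<epsilon>) * norm h" if \<epsilon>: "0 \<le> T \<epsilon>" "0 < \<epsilon>" "\<epsilon> < 1" for \<epsilon>
    unfolding dist_norm
  proof (rule norm_le_if_coordinates_le)
    fix k
    have N\<epsilon>: "exp (- N * T \<epsilon>) = \<epsilon> * exp (- \<rho> * N)"
    proof -
      have "- N * T \<epsilon> = ln \<epsilon> + - \<rho> * N" using \<epsilon> N by (simp add: T_def field_simps)
      then show ?thesis using \<epsilon> by (simp only: exp_add) simp
    qed
    have split: "exp (- lam k * T \<epsilon>) = \<epsilon> * exp (- \<rho> * N) * exp (- (lam k - N) * T \<epsilon>)"
      unfolding N\<epsilon>[symmetric] exp_add[symmetric] by (simp add: algebra_simps)
    define E F where "E = exp (- (lam k - N) * T \<epsilon>)" and "F = exp (- \<rho> * N)"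
    have "inner (e k) ((1 / \<epsilon>) *\<^sub>R heat_sg e lam (T \<epsilon>) h - F *\<^sub>R vvec e lam h)
        = F * (E - (if k \<in> Mset e lam h then 1 else 0)) * inner (e k) h"
      unfolding inner_diff_right inner_scaleR_right inner_heat_sg[OF \<epsilon>(1)] inner_vvec split
        E_def[symmetric] F_def[symmetric]
      using \<epsilon> by (auto simp: algebra_simps)
    then have coord: "\<bar>inner (e k) ((1 / \<epsilon>) *\<^sub>R heat_sg e lam (T \<epsilon>) h - F *\<^sub>R vvec e lam h)\<bar>
        = F * \<bar>E - (if k \<in> Mset e lam h then 1 else 0)\<bar> * \<bar>inner (e k) h\<bar>"
      by (simp add: abs_mult F_def)
    show "\<bar>inner (e k) ((1 / \<epsilon>) *\<^sub>R heat_sg e lam (T \<epsilon>) h - exp (- \<rho> * N) *\<^sub>R vvec e lam h)\<bar>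
       \<le> exp (- \<rho> * N) * exp (- \<gamma> * T \<epsilon>) * \<bar>inner (e k) h\<bar>"
      unfolding F_def[symmetric] coord
    proof (cases "k \<in> Mset e lam h \<or> k \<notin> Kset e h")
      case True
      then show "F * \<bar>E - (if k \<in> Mset e lam h then 1 else 0)\<bar> * \<bar>inner (e k) h\<bar>
          \<le> F * exp (- \<gamma> * T \<epsilon>) * \<bar>inner (e k) h\<bar>"
      proof
        assume k: "k \<in> Mset e lam h"
        then have "E = 1" by (simp add: E_def N_def Mset_def)
        with k show ?thesis by (simp add: F_def)
      qed (simp add: Kset_def)
    next
      case False
      \<comment> \<open>An index of \<open>Kset\<close> lies at or above \<open>Nidx\<close>, so
        monotonicity of \<open>lam\<close> gives N \<le> lam k; outside \<open>Mset\<close> the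
        inequality is strict.\<close>
      then have "N \<noteq> lam k" by (auto simp: Mset_def N_def)
      moreover have "N \<le> lam k" unfolding N_def using Nidx_le[of k h] False lam_mono by (auto simp: monoD)
      ultimately have "N < lam k" by simp
      then have "E \<le> exp (- \<gamma> * T \<epsilon>)"
        unfolding E_def exp_le_cancel_iff
        using mult_right_mono[of \<gamma> "lam k - N" "T \<epsilon>"] \<gamma>(2)[of k] \<epsilon> by (simp add: algebra_simps)
      moreover have "0 \<le> E" "0 \<le> F" by (simp_all add: E_def F_def)
      ultimately show "F * \<bar>E - (if k \<in> Mset e lam h then 1 else 0)\<bar> * \<bar>inner (e k) h\<bar>
          \<le> F * exp (- \<gamma> * T \<epsilon>) * \<bar>inner (e k) h\<bar>"
        using False by (intro mult_right_mono mult_left_mono) auto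
    qed
  qed simp
  have "((\<lambda>\<epsilon>. exp (- \<rho> * N) * exp (- \<gamma> * T \<epsilon>) * norm h) \<longlongrightarrow> exp (- \<rho> * N) * 0 * norm h) (at_right 0)"
    using \<gamma>(1)
    by (intro tendsto_intros filterlim_compose[OF exp_at_bot] filterlim_tendsto_neg_mult_at_bot[OF tendsto_const _ T]) auto
  then have lim: "((\<lambda>\<epsilon>. exp (- \<rho> * N) * exp (- \<gamma> * T \<epsilon>) * norm h) \<longlongrightarrow> 0) (at_right 0)" by simp
  show ?thesis
    unfolding T_def[symmetric]
    by (rule metric_tendsto_imp_tendsto[OF lim]) (use ev bd in \<open>auto elim!: eventually_mono simp: \<gamma>\<close>)
qed

end

section \<open>A Lyapunov function for sums of independent vectors\<close>

lemma exp_le_quadratic: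
  fixes w c :: real
  assumes "\<bar>w\<bar> \<le> c"
  shows "exp w \<le> 1 + w + exp c / 2 * w\<^sup>2"
proof -
  obtain t where t: "\<bar>t\<bar> \<le> \<bar>w\<bar>" "exp w = (\<Sum>m<2. w ^ m / fact m) + exp t / fact 2 * w ^ 2"
    using Maclaurin_exp_le[of w 2] by blast
  have "exp t / 2 * w\<^sup>2 \<le> exp c / 2 * w\<^sup>2"
    using t(1) assms by (intro mult_right_mono divide_right_mono) auto
  then show ?thesis using t(2) by (simp add: numeral_2_eq_2)
qed

text \<open>A regularised power: for q = p / 2 it dominates |s|^p, it is smooth at 0 for every q >
  0, and it is at least 1, so that additive errors can be made multiplicative.\<close>

definition lyap :: "real \<Rightarrow> 'a::real_inner \<Rightarrow> real" where
  "lyap q s = (1 + (norm s)\<^sup>2) powr q"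

lemma one_le_lyap: "0 \<le> q \<Longrightarrow> 1 \<le> lyap q s"
  by (simp add: lyap_def ge_one_powr_ge_zero)

text \<open>The remainder of this second-order expansion is proportional to \<open>lyap q s\<close>
  itself, as a Gronwall argument requires. The linear term is kept exact, because for increments
  over a short time its mean is of smaller order than the mean of norm x.\<close>

lemma lyap_small_step:
  assumes q: "0 < q" and x: "norm x \<le> 1"
  shows "lyap q (s + x) \<le> lyap q s + 2 * q * (1 + (norm s)\<^sup>2) powr (q - 1) * inner s x
      + (q + 2 * q\<^sup>2 * exp (2 * q)) * lyap q s * (norm x)\<^sup>2"
proof -
  define a y where "a = 1 + (norm s)\<^sup>2" and "y = 2 * inner s x + (norm x)\<^sup>2"
  have a: "1 \<le> a" "0 < a" by (simp_all add: a_def add_pos_nonneg)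
  have eq: "1 + (norm (s + x))\<^sup>2 = a + y"
    by (simp add: a_def y_def power2_norm_eq_inner inner_add_left inner_add_right inner_commute)
  \<comment> \<open>The relative change z is at most 2 * norm x in modulus, since both the cross
    term and the square are measured against a = 1 + |s|^2.\<close>
  define z where "z = y / a"
  have "2 * norm s \<le> a"
    unfolding a_def using sum_squares_bound[of "norm s" 1] by (simp add: power2_eq_square)
  then have 1: "2 * norm s * norm x \<le> a * norm x" by (intro mult_right_mono) auto
  have 2: "(norm x)\<^sup>2 \<le> a * norm x"
    using mult_mono[of "norm x" a "norm x" "norm x"] x a by (simp add: power2_eq_square)
  have "\<bar>y\<bar> \<le> 2 * \<bar>inner s x\<bar> + (norm x)\<^sup>2" 
    unfolding y_def using abs_triangle_ineq[of "2 * inner s x" "(norm x)\<^sup>2"] by (simp add: abs_mult)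
  also have "\<dots> \<le> 2 * (norm s * norm x) + (norm x)\<^sup>2"
    using Cauchy_Schwarz_ineq2[of s x] by simp
  also have "\<dots> \<le> a * (2 * norm x)" using 1 2 by simp
  finally have z: "\<bar>z\<bar> \<le> 2 * norm x"
    using a by (simp add: z_def pos_divide_le_eq mult.commute)
  have "0 \<le> a + y" unfolding eq[symmetric] by simp
  then have z1: "0 \<le> 1 + z" using a by (simp add: z_def field_simps)
  have ay: "a + y = a * (1 + z)" using a by (simp add: z_def field_simps)
  \<comment> \<open>From 1 + z \<le> exp z the power is at most exp (q z), whose quadratic bound
    holds for all q > 0 and even where 1 + z is close to 0.\<close>
  have "(1 + z) powr q \<le> exp z powr q" using z1 q by (intro powr_mono2) auto
  also have "\<dots> = exp (q * z)" by (simp add: powr_def mult.commute)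
  also have "\<dots> \<le> 1 + q * z + exp (2 * q) / 2 * (q * z)\<^sup>2"
  proof (rule exp_le_quadratic)
    have "q * \<bar>z\<bar> \<le> q * 2" using q z x by (intro mult_left_mono) auto
    then show "\<bar>q * z\<bar> \<le> 2 * q" using q by (simp add: abs_mult)
  qed
  also have "(q * z)\<^sup>2 \<le> q\<^sup>2 * (4 * (norm x)\<^sup>2)"
    using mult_left_mono[OF power_mono[OF z, of 2], of "q\<^sup>2"] by (simp add: power_mult_distrib)
  finally have *: "(1 + z) powr q \<le> 1 + q * z + 2 * q\<^sup>2 * exp (2 * q) * (norm x)\<^sup>2"
    by (simp add: mult_left_mono algebra_simps)
  have "lyap q (s + x) = a powr q * (1 + z) powr q"
    using a z1 by (simp add: lyap_def eq ay powr_mult)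
  also have "\<dots> \<le> a powr q * (1 + q * z + 2 * q\<^sup>2 * exp (2 * q) * (norm x)\<^sup>2)"
    using * by (intro mult_left_mono) auto
  also have "\<dots> = a powr q + q * (a powr q / a) * y + 2 * q\<^sup>2 * exp (2 * q) * a powr q * (norm x)\<^sup>2"
    by (simp add: z_def algebra_simps)
  also have "a powr q / a = a powr (q - 1)" using a by (simp add: powr_diff)
  also have "q * a powr (q - 1) * y = 2 * q * a powr (q - 1) * inner s x + q * a powr (q - 1) * (norm x)\<^sup>2"
    by (simp add: y_def algebra_simps)
  also have "q * a powr (q - 1) * (norm x)\<^sup>2 \<le> q * a powr q * (norm x)\<^sup>2"
    using a q by (intro mult_right_mono mult_left_mono powr_mono) auto
  finally show ?thesis
    by (simp add: lyap_def a_def algebra_simps)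
qed

text \<open>For increments of norm above 1 this crude separation suffices, since they occur with a
  probability of order 1 / N.\<close>

lemma lyap_large_step:
  assumes q: "0 < q" and x: "norm x \<le> d" and d: "1 \<le> d"
  shows "lyap q (s + x) \<le> 4 powr q * (lyap q s + d powr (2 * q))"
proof -
  have "(norm (s + x))\<^sup>2 \<le> (norm s + d)\<^sup>2"
    using norm_triangle_ineq[of s x] x by (intro power_mono) auto
  also have "\<dots> \<le> 2 * (norm s)\<^sup>2 + 2 * d\<^sup>2"
    using sum_squares_bound[of "norm s" d] by (simp add: power2_eq_square algebra_simps)
  finally have "1 + (norm (s + x))\<^sup>2 \<le> 2 * (1 + (norm s)\<^sup>2) + 2 * d\<^sup>2" by simp
  then have "lyap q (s + x) \<le> (2 * (1 + (norm s)\<^sup>2) + 2 * d\<^sup>2) powr q"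
    unfolding lyap_def using q by (intro powr_mono2) (auto simp: add_nonneg_nonneg)
  also have "\<dots> \<le> 2 powr q * ((2 * (1 + (norm s)\<^sup>2)) powr q + (2 * d\<^sup>2) powr q)"
    using q by (intro powr_add_le) auto
  also have "\<dots> = (2 powr q * 2 powr q) * (lyap q s + (d\<^sup>2) powr q)"
    unfolding powr_mult lyap_def by (simp add: distrib_left mult.assoc)
  also have "2 powr q * 2 powr q = 4 powr q" by (simp add: powr_mult[symmetric])
  also have "(d\<^sup>2) powr q = d powr (2 * q)"
    using d by (simp add: powr_powr flip: powr_numeral)
  finally show ?thesis .
qed

section \<open>Lyapunov recursion along weighted partial sums\<close>

context orthonormal_basis
begin

definition diag :: "nat \<Rightarrow> (nat \<Rightarrow> real) \<Rightarrow> 'a \<Rightarrow> 'a" where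
  "diag n \<theta> x = (\<Sum>k<n. (\<theta> k * inner (e k) x) *\<^sub>R e k)"

lemma borel_measurable_diag[measurable]: "diag n \<theta> \<in> borel_measurable borel"
  unfolding diag_def[abs_def] by measurable

text \<open>The weights move to the state \<open>s\<close> and leave the bare projected increment,
  so one drift estimate, uniform in the direction, serves all weights.\<close>

lemma inner_diag: "inner s (diag n \<theta> x) = inner (diag n \<theta> s) (proj n x)"
proof -
  have "inner s (diag n \<theta> x) = (\<Sum>k<n. \<theta> k * inner (e k) x * inner s (e k))"
    unfolding diag_def inner_sum_right inner_scaleR_right ..
  also have "\<dots> = (\<Sum>k<n. \<theta> k * inner (e k) s * inner (e k) (proj n x))"
    by (intro sum.cong refl) (simp add: proj_def inner_basis_sum inner_commute)
  also have "\<dots> = inner (diag n \<theta> s) (proj n x)"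
    by (simp add: diag_def inner_sum_left)
  finally show ?thesis .
qed

lemma norm_diag_le:
  assumes "\<And>k. \<bar>\<theta> k\<bar> \<le> c"
  shows "norm (diag n \<theta> x) \<le> c * norm (proj n x)"
proof (rule norm_le_if_coordinates_le)
  show "0 \<le> c" using assms[of 0] by simp
  fix k
  show "\<bar>inner (e k) (diag n \<theta> x)\<bar> \<le> c * \<bar>inner (e k) (proj n x)\<bar>"
    unfolding diag_def proj_def using assms[of k]
    by (simp add: inner_basis_sum abs_mult mult_right_mono)
qed

text \<open>Small increments use the expansion, intermediate ones the crude separation, and those
  beyond \<open>R\<close> are dropped here, to be charged to a rare event later. For fixed
  \<open>s\<close> every term on the right is bounded in \<open>d\<close>, hence integrable under
  any law.\<close>

lemma lyap_truncated_step:
  assumes q: "0 < q" and R: "1 \<le> R" and \<theta>: "\<And>k. \<bar>\<theta> k\<bar> \<le> 1"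
  shows "lyap q (s + (if norm (proj n d) \<le> R then diag n \<theta> d else 0))
    \<le> lyap q s + 2 * q * (1 + (norm s)\<^sup>2) powr (q - 1)
          * (inner (diag n \<theta> s) (proj n d) * indicator {x. norm (proj n x) \<le> 1} d)
        + (q + 2 * q\<^sup>2 * exp (2 * q) + 4 powr q) * (lyap q s * min 1 ((norm (proj n d))\<^sup>2)
          + norm (proj n d) powr (2 * q) * indicator {x. 1 < norm (proj n x) \<and> norm (proj n x) \<le> R} d)"
proof -
  define y K where "y = norm (proj n d)" and "K = q + 2 * q\<^sup>2 * exp (2 * q)"
  have K: "0 \<le> K" using q by (simp add: K_def)
  have x: "norm (diag n \<theta> d) \<le> y" using norm_diag_le[where \<theta> = \<theta> and n = n and x = d and c = 1, OF \<theta>] by (simp add: y_def)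
  have y0: "0 \<le> y" by (simp add: y_def)
  have V: "0 \<le> lyap q s" by (simp add: lyap_def)
  consider "y \<le> 1" | "1 < y" "y \<le> R" | "R < y" by linarith
  then show ?thesis
  proof cases
    case 1
    have "lyap q (s + diag n \<theta> d) \<le> lyap q s + 2 * q * (1 + (norm s)\<^sup>2) powr (q - 1) * inner s (diag n \<theta> d)
      + K * lyap q s * (norm (diag n \<theta> d))\<^sup>2"
      unfolding K_def by (rule lyap_small_step) (use q x 1 in auto)
    also have "K * lyap q s * (norm (diag n \<theta> d))\<^sup>2 \<le> K * lyap q s * y\<^sup>2"
      using K V x by (intro mult_left_mono power_mono) auto
    also have "\<dots> \<le> (K + 4 powr q) * (lyap q s * y\<^sup>2)"
      using V by (simp add: algebra_simps)
    finally show ?thesis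
      using 1 R y0 power_le_one[of y 2]
      by (simp add: y_def[symmetric] K_def[symmetric] inner_diag min_def)
  next
    case 2
    have "lyap q (s + diag n \<theta> d) \<le> 4 powr q * (lyap q s + y powr (2 * q))"
      using q x 2 by (intro lyap_large_step) auto
    also have "\<dots> \<le> lyap q s + (K + 4 powr q) * (lyap q s + y powr (2 * q))"
      using V K by (simp add: algebra_simps)
    finally show ?thesis
      using 2 by (simp add: y_def[symmetric] K_def[symmetric] min_def one_le_power)
  next
    case 3
    have "0 \<le> (K + 4 powr q) * (lyap q s * min 1 (y\<^sup>2))" using K V by simp
    then show ?thesis
      using 3 R by (simp add: y_def[symmetric] K_def[symmetric])
  qed
qed

text \<open>All error terms become multiples of \<open>lyap q s\<close>, so one step multiplies the
  mean by 1 + const * c. In the application \<open>c\<close> is of order 1 / N.\<close>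

lemma lyap_expectation_step:
  assumes \<rho>: "prob_space \<rho>" "sets \<rho> = sets borel"
    and q: "0 < q" and R: "1 \<le> R" and \<theta>: "\<And>k. \<bar>\<theta> k\<bar> \<le> 1"
    and A: "(\<integral>d. min 1 ((norm (proj n d))\<^sup>2) \<partial>\<rho>) \<le> c"
    and B: "\<And>v. \<bar>\<integral>d. inner v (proj n d) * indicator {x. norm (proj n x) \<le> 1} d \<partial>\<rho>\<bar> \<le> c * norm v"
    and C: "(\<integral>d. norm (proj n d) powr (2 * q) * indicator {x. 1 < norm (proj n x) \<and> norm (proj n x) \<le> R} d \<partial>\<rho>) \<le> c"
  shows "(\<integral>\<^sup>+d. ennreal (lyap q (s + (if norm (proj n d) \<le> R then diag n \<theta> d else 0))) \<partial>\<rho>)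
    \<le> ennreal (lyap q s * (1 + 2 * (q + (q + 2 * q\<^sup>2 * exp (2 * q) + 4 powr q)) * c))"
proof -
  interpret prob_space \<rho> by fact
  note [measurable_cong] = \<rho>(2)
  define K where "K = q + 2 * q\<^sup>2 * exp (2 * q) + 4 powr q"
  have K: "0 \<le> K" using q by (simp add: K_def)
  have c: "0 \<le> c" by (rule order_trans[OF _ A]) (simp add: integral_nonneg_AE)
  define a where "a = 1 + (norm s)\<^sup>2"
  have a: "1 \<le> a" by (simp add: a_def)
  have V: "1 \<le> lyap q s" using q by (intro one_le_lyap) auto
  have i1: "integrable \<rho> (\<lambda>d. min 1 ((norm (proj n d))\<^sup>2))"
    by (rule integrable_const_bound[of _ 1]) auto
  have i2: "integrable \<rho> (\<lambda>d. inner v (proj n d) * indicator {x. norm (proj n x) \<le> 1} d)" for v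
  proof (rule integrable_const_bound[of _ "norm v"])
    show "AE d in \<rho>. norm (inner v (proj n d) * indicator {x. norm (proj n x) \<le> 1} d) \<le> norm v"
      using Cauchy_Schwarz_ineq2[of v "proj n _"] mult_left_mono[of "norm (proj n _)" 1 "norm v"]
      by (intro AE_I2) (auto simp: indicator_def intro: order_trans)
  qed measurable
  have i3: "integrable \<rho> (\<lambda>d. norm (proj n d) powr (2 * q) * indicator {x. 1 < norm (proj n x) \<and> norm (proj n x) \<le> R} d)"
  proof (rule integrable_const_bound[of _ "R powr (2 * q)"])
    show "AE d in \<rho>. norm (norm (proj n d) powr (2 * q) * indicator {x. 1 < norm (proj n x) \<and> norm (proj n x) \<le> R} d) \<le> R powr (2 * q)"
      using q by (intro AE_I2) (auto simp: indicator_def powr_mono2)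
  qed measurable
  define F where "F d = lyap q s + 2 * q * a powr (q - 1)
          * (inner (diag n \<theta> s) (proj n d) * indicator {x. norm (proj n x) \<le> 1} d)
        + K * (lyap q s * min 1 ((norm (proj n d))\<^sup>2)
          + norm (proj n d) powr (2 * q) * indicator {x. 1 < norm (proj n x) \<and> norm (proj n x) \<le> R} d)" for d
  have le: "lyap q (s + (if norm (proj n d) \<le> R then diag n \<theta> d else 0)) \<le> F d" for d
    unfolding F_def K_def a_def by (rule lyap_truncated_step[OF q R \<theta>])
  have F0: "0 \<le> F d" for d
    using order_trans[OF _ le[of d], of 0] by (simp add: lyap_def)
  have Fi: "integrable \<rho> F"
    unfolding F_def using i1 i2 i3 by (intro Bochner_Integration.integrable_add integrable_mult_right) auto
  have "(\<integral>\<^sup>+d. ennreal (lyap q (s + (if norm (proj n d) \<le> R then diag n \<theta> d else 0))) \<partial>\<rho>) \<le> (\<integral>\<^sup>+d. ennreal (F d) \<partial>\<rho>)"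
    by (intro nn_integral_mono ennreal_leI le)
  also have "\<dots> = ennreal (\<integral>d. F d \<partial>\<rho>)"
    using F0 by (intro nn_integral_eq_integral Fi) auto
  also have "(\<integral>d. F d \<partial>\<rho>) = lyap q s + 2 * q * a powr (q - 1)
          * (\<integral>d. inner (diag n \<theta> s) (proj n d) * indicator {x. norm (proj n x) \<le> 1} d \<partial>\<rho>)
        + K * (lyap q s * (\<integral>d. min 1 ((norm (proj n d))\<^sup>2) \<partial>\<rho>)
          + (\<integral>d. norm (proj n d) powr (2 * q) * indicator {x. 1 < norm (proj n x) \<and> norm (proj n x) \<le> R} d \<partial>\<rho>))"
    unfolding F_def using i1 i2 i3 by (simp add: prob_space)
  also have "\<dots> \<le> lyap q s + 2 * q * a powr (q - 1) * (c * norm s) + K * (lyap q s * c + c)"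
  proof (intro add_mono mult_left_mono A C)
    have "\<bar>\<integral>d. inner (diag n \<theta> s) (proj n d) * indicator {x. norm (proj n x) \<le> 1} d \<partial>\<rho>\<bar>
        \<le> c * norm (diag n \<theta> s)" by (rule B)
    also have "\<dots> \<le> c * norm s"
      using norm_diag_le[where \<theta> = \<theta> and n = n and x = s and c = 1, OF \<theta>] norm_proj_le[of n s] c by (intro mult_left_mono) auto
    finally show "(\<integral>d. inner (diag n \<theta> s) (proj n d) * indicator {x. norm (proj n x) \<le> 1} d \<partial>\<rho>) \<le> c * norm s"
      by simp
  qed (use q K V order_trans[OF zero_le_one V] in auto)
  also have "\<dots> \<le> lyap q s + 2 * q * (lyap q s * c) + K * (lyap q s * c + lyap q s * c)"
  proof (intro add_mono mult_left_mono order_refl K)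
    \<comment> \<open>The drift enters with a^(q - 1) |s|, and this is at most a^q =
      \<open>lyap q s\<close> because |s| \<le> 1 + |s|^2.\<close>
    have "norm s \<le> a"
      unfolding a_def using sum_squares_bound[of "norm s" 1] norm_ge_zero[of s]
      by (simp only: power2_eq_square)
    then have "a powr (q - 1) * norm s \<le> a powr (q - 1) * a" by (intro mult_left_mono) auto
    also have "\<dots> = lyap q s" using a by (simp add: lyap_def a_def[symmetric] powr_diff)
    finally have "2 * q * c * (a powr (q - 1) * norm s) \<le> 2 * q * c * lyap q s"
      using q c by (intro mult_left_mono) auto
    then show "2 * q * a powr (q - 1) * (c * norm s) \<le> 2 * q * (lyap q s * c)" by (simp add: ac_simps)
    show "c \<le> lyap q s * c" using mult_right_mono[OF V c] by simp
  qed (use V in simp)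
  also have "\<dots> = lyap q s * (1 + 2 * (q + K) * c)" by (simp add: algebra_simps)
  finally show ?thesis by (simp add: K_def ennreal_leI)
qed

text \<open>Gronwall in product form: by Fubini the last increment is integrated out with the
  previous partial sum frozen as the state \<open>s\<close>.\<close>

lemma lyap_sum_le:
  assumes \<rho>: "prob_space \<rho>" "sets \<rho> = sets borel"
    and q: "0 < q" and R: "1 \<le> R" and \<theta>: "\<And>j k. \<bar>\<theta> j k\<bar> \<le> 1"
    and A: "(\<integral>d. min 1 ((norm (proj n d))\<^sup>2) \<partial>\<rho>) \<le> c"
    and B: "\<And>v. \<bar>\<integral>d. inner v (proj n d) * indicator {x. norm (proj n x) \<le> 1} d \<partial>\<rho>\<bar> \<le> c * norm v"
    and C: "(\<integral>d. norm (proj n d) powr (2 * q) * indicator {x. 1 < norm (proj n x) \<and> norm (proj n x) \<le> R} d \<partial>\<rho>) \<le> c"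
  shows "(\<integral>\<^sup>+\<omega>. ennreal (lyap q (\<Sum>j<m. if norm (proj n (\<omega> j)) \<le> R then diag n (\<theta> j) (\<omega> j) else 0)) \<partial>PiM {..<m} (\<lambda>_. \<rho>))
    \<le> ennreal ((1 + 2 * (q + (q + 2 * q\<^sup>2 * exp (2 * q) + 4 powr q)) * c) ^ m)"
proof (induction m)
  case 0
  interpret prob_space \<rho> by fact
  interpret product_prob_space "\<lambda>_::nat. \<rho>" "{}" ..
  show ?case by (simp add: lyap_def P.emeasure_space_1)
next
  case (Suc m)
  interpret prob_space \<rho> by fact
  interpret product_sigma_finite "\<lambda>_::nat. \<rho>" ..
  note [measurable_cong] = \<rho>(2)
  define k where "k = 1 + 2 * (q + (q + 2 * q\<^sup>2 * exp (2 * q) + 4 powr q)) * c"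
  have "0 \<le> c" by (rule order_trans[OF _ A]) (simp add: integral_nonneg_AE)
  then have k: "0 \<le> k" using q by (simp add: k_def)
  have [measurable]: "lyap q \<in> borel_measurable borel" unfolding lyap_def[abs_def] by measurable
  let ?T = "\<lambda>j d. if norm (proj n d) \<le> R then diag n (\<theta> j) d else 0"
  have "(\<integral>\<^sup>+\<omega>. ennreal (lyap q (\<Sum>j<Suc m. ?T j (\<omega> j))) \<partial>PiM {..<Suc m} (\<lambda>_. \<rho>))
    = (\<integral>\<^sup>+\<omega>. \<integral>\<^sup>+d. ennreal (lyap q (\<Sum>j<Suc m. ?T j ((fun_upd \<omega> m d) j))) \<partial>\<rho> \<partial>PiM {..<m} (\<lambda>_. \<rho>))"
    unfolding lessThan_Suc by (subst product_nn_integral_insert) auto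
  also have "\<dots> = (\<integral>\<^sup>+\<omega>. \<integral>\<^sup>+d. ennreal (lyap q ((\<Sum>j<m. ?T j (\<omega> j)) + ?T m d)) \<partial>\<rho> \<partial>PiM {..<m} (\<lambda>_. \<rho>))"
    by (intro nn_integral_cong arg_cong[where f="\<lambda>x. ennreal (lyap q x)"]) (auto intro!: sum.cong)
  also have "\<dots> \<le> (\<integral>\<^sup>+\<omega>. ennreal (lyap q (\<Sum>j<m. ?T j (\<omega> j)) * k) \<partial>PiM {..<m} (\<lambda>_. \<rho>))"
    unfolding k_def by (intro nn_integral_mono lyap_expectation_step[OF \<rho> q R \<theta> A B C])
  also have "\<dots> = (\<integral>\<^sup>+\<omega>. ennreal (lyap q (\<Sum>j<m. ?T j (\<omega> j))) * ennreal k \<partial>PiM {..<m} (\<lambda>_. \<rho>))"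
    using k by (intro nn_integral_cong) (simp add: ennreal_mult' lyap_def)
  also have "\<dots> = (\<integral>\<^sup>+\<omega>. ennreal (lyap q (\<Sum>j<m. ?T j (\<omega> j))) \<partial>PiM {..<m} (\<lambda>_. \<rho>)) * ennreal k"
    by (rule nn_integral_multc) measurable
  also have "\<dots> \<le> ennreal (k ^ m) * ennreal k"
    using Suc.IH unfolding k_def by (intro mult_right_mono) auto
  also have "\<dots> = ennreal (k ^ Suc m)" using k by (simp add: ennreal_mult[symmetric] mult.commute)
  finally show ?case by (simp add: k_def)
qed

end

section \<open>Truncated moments of the increments from the characteristic function\<close>

text \<open>Off 0 the space is exhausted by the sets |x| > 1 / (k + 1), of finite mass by
  Chebyshev's inequality, and {0} is null. Fubini with Gaussian frequencies relies on this.\<close>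

lemma levy_measure_sigma_finite:
  fixes \<nu> :: "'a::{real_normed_vector, second_countable_topology} measure"
  assumes "levy_measure \<nu>"
  shows "sigma_finite_measure \<nu>"
proof
  have s[measurable_cong]: "sets \<nu> = sets borel" and z: "emeasure \<nu> {0} = 0"
    and f: "(\<integral>\<^sup>+ x. ennreal (min 1 ((norm x)\<^sup>2)) \<partial>\<nu>) < \<infinity>"
    using assms by (auto simp: levy_measure_def)
  have sp: "space \<nu> = UNIV" using sets_eq_imp_space_eq[OF s] by simp
  define A :: "nat \<Rightarrow> 'a set" where "A k = {x. inverse (Suc k) < norm x}" for k
  have A[measurable]: "A k \<in> sets \<nu>" for k unfolding A_def by measurable
  have fin: "emeasure \<nu> (A k) \<noteq> \<infinity>" for k
  proof -
    have "ennreal ((inverse (Suc k))\<^sup>2) * emeasure \<nu> (A k) = (\<integral>\<^sup>+x. ennreal ((inverse (Suc k))\<^sup>2) * indicator (A k) x \<partial>\<nu>)"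
      by (rule nn_integral_cmult_indicator[symmetric]) simp
    also have "\<dots> \<le> (\<integral>\<^sup>+ x. ennreal (min 1 ((norm x)\<^sup>2)) \<partial>\<nu>)"
    proof (intro nn_integral_mono)
      fix x :: 'a
      show "ennreal ((inverse (Suc k))\<^sup>2) * indicator (A k) x \<le> ennreal (min 1 ((norm x)\<^sup>2))"
      proof (cases "x \<in> A k")
        case True
        have "(inverse (real (Suc k)))\<^sup>2 \<le> 1\<^sup>2"
          by (rule power_mono) (simp_all add: inverse_le_1_iff)
        moreover have "(inverse (real (Suc k)))\<^sup>2 \<le> (norm x)\<^sup>2"
          using True by (intro power_mono) (auto simp: A_def)
        ultimately show ?thesis using True by (simp add: ennreal_leI)
      qed simp
    qed
    finally have "ennreal ((inverse (Suc k))\<^sup>2) * emeasure \<nu> (A k) < \<top>"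
      using f by (metis infinity_ennreal_def order.strict_trans1)
    then show ?thesis by (auto simp: ennreal_mult_less_top)
  qed
  show "\<exists>B. countable B \<and> B \<subseteq> sets \<nu> \<and> \<Union> B = space \<nu> \<and> (\<forall>a\<in>B. emeasure \<nu> a \<noteq> \<infinity>)"
  proof (intro exI[of _ "insert {0} (range A)"] conjI)
    show "\<Union> (insert {0} (range A)) = space \<nu>"
    proof -
      have "x \<in> \<Union> (insert {0} (range A))" for x :: 'a
      proof (cases "x = 0")
        case False
        then have "0 < norm x" by simp
        then obtain k where "inverse (Suc k) < norm x" using reals_Archimedean by blast
        then show ?thesis by (auto simp: A_def)
      qed simp
      then show ?thesis by (auto simp: sp)
    qed
  qed (use fin z A s in auto)
qed

text \<open>Mean value inequality on the half plane Re \<le> 0, where exp has modulus at most 1. It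
  supplies the dominating function when the mesh tends to 0.\<close>

lemma norm_one_minus_exp_le:
  fixes w :: complex
  assumes "Re w \<le> 0"
  shows "norm (1 - exp w) \<le> norm w"
proof -
  have "norm (exp w - exp 0) \<le> 1 * norm (w - 0)"
  proof (rule field_differentiable_bound[of "{z. Re z \<le> 0}" exp exp])
    show "convex {z. Re z \<le> 0}" by (rule convex_halfspace_Re_le)
  qed (use assms in \<open>auto intro: DERIV_exp has_field_derivative_at_within\<close>)
  then show ?thesis by (simp add: norm_minus_commute)
qed

text \<open>Recovers the exponent from the characteristic functions of increments over the N-th part
  of an interval.\<close>

lemma rescaled_one_minus_exp_tendsto:
  fixes z :: complex
  shows "(\<lambda>N. of_nat N * (1 - exp (z / of_nat N))) \<longlonglongrightarrow> - z"
proof (cases "z = 0")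
  case False
  have lim0: "(\<lambda>N. z / of_nat N) \<longlonglongrightarrow> 0"
    by (rule tendsto_divide_0[OF tendsto_const tendsto_of_nat])
  have "filterlim (\<lambda>N. z / of_nat N) (at 0) sequentially"
    using lim0 False by (intro filterlim_atI) (auto intro: eventually_sequentiallyI[of 1])
  from filterlim_compose[OF lim_exp_minus_1 this]
  have "(\<lambda>N. - z * ((exp (z / of_nat N) - 1) / (z / of_nat N))) \<longlonglongrightarrow> - z * 1"
    by (intro tendsto_mult tendsto_const)
  then show ?thesis
    by (rule Lim_transform_eventually[THEN tendsto_eq_rhs])
      (use False in \<open>auto intro!: eventually_sequentiallyI[of 1] simp: field_simps\<close>)
qed simp

lemma norm_cis_minus_one_le: "norm (cis a - 1) \<le> 2"
  using norm_triangle_ineq4[of "cis a" 1] by simp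

lemma norm_cis_quadratic_le: "norm (cis a - 1 - \<i> * complex_of_real a) \<le> a\<^sup>2 / 2"
  using iexp_approx1[of a 1] by (simp add: cis_conv_exp numeral_2_eq_2 algebra_simps)

section \<open>Gaussian frequencies\<close>

abbreviation gauss :: "nat \<Rightarrow> (nat \<Rightarrow> real) measure" where
  "gauss n \<equiv> PiM {..<n} (\<lambda>_. std_normal_distribution)"

interpretation std_normal: prob_space std_normal_distribution
  by (rule prob_space_normal_density) simp

interpretation gauss: product_prob_space "\<lambda>_::nat. std_normal_distribution" UNIV ..

lemma prob_space_gauss: "prob_space (gauss n)"
  by (intro prob_space_PiM std_normal.prob_space_axioms)

lemma gauss_char:
  "(\<integral>g. cis (\<Sum>k<n. a k * g k) \<partial>gauss n) = complex_of_real (exp (- (\<Sum>k<n. (a k)\<^sup>2) / 2))"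
proof -
  have int: "integrable std_normal_distribution (\<lambda>x. cis (a k * x))" for k
    by (rule std_normal.integrable_const_bound[of _ 1]) (auto simp: cis_conv_exp)
  have cis_sum: "cis (sum f A) = (\<Prod>k\<in>A. cis (f k))" if "finite A" for f :: "nat \<Rightarrow> real" and A
    using that by induction (auto simp: cis_mult[symmetric])
  have "(\<integral>g. cis (\<Sum>k<n. a k * g k) \<partial>gauss n) = (\<integral>g. (\<Prod>k<n. cis (a k * g k)) \<partial>gauss n)"
    by (simp add: cis_sum)
  also have "\<dots> = (\<Prod>k<n. \<integral>x. cis (a k * x) \<partial>std_normal_distribution)"
    by (rule gauss.product_integral_prod[of "{..<n}" "\<lambda>k x. cis (a k * x)"]) (use int in auto)
  also have "\<dots> = (\<Prod>k<n. complex_of_real (exp (- (a k)\<^sup>2 / 2)))"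
    using fun_cong[OF char_std_normal_distribution] by (simp add: char_def cis_conv_exp)
  also have "\<dots> = complex_of_real (exp (- (\<Sum>k<n. (a k)\<^sup>2) / 2))"
    by (simp add: exp_sum[symmetric] sum_negf sum_divide_distrib flip: of_real_prod)
  finally show ?thesis .
qed

lemma gauss_moment:
  assumes "k < n" "l < n"
  shows "integrable (gauss n) (\<lambda>g. g k * g l)" "(\<integral>g. g k * g l \<partial>gauss n) = (if k = l then 1 else 0)"
proof -
  \<comment> \<open>\<open>f\<close> writes the monomial g k * g l as a product over coordinates;
    for k = l both conditions fire in one factor and produce the square.\<close>
  define f :: "nat \<Rightarrow> real \<Rightarrow> real" where "f i x = (if i = k then x else 1) * (if i = l then x else 1)" for i x
  have sq: "integrable std_normal_distribution (\<lambda>x. x * x)" "(\<integral>x. x * x \<partial>std_normal_distribution) = 1"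
    using std_normal_distribution_even_moments[of 1] by (simp_all add: power2_eq_square)
  have lin: "integrable std_normal_distribution (\<lambda>x. x)" "(\<integral>x. x \<partial>std_normal_distribution) = 0"
    using integrable_std_normal_distribution_moment[of 1] integral_std_normal_distribution_moment_odd[of 1] by simp_all
  have int: "integrable std_normal_distribution (f i)" for i
    using sq(1) lin(1) by (cases "i = k"; cases "i = l") (auto simp: f_def[abs_def])
  have val: "(\<integral>x. f i x \<partial>std_normal_distribution) = (if i = k \<and> i = l then 1 else if i = k \<or> i = l then 0 else 1)" for i
    using sq(2) lin(2) by (cases "i = k"; cases "i = l") (auto simp: f_def std_normal.prob_space[simplified])
  have prod: "(\<Prod>i<n. f i (g i)) = g k * g l" for g
    using assms by (simp add: f_def prod.distrib)
  show "integrable (gauss n) (\<lambda>g. g k * g l)"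
    using gauss.product_integrable_prod[of "{..<n}" f] int by (simp add: prod)
  have "(\<integral>g. g k * g l \<partial>gauss n) = (\<Prod>i<n. \<integral>x. f i x \<partial>std_normal_distribution)"
    using gauss.product_integral_prod[of "{..<n}" f] int by (simp add: prod)
  also have "\<dots> = (if k = l then 1 else 0)"
  proof (cases "k = l")
    case True
    then show ?thesis by (auto simp: val intro!: prod.neutral)
  next
    case False
    then have "(\<integral>x. f k x \<partial>std_normal_distribution) = 0" by (simp add: val)
    then show ?thesis using assms False by (auto intro!: prod_zero)
  qed
  finally show "(\<integral>g. g k * g l \<partial>gauss n) = (if k = l then 1 else 0)" .
qed

section \<open>The Levy exponent and its Gaussian mean\<close>

locale levy_triplet = orthonormal_basis e for e :: "nat \<Rightarrow> 'a::{real_inner, polish_space}" +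
  fixes b :: 'a and Q :: "'a \<Rightarrow> 'a" and \<nu> :: "'a measure"
  assumes cov: "cov_operator e Q" and nu: "levy_measure \<nu>"
begin

sublocale nu: sigma_finite_measure \<nu>
  by (rule levy_measure_sigma_finite[OF nu])

lemma sets_nu[measurable_cong]: "sets \<nu> = sets borel"
  using nu by (simp add: levy_measure_def)

lemma integrable_min: "integrable \<nu> (\<lambda>x. min 1 ((norm x)\<^sup>2))"
  using nu by (intro integrableI_nonneg) (auto simp: levy_measure_def)

definition nu_mass :: real where "nu_mass = (\<integral>x. min 1 ((norm x)\<^sup>2) \<partial>\<nu>)"

lemma nu_mass_nonneg: "0 \<le> nu_mass"
  unfolding nu_mass_def by (simp add: integral_nonneg_AE)

definition integrand :: "'a \<Rightarrow> 'a \<Rightarrow> complex" where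
  "integrand u x = cis (inner u x) - 1 - \<i> * complex_of_real (inner u x * indicator (cball 0 1) x)"

lemma integrand_measurable[measurable]:
  "(\<lambda>(u, x). integrand u x) \<in> borel_measurable (borel \<Otimes>\<^sub>M borel)"
proof -
  have [measurable]: "(cball 0 1 :: 'a set) \<in> sets borel" by (rule borel_closed) simp
  show ?thesis unfolding integrand_def cis_conv_exp split_beta' by measurable
qed

lemma norm_integrand_le: "norm (integrand u x) \<le> (2 + (norm u)\<^sup>2) * min 1 ((norm x)\<^sup>2)"
proof (cases "norm x \<le> 1")
  case True
  have "norm (integrand u x) \<le> (inner u x)\<^sup>2 / 2"
    using True norm_cis_quadratic_le[of "inner u x"] by (simp add: integrand_def)
  also have "\<dots> \<le> (norm u * norm x)\<^sup>2"
    using power_mono[OF Cauchy_Schwarz_ineq2[of u x], of 2] zero_le_power2[of "norm u * norm x"]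
    by (simp only: power2_abs) linarith
  also have "\<dots> \<le> (2 + (norm u)\<^sup>2) * (norm x)\<^sup>2"
    by (simp add: power_mult_distrib mult_right_mono)
  finally show ?thesis using True power_le_one[of "norm x" 2] by (simp add: min_absorb2)
next
  case False
  have "norm (integrand u x) \<le> 2"
    using False norm_cis_minus_one_le[of "inner u x"] by (simp add: integrand_def)
  then have "norm (integrand u x) \<le> 2 + (norm u)\<^sup>2" using zero_le_power2[of "norm u"] by linarith
  then show ?thesis using False by (simp add: min_def one_le_power)
qed

lemma integrable_integrand: "integrable \<nu> (integrand u)"
proof (rule Bochner_Integration.integrable_bound[OF integrable_mult_right[OF integrable_min]])
  show "integrand u \<in> borel_measurable \<nu>"
    using measurable_compose_Pair1[OF _ integrand_measurable, of u] by (simp cong: measurable_cong_sets)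
  show "AE x in \<nu>. norm (integrand u x) \<le> norm ((2 + (norm u)\<^sup>2) * min 1 ((norm x)\<^sup>2))"
    using norm_integrand_le by (intro AE_I2) (auto simp: abs_mult)
qed

abbreviation psi :: "'a \<Rightarrow> complex" where "psi \<equiv> levy_exponent b Q \<nu>"

lemma psi_eq: "psi u = \<i> * complex_of_real (inner b u) - complex_of_real (inner (Q u) u / 2) + (\<integral>x. integrand u x \<partial>\<nu>)"
  by (simp add: levy_exponent_def integrand_def)

lemma borel_measurable_Q[measurable]: "Q \<in> borel_measurable borel"
  using cov by (intro borel_measurable_continuous_onI linear_continuous_on) (auto simp: cov_operator_def)

lemma borel_measurable_psi[measurable]: "psi \<in> borel_measurable borel"
proof -
  have "(\<lambda>u. \<integral>x. integrand u x \<partial>\<nu>) \<in> borel_measurable borel"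
    by (rule nu.borel_measurable_lebesgue_integral) (simp cong: measurable_cong_sets add: sets_pair_measure_cong[OF refl sets_nu])
  then show ?thesis unfolding psi_eq[abs_def] by measurable
qed

lemma norm_integral_integrand_le: "norm (\<integral>x. integrand u x \<partial>\<nu>) \<le> (2 + (norm u)\<^sup>2) * nu_mass"
proof -
  have "norm (\<integral>x. integrand u x \<partial>\<nu>) \<le> (\<integral>x. norm (integrand u x) \<partial>\<nu>)"
    by (rule integral_norm_bound)
  also have "\<dots> \<le> (\<integral>x. (2 + (norm u)\<^sup>2) * min 1 ((norm x)\<^sup>2) \<partial>\<nu>)"
    by (intro integral_mono integrable_norm integrable_integrand integrable_mult_right integrable_min norm_integrand_le)
  finally show ?thesis by (simp add: nu_mass_def)
qed

lemma one_minus_cos_eq: "1 - cos (inner u x) = - Re (integrand u x)"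
  by (simp add: integrand_def)

lemma integrable_one_minus_cos: "integrable \<nu> (\<lambda>x. 1 - cos (inner u x))"
  unfolding one_minus_cos_eq using integrable_Re[OF integrable_integrand] by simp

lemma Re_psi: "- Re (psi u) = inner (Q u) u / 2 + (\<integral>x. 1 - cos (inner u x) \<partial>\<nu>)"
  unfolding one_minus_cos_eq using integral_Re[OF integrable_integrand, of u] by (simp add: psi_eq)

lemma Re_psi_nonpos: "Re (psi u) \<le> 0"
proof -
  have "0 \<le> (\<integral>x. 1 - cos (inner u x) \<partial>\<nu>)" by (simp add: integral_nonneg_AE)
  moreover have "0 \<le> inner (Q u) u" using cov unfolding cov_operator_def by blast
  ultimately show ?thesis using Re_psi[of u] by linarith
qed

lemma Im_psi_le: "\<bar>Im (psi u)\<bar> \<le> norm b * norm u + (2 + (norm u)\<^sup>2) * nu_mass"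
proof -
  have "\<bar>Im (psi u)\<bar> \<le> \<bar>inner b u\<bar> + \<bar>Im (\<integral>x. integrand u x \<partial>\<nu>)\<bar>"
    by (simp add: psi_eq)
  also have "\<dots> \<le> norm b * norm u + norm (\<integral>x. integrand u x \<partial>\<nu>)"
    by (intro add_mono Cauchy_Schwarz_ineq2 abs_Im_le_cmod)
  finally show ?thesis using norm_integral_integrand_le[of u] by linarith
qed

text \<open>Quadratic growth makes the exponent integrable over Gaussian frequencies.\<close>

lemma norm_psi_le:
  obtains K where "0 \<le> K" "\<And>u. norm (psi u) \<le> K * (1 + (norm u)\<^sup>2)"
proof -
  obtain q where q: "\<And>x. norm (Q x) \<le> norm x * q" "0 \<le> q"
    using cov bounded_linear.nonneg_bounded unfolding cov_operator_def by blast
  show ?thesis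
  proof
    show "0 \<le> norm b + q + 2 * nu_mass" using q nu_mass_nonneg by simp
    fix u
    have "norm (psi u) \<le> \<bar>inner b u\<bar> + \<bar>inner (Q u) u / 2\<bar> + norm (\<integral>x. integrand u x \<partial>\<nu>)"
      unfolding psi_eq
      by (rule order_trans[OF norm_triangle_ineq add_mono[OF order_trans[OF norm_triangle_ineq4] order_refl]])
        (simp add: norm_mult del: of_real_divide)
    also have "\<dots> \<le> norm b * (1 + (norm u)\<^sup>2) + q * (1 + (norm u)\<^sup>2) + 2 * nu_mass * (1 + (norm u)\<^sup>2)"
    proof (intro add_mono)
      have "norm u \<le> 1 + (norm u)\<^sup>2"
        using sum_squares_bound[of "norm u" 1] norm_ge_zero[of u]
        by (simp only: power2_eq_square)
      then show "\<bar>inner b u\<bar> \<le> norm b * (1 + (norm u)\<^sup>2)"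
        by (intro order_trans[OF Cauchy_Schwarz_ineq2]) (intro mult_left_mono; simp)
      have "\<bar>inner (Q u) u\<bar> \<le> norm (Q u) * norm u" by (rule Cauchy_Schwarz_ineq2)
      also have "\<dots> \<le> norm u * q * norm u" by (intro mult_right_mono q) simp
      also have "\<dots> = q * (norm u)\<^sup>2" by (simp add: power2_eq_square)
      finally show "\<bar>inner (Q u) u / 2\<bar> \<le> q * (1 + (norm u)\<^sup>2)" using q by (simp add: algebra_simps)
      have "(2 + (norm u)\<^sup>2) * nu_mass \<le> 2 * nu_mass * (1 + (norm u)\<^sup>2)"
        using nu_mass_nonneg by (simp add: algebra_simps)
      then show "norm (\<integral>x. integrand u x \<partial>\<nu>) \<le> 2 * nu_mass * (1 + (norm u)\<^sup>2)"
        using norm_integral_integrand_le[of u] by linarith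
    qed
    finally show "norm (psi u) \<le> (norm b + q + 2 * nu_mass) * (1 + (norm u)\<^sup>2)"
      by (simp add: distrib_right)
  qed
qed


text \<open>For s \<ge> 0 a Gaussian vector with covariance \<open>s\<close> times the identity on
  the span of the first \<open>n\<close> basis vectors. No such vector exists in the whole space,
  which is why all estimates concern \<open>proj n\<close>, with constants free of
  \<open>n\<close>.\<close>

definition gvec :: "nat \<Rightarrow> real \<Rightarrow> (nat \<Rightarrow> real) \<Rightarrow> 'a" where
  "gvec n s g = sqrt s *\<^sub>R (\<Sum>k<n. g k *\<^sub>R e k)"

text \<open>One minus the Laplace kernel of |P_n x|^2; it arises as the mean of 1 - cos <u, x> over
  the Gaussian frequency u.\<close>

definition damp :: "nat \<Rightarrow> real \<Rightarrow> 'a \<Rightarrow> real" where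
  "damp n s x = 1 - exp (- s * (norm (proj n x))\<^sup>2 / 2)"

text \<open>The Gaussian mean of - Re psi: a partial trace from \<open>Q\<close> and an integral
  from the jumps.\<close>

definition kappa :: "nat \<Rightarrow> real \<Rightarrow> real" where
  "kappa n s = s / 2 * (\<Sum>k<n. inner (Q (e k)) (e k)) + (\<integral>x. damp n s x \<partial>\<nu>)"

lemma gvec_measurable[measurable]: "gvec n s \<in> borel_measurable (gauss n)"
  unfolding gvec_def[abs_def] by measurable

lemma damp_measurable[measurable]: "damp n s \<in> borel_measurable borel"
  unfolding damp_def[abs_def] by measurable

lemma damp_nonneg: "0 \<le> s \<Longrightarrow> 0 \<le> damp n s x"
  by (simp add: damp_def)

lemma damp_le_one: "damp n s x \<le> 1"
  by (simp add: damp_def)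

lemma inner_gvec: "inner (gvec n s g) x = (\<Sum>k<n. (sqrt s * inner (e k) x) * g k)"
  by (simp add: gvec_def inner_sum_left sum_distrib_left ac_simps)

lemma norm_gvec:
  assumes "0 \<le> s"
  shows "(norm (gvec n s g))\<^sup>2 = s * (\<Sum>k<n. g k * g k)"
  using assms by (simp add: gvec_def power_mult_distrib norm_basis_sum power2_eq_square[symmetric])

lemma integrable_norm_gvec:
  assumes "0 \<le> s"
  shows "integrable (gauss n) (\<lambda>g. (norm (gvec n s g))\<^sup>2)"
  unfolding norm_gvec[OF assms] using gauss_moment(1)
  by (intro integrable_mult_right Bochner_Integration.integrable_sum) auto

lemma gauss_cos:
  assumes "0 \<le> s"
  shows "(\<integral>g. 1 - cos (inner (gvec n s g) x) \<partial>gauss n) = damp n s x"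
proof -
  interpret prob_space "gauss n" by (rule prob_space_gauss)
  have int: "integrable (gauss n) (\<lambda>g. cis (inner (gvec n s g) x))"
    by (rule integrable_const_bound[of _ 1]) (auto simp: cis_conv_exp)
  have "(\<integral>g. cos (inner (gvec n s g) x) \<partial>gauss n) = Re (\<integral>g. cis (inner (gvec n s g) x) \<partial>gauss n)"
    using integral_Re[OF int] by simp
  also have "\<dots> = exp (- (\<Sum>k<n. (sqrt s * inner (e k) x)\<^sup>2) / 2)"
    by (simp add: inner_gvec gauss_char)
  also have "(\<Sum>k<n. (sqrt s * inner (e k) x)\<^sup>2) = s * (norm (proj n x))\<^sup>2"
    using assms by (simp add: power_mult_distrib norm_proj sum_distrib_left)
  finally have "(\<integral>g. cos (inner (gvec n s g) x) \<partial>gauss n) = exp (- s * (norm (proj n x))\<^sup>2 / 2)" by simp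
  moreover have "integrable (gauss n) (\<lambda>g. cos (inner (gvec n s g) x))"
    using integrable_Re[OF int] by simp
  ultimately show ?thesis by (simp add: damp_def prob_space)
qed

lemma gauss_inner_Q:
  assumes "0 \<le> s"
  shows "integrable (gauss n) (\<lambda>g. inner (Q (gvec n s g)) (gvec n s g) / 2)"
    "(\<integral>g. inner (Q (gvec n s g)) (gvec n s g) / 2 \<partial>gauss n) = s / 2 * (\<Sum>k<n. inner (Q (e k)) (e k))"
proof -
  interpret Q: bounded_linear Q using cov by (simp add: cov_operator_def)
  have eq: "inner (Q (gvec n s g)) (gvec n s g) / 2
      = (\<Sum>k<n. \<Sum>l<n. (s / 2 * inner (Q (e k)) (e l)) * (g k * g l))" for g
  proof -
    have "inner (Q (gvec n s g)) (gvec n s g) = sqrt s * sqrt s * (\<Sum>k<n. \<Sum>l<n. g k * (g l * inner (Q (e k)) (e l)))"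
      unfolding gvec_def Q.scaleR Q.sum inner_scaleR_left inner_scaleR_right inner_sum_left
      unfolding inner_sum_right inner_scaleR_right by (simp only: sum_distrib_left mult.assoc)
    also have "sqrt s * sqrt s = s" using assms by simp
    finally show ?thesis by (simp add: sum_distrib_left sum_divide_distrib ac_simps)
  qed
  show "integrable (gauss n) (\<lambda>g. inner (Q (gvec n s g)) (gvec n s g) / 2)"
    unfolding eq using gauss_moment(1) by (intro Bochner_Integration.integrable_sum integrable_mult_right) auto
  have "(\<integral>g. inner (Q (gvec n s g)) (gvec n s g) / 2 \<partial>gauss n)
      = (\<Sum>k<n. \<Sum>l<n. (s / 2 * inner (Q (e k)) (e l)) * (\<integral>g. g k * g l \<partial>gauss n))"
    unfolding eq using gauss_moment(1)
    by (subst Bochner_Integration.integral_sum, force, intro sum.cong refl, subst Bochner_Integration.integral_sum) auto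
  also have "\<dots> = (\<Sum>k<n. \<Sum>l<n. if k = l then s / 2 * inner (Q (e k)) (e l) else 0)"
    by (intro sum.cong refl) (simp add: gauss_moment(2))
  also have "\<dots> = s / 2 * (\<Sum>k<n. inner (Q (e k)) (e k))"
    by (simp add: sum_distrib_left)
  finally show "(\<integral>g. inner (Q (gvec n s g)) (gvec n s g) / 2 \<partial>gauss n) = s / 2 * (\<Sum>k<n. inner (Q (e k)) (e k))" .
qed

lemma one_minus_cos_le:
  fixes u x :: 'a
  shows "\<bar>1 - cos (inner u x)\<bar> \<le> (2 + (norm u)\<^sup>2) * min 1 ((norm x)\<^sup>2)"
  unfolding one_minus_cos_eq using norm_integrand_le[of u x] abs_Re_le_cmod[of "integrand u x"] by simp

text \<open>A single Fubini argument, dominated by (2 + |u|^2) * \<open>nu_mass\<close>, gives the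
  exchange of integrals as well as the integrability of \<open>damp\<close> under \<nu>.\<close>

lemma gauss_integral_cos:
  assumes s: "0 \<le> s"
  shows "integrable (gauss n) (\<lambda>g. \<integral>x. 1 - cos (inner (gvec n s g) x) \<partial>\<nu>)"
    "(\<integral>g. (\<integral>x. 1 - cos (inner (gvec n s g) x) \<partial>\<nu>) \<partial>gauss n) = (\<integral>x. damp n s x \<partial>\<nu>)"
    "integrable \<nu> (damp n s)"
proof -
  interpret G: prob_space "gauss n" by (rule prob_space_gauss)
  interpret P: pair_sigma_finite "gauss n" \<nu> ..
  have m[measurable]: "(\<lambda>(g, x). 1 - cos (inner (gvec n s g) x)) \<in> borel_measurable (gauss n \<Otimes>\<^sub>M \<nu>)"
    by measurable
  have int: "integrable (gauss n \<Otimes>\<^sub>M \<nu>) (\<lambda>(g, x). 1 - cos (inner (gvec n s g) x))"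
  proof (rule P.Fubini_integrable[OF m])
    show "AE g in gauss n. integrable \<nu> (\<lambda>x. case (g, x) of (g, x) \<Rightarrow> 1 - cos (inner (gvec n s g) x))"
      using integrable_one_minus_cos by simp
    show "integrable (gauss n) (\<lambda>g. \<integral>x. norm (case (g, x) of (g, x) \<Rightarrow> 1 - cos (inner (gvec n s g) x)) \<partial>\<nu>)"
    proof (rule Bochner_Integration.integrable_bound)
      show "integrable (gauss n) (\<lambda>g. (2 + (norm (gvec n s g))\<^sup>2) * nu_mass)"
        using integrable_norm_gvec[OF s] by simp
      show "(\<lambda>g. \<integral>x. norm (case (g, x) of (g, x) \<Rightarrow> 1 - cos (inner (gvec n s g) x)) \<partial>\<nu>) \<in> borel_measurable (gauss n)"
        by (rule nu.borel_measurable_lebesgue_integral) measurable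
      have "(\<integral>x. \<bar>1 - cos (inner u x)\<bar> \<partial>\<nu>) \<le> (2 + (norm u)\<^sup>2) * nu_mass" for u
      proof -
        have "(\<integral>x. \<bar>1 - cos (inner u x)\<bar> \<partial>\<nu>) \<le> (\<integral>x. (2 + (norm u)\<^sup>2) * min 1 ((norm x)\<^sup>2) \<partial>\<nu>)"
          by (intro integral_mono integrable_abs integrable_one_minus_cos integrable_mult_right integrable_min one_minus_cos_le)
        then show ?thesis by (simp add: nu_mass_def)
      qed
      then show "AE g in gauss n. norm (\<integral>x. norm (case (g, x) of (g, x) \<Rightarrow> 1 - cos (inner (gvec n s g) x)) \<partial>\<nu>)
          \<le> norm ((2 + (norm (gvec n s g))\<^sup>2) * nu_mass)"
        using nu_mass_nonneg by (auto simp: integral_nonneg_AE abs_of_nonneg)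
    qed
  qed
  show "integrable (gauss n) (\<lambda>g. \<integral>x. 1 - cos (inner (gvec n s g) x) \<partial>\<nu>)"
    using P.integrable_fst'[OF int] by simp
  show "integrable \<nu> (damp n s)"
    using P.integrable_snd[OF int] by (simp add: gauss_cos[OF s])
  show "(\<integral>g. (\<integral>x. 1 - cos (inner (gvec n s g) x) \<partial>\<nu>) \<partial>gauss n) = (\<integral>x. damp n s x \<partial>\<nu>)"
    using P.Fubini_integral[OF int] by (simp add: gauss_cos[OF s])
qed

lemma gauss_Re_psi:
  assumes s: "0 \<le> s"
  shows "(\<integral>g. - Re (psi (gvec n s g)) \<partial>gauss n) = kappa n s"
  unfolding Re_psi kappa_def
  unfolding Bochner_Integration.integral_add[OF gauss_inner_Q(1)[OF s] gauss_integral_cos(1)[OF s]]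
    gauss_inner_Q(2)[OF s] gauss_integral_cos(2)[OF s] ..

end

section \<open>Laws of increments over the N-th part of an interval\<close>

locale levy_array = levy_triplet e b Q \<nu> for e :: "nat \<Rightarrow> 'a::{real_inner, polish_space}" and b Q \<nu> +
  fixes \<tau> :: real and \<rho> :: "nat \<Rightarrow> 'a measure"
  assumes \<tau>: "0 \<le> \<tau>" and prob_rho: "\<And>N. 0 < N \<Longrightarrow> prob_space (\<rho> N)"
    and sets_rho: "\<And>N. sets (\<rho> N) = sets borel"
    and char_rho: "\<And>N u. 0 < N \<Longrightarrow> (\<integral>x. cis (inner u x) \<partial>\<rho> N) = exp (complex_of_real (\<tau> / N) * psi u)"
begin

lemma integral_one_minus_cos_rho:
  assumes N: "0 < N"
  shows "integrable (\<rho> N) (\<lambda>x. cis (inner u x))"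
    "real N * (\<integral>x. 1 - cos (inner u x) \<partial>\<rho> N) = Re (of_nat N * (1 - exp (complex_of_real \<tau> * psi u / of_nat N)))"
proof -
  interpret prob_space "\<rho> N" by (rule prob_rho[OF N])
  note [measurable_cong] = sets_rho[of N]
  show int: "integrable (\<rho> N) (\<lambda>x. cis (inner u x))"
    by (rule integrable_const_bound[of _ 1]) (auto simp: cis_conv_exp)
  have "(\<integral>x. 1 - cos (inner u x) \<partial>\<rho> N) = 1 - Re (\<integral>x. cis (inner u x) \<partial>\<rho> N)"
    using integral_Re[OF int] integrable_Re[OF int] by (simp add: prob_space)
  then show "real N * (\<integral>x. 1 - cos (inner u x) \<partial>\<rho> N) = Re (of_nat N * (1 - exp (complex_of_real \<tau> * psi u / of_nat N)))"
    using N by (simp add: char_rho)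
qed

text \<open>By Fubini the N-th term is the Gaussian mean of Re (N (1 - exp (z / N))) with z = \<tau>
  psi (u). The integrand tends to - Re z and is dominated by |z|, which grows quadratically in the
  frequency u.\<close>

theorem damp_limit:
  assumes s: "0 \<le> s"
  shows "(\<lambda>N. real N * (\<integral>x. damp n s x \<partial>\<rho> N)) \<longlonglongrightarrow> \<tau> * kappa n s"
proof -
  interpret G: prob_space "gauss n" by (rule prob_space_gauss)
  let ?z = "\<lambda>g. complex_of_real \<tau> * psi (gvec n s g)"
  have eq: "real N * (\<integral>x. damp n s x \<partial>\<rho> N) = (\<integral>g. Re (of_nat N * (1 - exp (?z g / of_nat N))) \<partial>gauss n)"
    if N: "0 < N" for N
  proof -
    interpret R: prob_space "\<rho> N" by (rule prob_rho[OF N])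
    note [measurable_cong] = sets_rho[of N]
    interpret P: pair_prob_space "gauss n" "\<rho> N" ..
    have int: "integrable (gauss n \<Otimes>\<^sub>M \<rho> N) (\<lambda>(g, x). 1 - cos (inner (gvec n s g) x))"
    proof (rule P.integrable_const_bound[of _ 2])
      show "AE z in gauss n \<Otimes>\<^sub>M \<rho> N. norm (case z of (g, x) \<Rightarrow> 1 - cos (inner (gvec n s g) x)) \<le> 2"
      proof (intro AE_I2)
        fix z :: "(nat \<Rightarrow> real) \<times> 'a"
        show "norm (case z of (g, x) \<Rightarrow> 1 - cos (inner (gvec n s g) x)) \<le> 2"
          using cos_ge_minus_one[of "inner (gvec n s (fst z)) (snd z)"] cos_le_one[of "inner (gvec n s (fst z)) (snd z)"]
          by (simp add: split_beta abs_le_iff)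
      qed
    qed measurable
    have "real N * (\<integral>x. damp n s x \<partial>\<rho> N) = real N * (\<integral>g. (\<integral>x. 1 - cos (inner (gvec n s g) x) \<partial>\<rho> N) \<partial>gauss n)"
      using P.Fubini_integral[OF int] by (simp add: gauss_cos[OF s])
    also have "\<dots> = (\<integral>g. real N * (\<integral>x. 1 - cos (inner (gvec n s g) x) \<partial>\<rho> N) \<partial>gauss n)"
      by simp
    also have "\<dots> = (\<integral>g. Re (of_nat N * (1 - exp (?z g / of_nat N))) \<partial>gauss n)"
      unfolding integral_one_minus_cos_rho[OF N] ..
    finally show ?thesis .
  qed
  obtain K where K: "0 \<le> K" "\<And>u. norm (psi u) \<le> K * (1 + (norm u)\<^sup>2)"
    by (rule norm_psi_le) blast
  have "(\<lambda>N. \<integral>g. Re (of_nat N * (1 - exp (?z g / of_nat N))) \<partial>gauss n) \<longlonglongrightarrow> (\<integral>g. Re (- ?z g) \<partial>gauss n)"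
  proof (rule integral_dominated_convergence)
    show "integrable (gauss n) (\<lambda>g. \<tau> * (K * (1 + (norm (gvec n s g))\<^sup>2)))"
      using integrable_norm_gvec[OF s] by simp
    show "AE g in gauss n. (\<lambda>N. Re (of_nat N * (1 - exp (?z g / of_nat N)))) \<longlonglongrightarrow> Re (- ?z g)"
      by (intro AE_I2 tendsto_Re rescaled_one_minus_exp_tendsto)
    show "AE g in gauss n. norm (Re (of_nat N * (1 - exp (?z g / of_nat N)))) \<le> \<tau> * (K * (1 + (norm (gvec n s g))\<^sup>2))" for N
    proof (intro AE_I2)
      fix g
      have "norm (Re (of_nat N * (1 - exp (?z g / of_nat N)))) \<le> norm (of_nat N * (1 - exp (?z g / of_nat N)))"
        unfolding real_norm_def by (rule abs_Re_le_cmod)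
      also have "\<dots> = N * norm (1 - exp (?z g / of_nat N))" by (simp add: norm_mult)
      also have "\<dots> \<le> N * norm (?z g / of_nat N)"
        using Re_psi_nonpos \<tau> by (intro mult_left_mono norm_one_minus_exp_le) (auto simp: divide_nonpos_nonneg mult_nonneg_nonpos)
      also have "\<dots> \<le> norm (?z g)" by (simp add: norm_divide)
      also have "\<dots> \<le> \<tau> * (K * (1 + (norm (gvec n s g))\<^sup>2))"
        using \<tau> K(2) by (simp add: norm_mult mult_left_mono)
      finally show "norm (Re (of_nat N * (1 - exp (?z g / of_nat N)))) \<le> \<tau> * (K * (1 + (norm (gvec n s g))\<^sup>2))" .
    qed
  qed measurable
  also have "(\<integral>g. Re (- ?z g) \<partial>gauss n) = \<tau> * kappa n s"
    unfolding gauss_Re_psi[OF s, symmetric] by simp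
  finally have "(\<lambda>N. \<integral>g. Re (of_nat N * (1 - exp (?z g / of_nat N))) \<partial>gauss n) \<longlonglongrightarrow> \<tau> * kappa n s" .
  then show ?thesis
    by (rule Lim_transform_eventually) (use eq in \<open>auto intro!: eventually_sequentiallyI[of 1]\<close>)
qed

end

text \<open>With t = y^2, the bound exp (- t / 2) \<le> 1 / (1 + t / 2) reduces the claim to min 1 t
  \<le> 3 t / (2 + t), an equality at t = 1; hence the constant 3.\<close>

lemma min_le_damping:
  fixes y :: real
  shows "min 1 (y\<^sup>2) \<le> 3 * (1 - exp (- y\<^sup>2 / 2))"
proof -
  have "exp (- (y\<^sup>2 / 2)) \<le> 1 / (1 + y\<^sup>2 / 2)"
    using exp_ge_add_one_self[of "y\<^sup>2 / 2"]
    by (simp add: exp_minus inverse_eq_divide add_pos_nonneg frac_le)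
  moreover have "min 1 (y\<^sup>2) \<le> 3 * (1 - 1 / (1 + y\<^sup>2 / 2))"
  proof -
    define t where "t = y\<^sup>2"
    have t: "0 \<le> t" by (simp add: t_def)
    have "3 * (1 - 1 / (1 + t / 2)) = 3 * t / (2 + t)" using t by (simp add: field_simps)
    moreover have "min 1 t * (2 + t) \<le> 3 * t"
    proof (cases "t \<le> 1")
      case True
      have "t * (2 + t) \<le> t * 3" using t True by (intro mult_left_mono) auto
      then show ?thesis using True by (simp add: min_absorb2)
    qed auto
    then have "min 1 t \<le> 3 * t / (2 + t)" using t by (simp add: pos_le_divide_eq)
    ultimately show ?thesis by (simp add: t_def)
  qed
  ultimately show ?thesis by simp
qed

context levy_array
begin

lemma damp_le_min: "damp n 1 x \<le> min 1 ((norm x)\<^sup>2)"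
proof -
  have "1 - exp (- ((norm (proj n x))\<^sup>2 / 2)) \<le> (norm (proj n x))\<^sup>2 / 2"
    using exp_ge_add_one_self[of "- ((norm (proj n x))\<^sup>2 / 2)"] by simp
  also have "\<dots> \<le> (norm x)\<^sup>2"
    using power_mono[OF norm_proj_le[of n x], of 2] zero_le_power2[of "norm x"] norm_ge_zero[of "proj n x"] by linarith
  finally show ?thesis using damp_le_one[of n 1 x] by (simp add: damp_def)
qed

lemma integrable_rho_bounded:
  fixes f :: "'a \<Rightarrow> real"
  assumes "0 < N" and [measurable]: "f \<in> borel_measurable borel" and "\<And>x. \<bar>f x\<bar> \<le> B"
  shows "integrable (\<rho> N) f"
proof -
  interpret prob_space "\<rho> N" using assms(1) by (rule prob_rho)
  note [measurable_cong] = sets_rho[of N]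
  show ?thesis by (rule integrable_const_bound[of _ B]) (use assms(3) in auto)
qed

text \<open>For integer s the functions 1 - \<open>damp n s\<close> are powers of u = exp (- |P_n
  x|^2 / 2), so \<open>damp\<close> times a polynomial in u is a combination of functions covered by
  \<open>damp_limit\<close>. The factor \<open>damp\<close> keeps the integrals against \<nu>
  finite. The Gaussian part of the limit sits at u = 1 and sees only q 1; the summand 1 is there to
  absorb the error of a polynomial approximation.\<close>

lemma damp_power_limit:
  fixes a :: "nat \<Rightarrow> real" and m n :: nat
  defines "q \<equiv> \<lambda>u. \<Sum>i\<le>m. a i * u ^ i"
  shows "(\<lambda>N. real N * (\<integral>x. damp n 1 x * (q (1 - damp n 1 x) + 1) \<partial>\<rho> N))
    \<longlonglongrightarrow> \<tau> * ((q 1 + 1) / 2 * (\<Sum>k<n. inner (Q (e k)) (e k)) + (\<integral>x. damp n 1 x * (q (1 - damp n 1 x) + 1) \<partial>\<nu>))"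
    and "integrable \<nu> (\<lambda>x. damp n 1 x * (q (1 - damp n 1 x) + 1))"
proof -
  define T where "T = (\<Sum>k<n. inner (Q (e k)) (e k))"
  have q1: "q 1 = (\<Sum>i\<le>m. a i)" by (simp add: q_def)
  have pow: "(1 - damp n 1 x) ^ i = 1 - damp n (real i) x" for i x
    unfolding damp_def by (simp add: exp_of_nat_mult[symmetric])
  have eq: "damp n 1 x * (q (1 - damp n 1 x) + 1)
      = (\<Sum>i\<le>m. a i * (damp n (real (Suc i)) x - damp n (real i) x)) + damp n 1 x" for x
  proof -
    have "damp n 1 x * (1 - damp n 1 x) ^ i = damp n (real (Suc i)) x - damp n (real i) x" for i
      using pow[where i="Suc i" and x=x] by (simp add: pow algebra_simps)
    then have "damp n 1 x * q (1 - damp n 1 x) = (\<Sum>i\<le>m. a i * (damp n (real (Suc i)) x - damp n (real i) x))"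
      unfolding q_def sum_distrib_left by (intro sum.cong refl) (simp only: mult.left_commute)
    then show ?thesis by (simp only: distrib_left mult_1_right)
  qed
  have int: "integrable (\<rho> N) (damp n s)" if "0 < N" "0 \<le> s" for N s
    using that damp_nonneg[of s n] damp_le_one[of n s]
    by (intro integrable_rho_bounded[where B=1]) (auto simp: abs_le_iff intro: order_trans[of _ 0])
  have intn: "integrable \<nu> (damp n s)" if "0 \<le> s" for s using that by (rule gauss_integral_cos(3))
  show "integrable \<nu> (\<lambda>x. damp n 1 x * (q (1 - damp n 1 x) + 1))"
    unfolding eq using intn by (intro Bochner_Integration.integrable_add Bochner_Integration.integrable_sum
        integrable_mult_right Bochner_Integration.integrable_diff) auto
  have val: "(\<integral>x. damp n 1 x * (q (1 - damp n 1 x) + 1) \<partial>\<mu>)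
      = (\<Sum>i\<le>m. a i * ((\<integral>x. damp n (real (Suc i)) x \<partial>\<mu>) - (\<integral>x. damp n (real i) x \<partial>\<mu>))) + (\<integral>x. damp n 1 x \<partial>\<mu>)"
    if "\<And>s. 0 \<le> s \<Longrightarrow> integrable \<mu> (damp n s)" for \<mu>
    unfolding eq using that
    by (subst Bochner_Integration.integral_add)
      (auto simp del: of_nat_Suc intro!: Bochner_Integration.integrable_sum integrable_mult_right Bochner_Integration.integrable_diff)
  have "(\<lambda>N. (\<Sum>i\<le>m. a i * (real N * (\<integral>x. damp n (real (Suc i)) x \<partial>\<rho> N) - real N * (\<integral>x. damp n (real i) x \<partial>\<rho> N)))
        + real N * (\<integral>x. damp n 1 x \<partial>\<rho> N))
      \<longlonglongrightarrow> (\<Sum>i\<le>m. a i * (\<tau> * kappa n (real (Suc i)) - \<tau> * kappa n (real i))) + \<tau> * kappa n 1"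
    by (intro tendsto_intros damp_limit) auto
  also have "(\<Sum>i\<le>m. a i * (\<tau> * kappa n (real (Suc i)) - \<tau> * kappa n (real i))) + \<tau> * kappa n 1
      = \<tau> * ((\<Sum>i\<le>m. a i * (T / 2 + ((\<integral>x. damp n (real (Suc i)) x \<partial>\<nu>) - (\<integral>x. damp n (real i) x \<partial>\<nu>))))
          + (T / 2 + (\<integral>x. damp n 1 x \<partial>\<nu>)))"
  proof -
    have k: "\<tau> * kappa n (real (Suc i)) - \<tau> * kappa n (real i)
        = \<tau> * (T / 2 + ((\<integral>x. damp n (real (Suc i)) x \<partial>\<nu>) - (\<integral>x. damp n (real i) x \<partial>\<nu>)))" for i
      by (simp add: kappa_def T_def[symmetric] algebra_simps add_divide_distrib)
    have k1: "kappa n 1 = T / 2 + (\<integral>x. damp n 1 x \<partial>\<nu>)" by (simp add: kappa_def T_def)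
    show ?thesis unfolding k k1 by (simp only: distrib_left sum_distrib_left mult.left_commute)
  qed
  also have "(\<Sum>i\<le>m. a i * (T / 2 + ((\<integral>x. damp n (real (Suc i)) x \<partial>\<nu>) - (\<integral>x. damp n (real i) x \<partial>\<nu>))))
          + (T / 2 + (\<integral>x. damp n 1 x \<partial>\<nu>))
      = (q 1 + 1) / 2 * T + (\<integral>x. damp n 1 x * (q (1 - damp n 1 x) + 1) \<partial>\<nu>)"
    unfolding q1 by (subst val[OF intn], assumption)
      (simp add: distrib_left sum.distrib sum_distrib_right[symmetric] add_divide_distrib distrib_right sum_divide_distrib[symmetric])
  finally have lim: "(\<lambda>N. (\<Sum>i\<le>m. a i * (real N * (\<integral>x. damp n (real (Suc i)) x \<partial>\<rho> N) - real N * (\<integral>x. damp n (real i) x \<partial>\<rho> N)))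
        + real N * (\<integral>x. damp n 1 x \<partial>\<rho> N))
      \<longlonglongrightarrow> \<tau> * ((q 1 + 1) / 2 * T + (\<integral>x. damp n 1 x * (q (1 - damp n 1 x) + 1) \<partial>\<nu>))" .
  show "(\<lambda>N. real N * (\<integral>x. damp n 1 x * (q (1 - damp n 1 x) + 1) \<partial>\<rho> N))
    \<longlonglongrightarrow> \<tau> * ((q 1 + 1) / 2 * (\<Sum>k<n. inner (Q (e k)) (e k)) + (\<integral>x. damp n 1 x * (q (1 - damp n 1 x) + 1) \<partial>\<nu>))"
    unfolding T_def[symmetric]
  proof (rule Lim_transform_eventually[OF lim], rule eventually_sequentiallyI[of 1])
    fix N :: nat assume "1 \<le> N"
    then have N: "0 < N" by simp
    show "(\<Sum>i\<le>m. a i * (real N * (\<integral>x. damp n (real (Suc i)) x \<partial>\<rho> N) - real N * (\<integral>x. damp n (real i) x \<partial>\<rho> N)))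
        + real N * (\<integral>x. damp n 1 x \<partial>\<rho> N) = real N * (\<integral>x. damp n 1 x * (q (1 - damp n 1 x) + 1) \<partial>\<rho> N)"
      by (subst val[OF int[OF N]], assumption) (simp add: distrib_left sum_distrib_left right_diff_distrib mult.left_commute)
  qed
qed

end

section \<open>Estimates of order 1 / N for single increments, and the moment bound\<close>

locale levy_array_moment = levy_array e b Q \<nu> \<tau> \<rho>
  for e :: "nat \<Rightarrow> 'a::{real_inner, polish_space}" and b Q \<nu> \<tau> \<rho> +
  fixes p :: real
  assumes p: "0 < p"
    and moment: "(\<integral>\<^sup>+ x. ennreal (indicator {x. norm x > 1} x * norm x powr p) \<partial>\<nu>) < \<infinity>"
begin

text \<open>Truncation at \<open>R\<close> makes this a continuous function of u = exp (- |P_n x|^2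
  / 2) on the closed interval [0, 1]; the bare power is unbounded as u tends to 0.\<close>

definition trunc_pow :: "nat \<Rightarrow> real \<Rightarrow> 'a \<Rightarrow> real" where
  "trunc_pow n R x = (min (norm (proj n x)) R) powr p"

text \<open>Of the multiple 3 of \<open>nu_mass\<close>, one part comes from \<open>damp\<close>
  times the truncated power and two from the approximation error. The final 1 makes an inequality
  between limits strict, so that it holds eventually.\<close>

definition array_const :: real where
  "array_const = \<tau> * ((\<Sum>k. inner (Q (e k)) (e k)) + 3 * nu_mass
     + (\<integral>x. indicator {x. norm x > 1} x * norm x powr p \<partial>\<nu>)) + 1"

lemma integrable_moment: "integrable \<nu> (\<lambda>x. indicator {x. norm x > 1} x * norm x powr p)"
  using moment by (intro integrableI_nonneg) auto

lemma trunc_pow_measurable[measurable]: "trunc_pow n R \<in> borel_measurable borel"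
  unfolding trunc_pow_def[abs_def] by measurable

lemma trunc_pow_bounds:
  assumes "0 \<le> R"
  shows "0 \<le> trunc_pow n R x" "trunc_pow n R x \<le> R powr p" "trunc_pow n R x \<le> norm x powr p"
proof -
  show "0 \<le> trunc_pow n R x" by (simp add: trunc_pow_def)
  show "trunc_pow n R x \<le> R powr p" unfolding trunc_pow_def using assms p by (intro powr_mono2) auto
  show "trunc_pow n R x \<le> norm x powr p"
    unfolding trunc_pow_def using assms p norm_proj_le[of n x] by (intro powr_mono2) auto
qed

text \<open>The truncated power, as a continuous function of u, is dominated by a polynomial in u,
  to which the limit theorem applies. The constant depends on neither \<open>n\<close> nor
  \<open>R\<close>; only the threshold for N does.\<close>

lemma eventually_trunc_pow_le:
  assumes R: "1 \<le> R"
  shows "eventually (\<lambda>N. real N * (\<integral>x. damp n 1 x * trunc_pow n R x \<partial>\<rho> N) \<le> array_const) sequentially"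
    "eventually (\<lambda>N. real N * (\<integral>x. damp n 1 x \<partial>\<rho> N) \<le> array_const) sequentially"
proof -
  define T where "T = (\<Sum>k<n. inner (Q (e k)) (e k))"
  have T: "0 \<le> T" "T \<le> (\<Sum>k. inner (Q (e k)) (e k))"
    unfolding T_def using cov by (auto simp: cov_operator_def intro!: sum_nonneg sum_le_suminf)
  define mp where "mp = (\<integral>x. indicator {x. norm x > 1} x * norm x powr p \<partial>\<nu>)"
  have mp: "0 \<le> mp" unfolding mp_def by (simp add: integral_nonneg_AE)
  \<comment> \<open>Inverts u = exp (- y^2 / 2), that is y^2 = - 2 ln u; the maximum keeps the
    logarithm away from 0 and at the same time cuts y off at \<open>R\<close>.\<close>
  define g where "g u = (- 2 * ln (max u (exp (- R\<^sup>2 / 2)))) powr (p / 2)" for u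
  have "continuous_on {0..1} g"
    unfolding g_def
  proof (intro continuous_on_powr' continuous_intros ballI)
    fix u :: real assume u: "u \<in> {0..1}"
    have m: "0 < max u (exp (- R\<^sup>2 / 2))" "max u (exp (- R\<^sup>2 / 2)) \<le> 1" using u by (auto simp: less_max_iff_disj)
    then show "max u (exp (- R\<^sup>2 / 2)) \<noteq> 0" by simp
    show "0 \<le> - 2 * ln (max u (exp (- R\<^sup>2 / 2))) \<and>
        (- 2 * ln (max u (exp (- R\<^sup>2 / 2))) = 0 \<longrightarrow> 0 < p / 2)"
      using m p by (simp add: ln_le_zero_iff)
  qed
  \<comment> \<open>Accuracy 1 is enough: the truncated power is at most q0 + 1, which exceeds it by
    at most 2, and the factor \<open>damp\<close> makes constants integrable.\<close>
  then obtain q0 where q0: "real_polynomial_function q0" "\<And>u. u \<in> {0..1} \<Longrightarrow> \<bar>g u - q0 u\<bar> < 1"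
    using Stone_Weierstrass_real_polynomial_function[of "{0..1}" g 1] by auto
  then obtain a m where a: "q0 = (\<lambda>u. \<Sum>i\<le>m. a i * u ^ i)"
    unfolding real_polynomial_function_iff_sum by blast
  have g_eq: "g (1 - damp n 1 x) = trunc_pow n R x" for x
  proof -
    define y where "y = norm (proj n x)"
    have "max (exp (- y\<^sup>2 / 2)) (exp (- R\<^sup>2 / 2)) = exp (- (min y R)\<^sup>2 / 2)"
      using R power_mono[of y R 2] power_mono[of R y 2] by (auto simp: max_def min_def y_def)
    then have "g (1 - damp n 1 x) = ((min y R)\<^sup>2) powr (p / 2)"
      by (simp add: g_def damp_def y_def)
    also have "\<dots> = (min y R) powr p"
      using R by (simp add: y_def powr_powr flip: powr_numeral)
    finally show ?thesis by (simp add: trunc_pow_def y_def)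
  qed
  have rng: "1 - damp n 1 x \<in> {0..1}" for x using damp_nonneg[of 1 n x] damp_le_one[of n 1 x] by simp
  have close: "\<bar>trunc_pow n R x - q0 (1 - damp n 1 x)\<bar> < 1" for x
    using q0(2)[OF rng, of x] by (simp add: g_eq)
  have lim: "(\<lambda>N. real N * (\<integral>x. damp n 1 x * (q0 (1 - damp n 1 x) + 1) \<partial>\<rho> N))
    \<longlonglongrightarrow> \<tau> * ((q0 1 + 1) / 2 * T + (\<integral>x. damp n 1 x * (q0 (1 - damp n 1 x) + 1) \<partial>\<nu>))"
    unfolding a T_def by (rule damp_power_limit)
  have int: "integrable \<nu> (\<lambda>x. damp n 1 x * (q0 (1 - damp n 1 x) + 1))"
    unfolding a by (rule damp_power_limit)
  \<comment> \<open>The value at u = 1 bounds the weight (q0 1 + 1) / 2 of the trace by 1.\<close>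
  have "g 1 = 0" by (simp add: g_def)
  then have q01: "q0 1 \<le> 1" using q0(2)[of 1] by simp
  have "(\<integral>x. damp n 1 x * (q0 (1 - damp n 1 x) + 1) \<partial>\<nu>)
      \<le> (\<integral>x. 3 * min 1 ((norm x)\<^sup>2) + indicator {x. norm x > 1} x * norm x powr p \<partial>\<nu>)"
  proof (intro integral_mono int Bochner_Integration.integrable_add integrable_mult_right integrable_min integrable_moment)
    fix x
    have d: "0 \<le> damp n 1 x" "damp n 1 x \<le> 1" "damp n 1 x \<le> min 1 ((norm x)\<^sup>2)"
      using damp_nonneg damp_le_one damp_le_min by auto
    have "damp n 1 x * (q0 (1 - damp n 1 x) + 1) \<le> damp n 1 x * (trunc_pow n R x + 2)"
      using d(1) close[of x] by (intro mult_left_mono) auto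
    also have "\<dots> = damp n 1 x * trunc_pow n R x + 2 * damp n 1 x" by (simp add: algebra_simps)
    also have "damp n 1 x * trunc_pow n R x \<le> min 1 ((norm x)\<^sup>2) + indicator {x. norm x > 1} x * norm x powr p"
    proof (cases "norm x \<le> 1")
      case True
      have "trunc_pow n R x \<le> 1"
        using trunc_pow_bounds(3)[of R n x] R True p powr_le1[of p "norm x"] by auto
      then have "damp n 1 x * trunc_pow n R x \<le> damp n 1 x * 1" using d by (intro mult_left_mono) auto
      then show ?thesis using d True by simp
    next
      case False
      have "damp n 1 x * trunc_pow n R x \<le> 1 * norm x powr p"
        using d trunc_pow_bounds[of R n x] R by (intro mult_mono) auto
      then show ?thesis using False by (simp add: min_def)
    qed
    finally show "damp n 1 x * (q0 (1 - damp n 1 x) + 1) \<le> 3 * min 1 ((norm x)\<^sup>2) + indicator {x. norm x > 1} x * norm x powr p"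
      using d by linarith
  qed
  also have "\<dots> = 3 * nu_mass + mp"
    using integrable_min integrable_moment by (simp add: nu_mass_def mp_def)
  finally have "\<tau> * ((q0 1 + 1) / 2 * T + (\<integral>x. damp n 1 x * (q0 (1 - damp n 1 x) + 1) \<partial>\<nu>))
      \<le> \<tau> * ((\<Sum>k. inner (Q (e k)) (e k)) + (3 * nu_mass + mp))"
  proof (intro mult_left_mono add_mono \<tau>)
    have "(q0 1 + 1) / 2 * T \<le> 1 * T" using q01 T by (intro mult_right_mono) auto
    then show "(q0 1 + 1) / 2 * T \<le> (\<Sum>k. inner (Q (e k)) (e k))" using T by simp
  qed
  also have "\<dots> < array_const" by (simp add: array_const_def mp_def add.assoc)
  finally have "eventually (\<lambda>N. real N * (\<integral>x. damp n 1 x * (q0 (1 - damp n 1 x) + 1) \<partial>\<rho> N) < array_const) sequentially"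
    by (rule order_tendstoD(2)[OF lim])
  then show "eventually (\<lambda>N. real N * (\<integral>x. damp n 1 x * trunc_pow n R x \<partial>\<rho> N) \<le> array_const) sequentially"
    using eventually_gt_at_top[of 0]
  proof eventually_elim
    case (elim N)
    have "(\<integral>x. damp n 1 x * trunc_pow n R x \<partial>\<rho> N) \<le> (\<integral>x. damp n 1 x * (q0 (1 - damp n 1 x) + 1) \<partial>\<rho> N)"
    proof (rule integral_mono)
      have d: "\<bar>damp n 1 x\<bar> \<le> 1" for x using damp_nonneg[of 1 n x] damp_le_one[of n 1 x] by simp
      have t: "\<bar>trunc_pow n R x\<bar> \<le> R powr p" for x using trunc_pow_bounds[of R n x] R by simp
      show "integrable (\<rho> N) (\<lambda>x. damp n 1 x * trunc_pow n R x)"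
      proof (rule integrable_rho_bounded[OF elim(2)])
        show "\<bar>damp n 1 x * trunc_pow n R x\<bar> \<le> 1 * R powr p" for x
          unfolding abs_mult using d[of x] t[of x] by (intro mult_mono) auto
      qed measurable
      have [measurable]: "q0 \<in> borel_measurable borel" unfolding a by measurable
      show "integrable (\<rho> N) (\<lambda>x. damp n 1 x * (q0 (1 - damp n 1 x) + 1))"
      proof (rule integrable_rho_bounded[OF elim(2)])
        show "\<bar>damp n 1 x * (q0 (1 - damp n 1 x) + 1)\<bar> \<le> 1 * (R powr p + 2)" for x
          unfolding abs_mult using d[of x] t[of x] close[of x] by (intro mult_mono) auto
      qed measurable
      show "damp n 1 x * trunc_pow n R x \<le> damp n 1 x * (q0 (1 - damp n 1 x) + 1)" for x
        using close[of x] damp_nonneg[of 1 n x] by (intro mult_left_mono) auto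
    qed
    then have "real N * (\<integral>x. damp n 1 x * trunc_pow n R x \<partial>\<rho> N) \<le> real N * (\<integral>x. damp n 1 x * (q0 (1 - damp n 1 x) + 1) \<partial>\<rho> N)"
      by (intro mult_left_mono) auto
    then show ?case using elim(1) by (rule order_trans[OF _ less_imp_le])
  qed
  have "(\<integral>x. damp n 1 x \<partial>\<nu>) \<le> nu_mass"
    unfolding nu_mass_def by (intro integral_mono gauss_integral_cos(3) integrable_min damp_le_min) simp
  then have "kappa n 1 \<le> (\<Sum>k. inner (Q (e k)) (e k)) + 3 * nu_mass + mp"
    using T mp nu_mass_nonneg unfolding kappa_def T_def[symmetric] by simp
  then have "\<tau> * kappa n 1 \<le> \<tau> * ((\<Sum>k. inner (Q (e k)) (e k)) + 3 * nu_mass + mp)"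
    using \<tau> by (rule mult_left_mono)
  also have "\<dots> < array_const" by (simp add: array_const_def mp_def add.assoc)
  finally have "eventually (\<lambda>N. real N * (\<integral>x. damp n 1 x \<partial>\<rho> N) < array_const) sequentially"
    by (rule order_tendstoD(2)[OF damp_limit[OF zero_le_one]])
  then show "eventually (\<lambda>N. real N * (\<integral>x. damp n 1 x \<partial>\<rho> N) \<le> array_const) sequentially"
    by (rule eventually_mono) simp
qed


text \<open>For the drift, the first summand pays for replacing the truncated identity by the sine,
  and the second bounds \<tau> |Im psi| on the unit ball.\<close>

definition incr_const :: real where
  "incr_const = 3 * array_const + \<tau> * (norm b + 3 * nu_mass)"

lemma array_const_pos: "0 < array_const"
proof -
  have "0 \<le> (\<Sum>k. inner (Q (e k)) (e k))"
    using cov by (auto simp: cov_operator_def intro!: suminf_nonneg)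
  moreover have "0 \<le> (\<integral>x. indicator {x. norm x > 1} x * norm x powr p \<partial>\<nu>)"
    by (simp add: integral_nonneg_AE)
  ultimately show ?thesis
    unfolding array_const_def using \<tau> nu_mass_nonneg by (intro add_nonneg_pos mult_nonneg_nonneg) auto
qed

lemma array_const_le_incr_const: "3 * array_const \<le> incr_const"
  unfolding incr_const_def using \<tau> nu_mass_nonneg by simp

text \<open>The truncated mean is compared with the mean of sin <u, x>, the imaginary part of the
  characteristic function. The integrands differ by at most min 1 (|P_n x|^2), whose mean is already
  of order 1 / N. Homogeneity in \<open>v\<close> reduces everything to unit vectors.\<close>

lemma drift_bound:
  assumes N: "0 < N" and A: "real N * (\<integral>d. min 1 ((norm (proj n d))\<^sup>2) \<partial>\<rho> N) \<le> 3 * array_const"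
  shows "real N * \<bar>\<integral>d. inner v (proj n d) * indicator {x. norm (proj n x) \<le> 1} d \<partial>\<rho> N\<bar> \<le> incr_const * norm v"
proof -
  interpret prob_space "\<rho> N" by (rule prob_rho[OF N])
  note [measurable_cong] = sets_rho[of N]
  let ?I = "\<lambda>x. indicator {x. norm (proj n x) \<le> 1} x :: real"
  have unit: "real N * \<bar>\<integral>d. inner w (proj n d) * ?I d \<partial>\<rho> N\<bar> \<le> incr_const" if w: "norm w = 1" for w
  proof -
    \<comment> \<open>The frequency is projected instead of the increment: <P_n w, x> = <w, P_n
      x>.\<close>
    define u where "u = proj n w"
    have u: "norm u \<le> 1" using norm_proj_le[of n w] w by (simp add: u_def)
    have inner_u: "inner u x = inner w (proj n x)" for x by (simp add: u_def inner_proj)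
    have int_cis: "integrable (\<rho> N) (\<lambda>x. cis (inner u x))"
      by (rule integral_one_minus_cos_rho(1)[OF N])
    have int_sin: "integrable (\<rho> N) (\<lambda>x. sin (inner u x))"
      using integrable_Im[OF int_cis] by simp
    have wP: "\<bar>inner w (proj n x)\<bar> \<le> norm (proj n x)" for x
      using Cauchy_Schwarz_ineq2[of w "proj n x"] w by simp
    have int_w: "integrable (\<rho> N) (\<lambda>x. inner w (proj n x) * ?I x)"
      by (rule integrable_rho_bounded[OF N, of _ 1]) (auto simp: indicator_def intro: order_trans[OF wP])
    have int_min: "integrable (\<rho> N) (\<lambda>x. min 1 ((norm (proj n x))\<^sup>2))"
      by (rule integrable_rho_bounded[OF N, of _ 1]) auto
    have diff: "\<bar>inner w (proj n x) * ?I x - sin (inner u x)\<bar> \<le> min 1 ((norm (proj n x))\<^sup>2)" for x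
    proof (cases "norm (proj n x) \<le> 1")
      case True
      define a where "a = inner w (proj n x)"
      have "\<bar>sin a - a\<bar> \<le> a\<^sup>2 / 2"
        using norm_cis_quadratic_le[of a] abs_Im_le_cmod[of "cis a - 1 - \<i> * complex_of_real a"] by simp
      also have "\<dots> \<le> (norm (proj n x))\<^sup>2"
        using power_mono[OF wP[of x], of 2] zero_le_power2[of a] unfolding a_def power2_abs by linarith
      finally show ?thesis
        using True power_le_one[of "norm (proj n x)" 2] by (simp add: inner_u a_def min_absorb2 abs_minus_commute)
    next
      case False
      then show ?thesis by (simp add: min_def one_le_power abs_le_iff minus_le_iff)
    qed
    have "real N * \<bar>\<integral>x. sin (inner u x) \<partial>\<rho> N\<bar> \<le> \<tau> * (norm b + 3 * nu_mass)"
    proof -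
      \<comment> \<open>As Re z \<le> 0, the imaginary part of exp z is at most |Im z|, which
        carries the factor \<tau> / N.\<close>
      define z where "z = complex_of_real (\<tau> / N) * psi u"
      have Re: "Re z \<le> 0" using Re_psi_nonpos[of u] \<tau> by (simp add: z_def mult_nonneg_nonpos divide_nonpos_nonneg)
      have "(\<integral>x. sin (inner u x) \<partial>\<rho> N) = Im (exp z)"
        using integral_Im[OF int_cis] by (simp add: char_rho[OF N] z_def)
      also have "\<dots> = exp (Re z) * sin (Im z)" by (simp add: Im_exp)
      finally have "\<bar>\<integral>x. sin (inner u x) \<partial>\<rho> N\<bar> = exp (Re z) * \<bar>sin (Im z)\<bar>" by (simp add: abs_mult)
      also have "\<dots> \<le> 1 * \<bar>Im z\<bar>" using Re by (intro mult_mono abs_sin_x_le_abs_x) auto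
      finally have "real N * \<bar>\<integral>x. sin (inner u x) \<partial>\<rho> N\<bar> \<le> real N * \<bar>Im z\<bar>" by (intro mult_left_mono) auto
      also have "\<dots> = \<tau> * \<bar>Im (psi u)\<bar>" using N \<tau> by (simp add: z_def abs_mult)
      also have "\<dots> \<le> \<tau> * (norm b + 3 * nu_mass)"
      proof (intro mult_left_mono \<tau>)
        have "norm b * norm u + (2 + (norm u)\<^sup>2) * nu_mass \<le> norm b * 1 + (2 + 1) * nu_mass"
          using u nu_mass_nonneg power_le_one[of "norm u" 2] by (intro add_mono mult_left_mono mult_right_mono) auto
        then show "\<bar>Im (psi u)\<bar> \<le> norm b + 3 * nu_mass" using Im_psi_le[of u] by simp
      qed
      finally show ?thesis .
    qed
    moreover have "real N * \<bar>(\<integral>x. inner w (proj n x) * ?I x \<partial>\<rho> N) - (\<integral>x. sin (inner u x) \<partial>\<rho> N)\<bar> \<le> 3 * array_const"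
    proof -
      have "\<bar>(\<integral>x. inner w (proj n x) * ?I x \<partial>\<rho> N) - (\<integral>x. sin (inner u x) \<partial>\<rho> N)\<bar>
        = \<bar>\<integral>x. inner w (proj n x) * ?I x - sin (inner u x) \<partial>\<rho> N\<bar>"
        using int_w int_sin by simp
      also have "\<dots> \<le> (\<integral>x. \<bar>inner w (proj n x) * ?I x - sin (inner u x)\<bar> \<partial>\<rho> N)"
        by (rule integral_abs_bound)
      also have "\<dots> \<le> (\<integral>x. min 1 ((norm (proj n x))\<^sup>2) \<partial>\<rho> N)"
        by (intro integral_mono integrable_abs Bochner_Integration.integrable_diff int_w int_sin int_min diff)
      finally have "real N * \<bar>(\<integral>x. inner w (proj n x) * ?I x \<partial>\<rho> N) - (\<integral>x. sin (inner u x) \<partial>\<rho> N)\<bar>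
          \<le> real N * (\<integral>x. min 1 ((norm (proj n x))\<^sup>2) \<partial>\<rho> N)" by (intro mult_left_mono) auto
      then show ?thesis using A by linarith
    qed
    moreover have "real N * \<bar>\<integral>x. inner w (proj n x) * ?I x \<partial>\<rho> N\<bar>
      \<le> real N * \<bar>\<integral>x. sin (inner u x) \<partial>\<rho> N\<bar>
        + real N * \<bar>(\<integral>x. inner w (proj n x) * ?I x \<partial>\<rho> N) - (\<integral>x. sin (inner u x) \<partial>\<rho> N)\<bar>"
      unfolding distrib_left[symmetric] by (intro mult_left_mono) auto
    ultimately show ?thesis unfolding incr_const_def by linarith
  qed
  show ?thesis
  proof (cases "v = 0")
    case False
    have "inner v (proj n d) * ?I d = norm v * (inner (v /\<^sub>R norm v) (proj n d) * ?I d)" for d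
      using False by simp
    then have "(\<integral>d. inner v (proj n d) * ?I d \<partial>\<rho> N) = norm v * (\<integral>d. inner (v /\<^sub>R norm v) (proj n d) * ?I d \<partial>\<rho> N)"
      by (simp only: integral_mult_right_zero)
    then have "real N * \<bar>\<integral>d. inner v (proj n d) * ?I d \<partial>\<rho> N\<bar>
      = (real N * \<bar>\<integral>d. inner (v /\<^sub>R norm v) (proj n d) * ?I d \<partial>\<rho> N\<bar>) * norm v"
      by (simp only: abs_mult abs_norm_cancel mult_ac)
    also have "\<dots> \<le> incr_const * norm v"
      using False by (intro mult_right_mono unit) auto
    finally show ?thesis .
  qed simp
qed

text \<open>Collects what the Lyapunov recursion asks for, with c = \<open>incr_const\<close> / N.
  The last bound is Markov's inequality: beyond \<open>R\<close> three times \<open>damp\<close>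
  times the truncated power is at least R^p.\<close>

lemma increment_estimates:
  assumes R: "1 \<le> R"
  shows "eventually (\<lambda>N. 0 < N \<and>
    (\<integral>d. min 1 ((norm (proj n d))\<^sup>2) \<partial>\<rho> N) \<le> incr_const / N \<and>
    (\<forall>v. \<bar>\<integral>d. inner v (proj n d) * indicator {x. norm (proj n x) \<le> 1} d \<partial>\<rho> N\<bar> \<le> incr_const / N * norm v) \<and>
    (\<integral>d. norm (proj n d) powr p * indicator {x. 1 < norm (proj n x) \<and> norm (proj n x) \<le> R} d \<partial>\<rho> N) \<le> incr_const / N \<and>
    measure (\<rho> N) {x. R < norm (proj n x)} \<le> incr_const / N / R powr p) sequentially"
  using eventually_trunc_pow_le(1)[OF R, of n] eventually_trunc_pow_le(2)[OF R, of n] eventually_gt_at_top[of 0]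
proof eventually_elim
  case (elim N)
  interpret prob_space "\<rho> N" by (rule prob_rho[OF elim(3)])
  note [measurable_cong] = sets_rho[of N]
  have sp: "space (\<rho> N) = UNIV" using sets_eq_imp_space_eq[OF sets_rho[of N]] by simp
  have d: "0 \<le> damp n 1 x" "damp n 1 x \<le> 1" for x using damp_nonneg damp_le_one by auto
  have t: "0 \<le> trunc_pow n R x" "trunc_pow n R x \<le> R powr p" for x using trunc_pow_bounds R by auto
  have min_damp: "min 1 ((norm (proj n x))\<^sup>2) \<le> 3 * damp n 1 x" for x
    using min_le_damping[of "norm (proj n x)"] by (simp add: damp_def)
  have int_d: "integrable (\<rho> N) (damp n 1)"
    by (rule integrable_rho_bounded[OF elim(3), of _ 1]) (use d in \<open>auto simp: abs_of_nonneg\<close>)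
  have int_dt: "integrable (\<rho> N) (\<lambda>x. damp n 1 x * trunc_pow n R x)"
  proof (rule integrable_rho_bounded[OF elim(3)])
    show "\<bar>damp n 1 x * trunc_pow n R x\<bar> \<le> 1 * R powr p" for x
      unfolding abs_mult using d[of x] t[of x] by (intro mult_mono) auto
  qed measurable
  have "real N * (\<integral>d. min 1 ((norm (proj n d))\<^sup>2) \<partial>\<rho> N) \<le> real N * (\<integral>x. 3 * damp n 1 x \<partial>\<rho> N)"
    by (intro mult_left_mono integral_mono min_damp integrable_mult_right int_d)
      (auto intro!: integrable_rho_bounded[OF elim(3), of _ 1])
  also have "\<dots> \<le> 3 * array_const" using elim(2) by simp
  finally have A: "real N * (\<integral>d. min 1 ((norm (proj n d))\<^sup>2) \<partial>\<rho> N) \<le> 3 * array_const" .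
  have dt: "real N * (\<integral>x. 3 * (damp n 1 x * trunc_pow n R x) \<partial>\<rho> N) \<le> incr_const"
    using elim(1) array_const_le_incr_const by simp
  have big: "1 \<le> 3 * damp n 1 x" if "1 < norm (proj n x)" for x
    using min_damp[of x] that by (simp add: min_def one_le_power split: if_splits)
  have "(\<integral>d. norm (proj n d) powr p * indicator {x. 1 < norm (proj n x) \<and> norm (proj n x) \<le> R} d \<partial>\<rho> N)
      \<le> (\<integral>x. 3 * (damp n 1 x * trunc_pow n R x) \<partial>\<rho> N)"
  proof (rule integral_mono)
    show "integrable (\<rho> N) (\<lambda>d. norm (proj n d) powr p * indicator {x. 1 < norm (proj n x) \<and> norm (proj n x) \<le> R} d)"
      by (rule integrable_rho_bounded[OF elim(3), of _ "R powr p"]) (use p in \<open>auto simp: indicator_def intro!: powr_mono2\<close>)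
    fix x
    show "norm (proj n x) powr p * indicator {x. 1 < norm (proj n x) \<and> norm (proj n x) \<le> R} x \<le> 3 * (damp n 1 x * trunc_pow n R x)"
      using mult_right_mono[OF big[of x] t(1)[of x]] d[of x] t[of x]
      by (auto simp: indicator_def trunc_pow_def min_def split: if_splits)
  qed (use int_dt in simp)
  then have "real N * (\<integral>d. norm (proj n d) powr p * indicator {x. 1 < norm (proj n x) \<and> norm (proj n x) \<le> R} d \<partial>\<rho> N)
      \<le> incr_const"
    by (rule order_trans[OF mult_left_mono[OF _ of_nat_0_le_iff] dt])
  moreover have "R powr p * measure (\<rho> N) {x. R < norm (proj n x)} \<le> (\<integral>x. 3 * (damp n 1 x * trunc_pow n R x) \<partial>\<rho> N)"
  proof -
    have "R powr p * measure (\<rho> N) {x. R < norm (proj n x)} = (\<integral>x. R powr p * indicator {x. R < norm (proj n x)} x \<partial>\<rho> N)"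
      by (simp add: sp)
    also have "\<dots> \<le> (\<integral>x. 3 * (damp n 1 x * trunc_pow n R x) \<partial>\<rho> N)"
    proof (rule integral_mono)
      fix x
      show "R powr p * indicator {x. R < norm (proj n x)} x \<le> 3 * (damp n 1 x * trunc_pow n R x)"
        using mult_right_mono[OF big[of x] t(1)[of x]] d[of x] t[of x] R
        by (auto simp: indicator_def trunc_pow_def min_def split: if_splits)
    next
      show "integrable (\<rho> N) (\<lambda>x. R powr p * indicator {x. R < norm (proj n x)} x)"
        by (rule integrable_rho_bounded[OF elim(3), of _ "R powr p"]) (auto simp: indicator_def)
    qed (use int_dt in simp)
    finally show ?thesis .
  qed
  then have "real N * (R powr p * measure (\<rho> N) {x. R < norm (proj n x)}) \<le> incr_const"
    by (rule order_trans[OF mult_left_mono[OF _ of_nat_0_le_iff] dt])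
  moreover have "real N * \<bar>\<integral>d. inner v (proj n d) * indicator {x. norm (proj n x) \<le> 1} d \<partial>\<rho> N\<bar> \<le> incr_const * norm v" for v
    by (rule drift_bound[OF elim(3) A])
  ultimately show ?case
    using elim(3) A array_const_le_incr_const R by (simp add: field_simps)
qed

text \<open>The exponential bounds the N-fold Gronwall product for q = p / 2; the summand 1 is for
  increments beyond the truncation level.\<close>

definition moment_const :: real where
  "moment_const = exp (2 * (p / 2 + (p / 2 + 2 * (p / 2)\<^sup>2 * exp (2 * (p / 2)) + 4 powr (p / 2))) * incr_const) + 1"

text \<open>The cap \<open>K\<close> allows large increments to be discarded: on that event the
  integrand is at most K^p, whatever the size of the jump. The bound depends on none of
  \<open>K\<close>, \<open>n\<close> and the weights, so the cap can be lifted afterwards.\<close>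

theorem array_moment_bound:
  assumes \<theta>: "\<And>N j k. \<bar>\<theta> N j k\<bar> \<le> 1" and K: "0 \<le> K"
  shows "eventually (\<lambda>N. (\<integral>\<^sup>+\<omega>. ennreal ((min (norm (\<Sum>j<N. diag n (\<theta> N j) (\<omega> j))) K) powr p) \<partial>PiM {..<N} (\<lambda>_. \<rho> N))
    \<le> ennreal moment_const) sequentially"
proof -
  \<comment> \<open>With R^p \<ge> K^p * \<open>incr_const\<close>, a union bound over the N
    increments charges at most 1 to the event that one of them exceeds \<open>R\<close>.\<close>
  define R where "R = max 1 ((K powr p * incr_const) powr (1 / p))"
  have R: "1 \<le> R" by (simp add: R_def)
  have c: "0 \<le> incr_const" using array_const_pos array_const_le_incr_const by simp
  have RK: "K powr p * incr_const \<le> R powr p"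
  proof -
    have "K powr p * incr_const = ((K powr p * incr_const) powr (1 / p)) powr p"
      using p c by (simp add: powr_powr)
    also have "\<dots> \<le> R powr p" using p by (intro powr_mono2) (auto simp: R_def)
    finally show ?thesis .
  qed
  show ?thesis
    using increment_estimates[OF R, of n]
  proof eventually_elim
    case (elim N)
    then have N: "0 < N" by simp
    interpret prob_space "\<rho> N" by (rule prob_rho[OF N])
    interpret PP: product_prob_space "\<lambda>_::nat. \<rho> N" "{..<N}" ..
    note [measurable_cong] = sets_rho[of N]
    have sp: "space (\<rho> N) = UNIV" using sets_eq_imp_space_eq[OF sets_rho[of N]] by simp
    have [measurable]: "lyap q \<in> borel_measurable borel" for q :: real unfolding lyap_def[abs_def] by measurable
    let ?T = "\<lambda>j d. if norm (proj n d) \<le> R then diag n (\<theta> N j) d else 0"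
    let ?J = "\<lambda>d. indicator {x. R < norm (proj n x)} d :: real"
    \<comment> \<open>Either no increment exceeds \<open>R\<close>, and the truncated and the true
      sum agree, or the indicator of an exceeding one pays K^p.\<close>
    have pt: "(min (norm (\<Sum>j<N. diag n (\<theta> N j) (\<omega> j))) K) powr p
        \<le> lyap (p / 2) (\<Sum>j<N. ?T j (\<omega> j)) + (\<Sum>j<N. K powr p * ?J (\<omega> j))" for \<omega>
    proof (cases "\<forall>j<N. norm (proj n (\<omega> j)) \<le> R")
      case True
      then have eq: "(\<Sum>j<N. ?T j (\<omega> j)) = (\<Sum>j<N. diag n (\<theta> N j) (\<omega> j))" by (intro sum.cong) auto
      define S where "S = (\<Sum>j<N. diag n (\<theta> N j) (\<omega> j))"
      have "(min (norm S) K) powr p \<le> norm S powr p" using p K by (intro powr_mono2) auto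
      also have "\<dots> = ((norm S)\<^sup>2) powr (p / 2)" by (simp add: powr_powr flip: powr_numeral)
      also have "\<dots> \<le> lyap (p / 2) S" unfolding lyap_def using p by (intro powr_mono2) auto
      moreover have "0 \<le> (\<Sum>j<N. K powr p * ?J (\<omega> j))" by (intro sum_nonneg) auto
      ultimately show ?thesis unfolding eq S_def[symmetric] by linarith
    next
      case False
      then obtain i where i: "i < N" "R < norm (proj n (\<omega> i))" by (auto simp: not_le)
      have "(min (norm (\<Sum>j<N. diag n (\<theta> N j) (\<omega> j))) K) powr p \<le> K powr p"
        using p K by (intro powr_mono2) auto
      also have "\<dots> = K powr p * ?J (\<omega> i)" using i by simp
      also have "\<dots> \<le> (\<Sum>j<N. K powr p * ?J (\<omega> j))" using i by (intro member_le_sum) auto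
      finally show ?thesis by (simp add: lyap_def add_increasing)
    qed
    have "(\<integral>\<^sup>+\<omega>. ennreal ((min (norm (\<Sum>j<N. diag n (\<theta> N j) (\<omega> j))) K) powr p) \<partial>PiM {..<N} (\<lambda>_. \<rho> N))
      \<le> (\<integral>\<^sup>+\<omega>. ennreal (lyap (p / 2) (\<Sum>j<N. ?T j (\<omega> j))) + (\<Sum>j<N. ennreal (K powr p) * ennreal (?J (\<omega> j))) \<partial>PiM {..<N} (\<lambda>_. \<rho> N))"
    proof (intro nn_integral_mono)
      fix \<omega>
      have "ennreal ((min (norm (\<Sum>j<N. diag n (\<theta> N j) (\<omega> j))) K) powr p)
        \<le> ennreal (lyap (p / 2) (\<Sum>j<N. ?T j (\<omega> j)) + (\<Sum>j<N. K powr p * ?J (\<omega> j)))"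
        by (rule ennreal_leI[OF pt])
      also have "\<dots> = ennreal (lyap (p / 2) (\<Sum>j<N. ?T j (\<omega> j))) + (\<Sum>j<N. ennreal (K powr p) * ennreal (?J (\<omega> j)))"
      proof (subst ennreal_plus)
        have "(\<Sum>j<N. ennreal (K powr p) * ennreal (?J (\<omega> j))) = (\<Sum>j<N. ennreal (K powr p * ?J (\<omega> j)))"
          by (intro sum.cong refl ennreal_mult[symmetric]) auto
        also have "\<dots> = ennreal (\<Sum>j<N. K powr p * ?J (\<omega> j))" by (rule sum_ennreal) auto
        finally show "ennreal (lyap (p / 2) (\<Sum>j<N. ?T j (\<omega> j))) + ennreal (\<Sum>j<N. K powr p * ?J (\<omega> j))
          = ennreal (lyap (p / 2) (\<Sum>j<N. ?T j (\<omega> j))) + (\<Sum>j<N. ennreal (K powr p) * ennreal (?J (\<omega> j)))" by simp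
      qed (auto simp: lyap_def intro!: sum_nonneg)
      finally show "ennreal ((min (norm (\<Sum>j<N. diag n (\<theta> N j) (\<omega> j))) K) powr p)
        \<le> ennreal (lyap (p / 2) (\<Sum>j<N. ?T j (\<omega> j))) + (\<Sum>j<N. ennreal (K powr p) * ennreal (?J (\<omega> j)))" .
    qed
    also have "\<dots> = (\<integral>\<^sup>+\<omega>. ennreal (lyap (p / 2) (\<Sum>j<N. ?T j (\<omega> j))) \<partial>PiM {..<N} (\<lambda>_. \<rho> N))
       + (\<Sum>j<N. ennreal (K powr p) * (\<integral>\<^sup>+\<omega>. ennreal (?J (\<omega> j)) \<partial>PiM {..<N} (\<lambda>_. \<rho> N)))"
      by (subst nn_integral_add, measurable, subst nn_integral_sum, measurable) (simp add: nn_integral_cmult)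
    also have "(\<integral>\<^sup>+\<omega>. ennreal (lyap (p / 2) (\<Sum>j<N. ?T j (\<omega> j))) \<partial>PiM {..<N} (\<lambda>_. \<rho> N))
        \<le> ennreal ((1 + 2 * (p / 2 + (p / 2 + 2 * (p / 2)\<^sup>2 * exp (2 * (p / 2)) + 4 powr (p / 2))) * (incr_const / N)) ^ N)"
      by (rule lyap_sum_le[OF prob_rho[OF N] sets_rho]) (use elim p R \<theta> in auto)
    also have "\<dots> \<le> ennreal (exp (2 * (p / 2 + (p / 2 + 2 * (p / 2)\<^sup>2 * exp (2 * (p / 2)) + 4 powr (p / 2))) * incr_const))"
    proof (rule ennreal_leI)
      define A where "A = 2 * (p / 2 + (p / 2 + 2 * (p / 2)\<^sup>2 * exp (2 * (p / 2)) + 4 powr (p / 2)))"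
      have "0 \<le> A" using p by (simp add: A_def)
      then have "(1 + (A * incr_const) / real N) ^ N \<le> exp (A * incr_const)"
        using N c by (intro exp_ge_one_plus_x_over_n_power_n) (auto intro: order_trans[of _ 0])
      then show "(1 + 2 * (p / 2 + (p / 2 + 2 * (p / 2)\<^sup>2 * exp (2 * (p / 2)) + 4 powr (p / 2))) * (incr_const / N)) ^ N
        \<le> exp (2 * (p / 2 + (p / 2 + 2 * (p / 2)\<^sup>2 * exp (2 * (p / 2)) + 4 powr (p / 2))) * incr_const)"
        unfolding A_def[symmetric] by simp
    qed
    also have "(\<Sum>j<N. ennreal (K powr p) * (\<integral>\<^sup>+\<omega>. ennreal (?J (\<omega> j)) \<partial>PiM {..<N} (\<lambda>_. \<rho> N))) \<le> ennreal 1"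
    proof -
      have "(\<integral>\<^sup>+\<omega>. ennreal (?J (\<omega> j)) \<partial>PiM {..<N} (\<lambda>_. \<rho> N)) = ennreal (measure (\<rho> N) {x. R < norm (proj n x)})" if "j < N" for j
      proof -
        have "(\<integral>\<^sup>+\<omega>. ennreal (?J (\<omega> j)) \<partial>PiM {..<N} (\<lambda>_. \<rho> N)) = (\<integral>\<^sup>+d. ennreal (?J d) \<partial>distr (PiM {..<N} (\<lambda>_. \<rho> N)) (\<rho> N) (\<lambda>\<omega>. \<omega> j))"
          using that by (subst nn_integral_distr) auto
        also have "\<dots> = (\<integral>\<^sup>+d. ennreal (?J d) \<partial>\<rho> N)"
          using that by (subst PP.PiM_component) auto
        also have "\<dots> = emeasure (\<rho> N) {x. R < norm (proj n x)}"
          by (simp add: ennreal_indicator sp)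
        finally show ?thesis by (simp add: emeasure_eq_measure)
      qed
      then have "(\<Sum>j<N. ennreal (K powr p) * (\<integral>\<^sup>+\<omega>. ennreal (?J (\<omega> j)) \<partial>PiM {..<N} (\<lambda>_. \<rho> N)))
        = (\<Sum>j<N. ennreal (K powr p * measure (\<rho> N) {x. R < norm (proj n x)}))"
        by (intro sum.cong) (auto simp: ennreal_mult)
      also have "\<dots> = ennreal (N * (K powr p * measure (\<rho> N) {x. R < norm (proj n x)}))"
        by (simp add: ennreal_of_nat_eq_real_of_nat ennreal_mult)
      also have "\<dots> \<le> ennreal (K powr p * incr_const / R powr p)"
      proof (rule ennreal_leI)
        have "real N * (K powr p * measure (\<rho> N) {x. R < norm (proj n x)}) \<le> real N * (K powr p * (incr_const / N / R powr p))"
          using elim by (intro mult_left_mono) auto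
        then show "real N * (K powr p * measure (\<rho> N) {x. R < norm (proj n x)}) \<le> K powr p * incr_const / R powr p"
          using N by simp
      qed
      also have "\<dots> \<le> ennreal 1"
        using RK R by (intro ennreal_leI) (simp add: divide_le_eq)
      finally show ?thesis .
    qed
    finally show ?case by (simp add: moment_const_def ennreal_plus add_right_mono add_left_mono)
  qed
qed

end

section \<open>Riemann sums of right-continuous paths\<close>

definition cadlag :: "(real \<Rightarrow> real) \<Rightarrow> bool" where
  "cadlag y \<longleftrightarrow> (\<forall>t\<ge>0. continuous (at_right t) y \<and> (t > 0 \<longrightarrow> (\<exists>l. (y \<longlongrightarrow> l) (at_left t))))"

text \<open>One-sided limits bound the path on either side of each point, and compactness of the
  interval does the rest.\<close>

lemma cadlag_bounded:
  assumes y: "cadlag y"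
  obtains B where "0 \<le> B" "\<And>s. 0 \<le> s \<Longrightarrow> s \<le> b \<Longrightarrow> \<bar>y s\<bar> \<le> B"
proof -
  have ex: "\<exists>U. open U \<and> t \<in> U \<and> (\<exists>B. \<forall>s\<in>U. 0 \<le> s \<longrightarrow> \<bar>y s\<bar> \<le> B)" if t: "0 \<le> t" for t
  proof -
    have "(y \<longlongrightarrow> y t) (at_right t)"
      using y t by (auto simp: cadlag_def continuous_within)
    then have "eventually (\<lambda>s. dist (y s) (y t) < 1) (at_right t)"
      by (rule tendstoD) simp
    then obtain d where d: "d > t" "\<And>s. t < s \<Longrightarrow> s < d \<Longrightarrow> dist (y s) (y t) < 1"
      unfolding eventually_at_right_field by blast
    have "\<exists>c B. c < t \<and> (\<forall>s. c < s \<and> s < t \<and> 0 \<le> s \<longrightarrow> \<bar>y s\<bar> \<le> B)"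
    proof (cases "t = 0")
      case True
      then show ?thesis by (intro exI[of _ "-1"]) auto
    next
      case False
      then obtain l where "(y \<longlongrightarrow> l) (at_left t)" using y t by (auto simp: cadlag_def)
      then have "eventually (\<lambda>s. dist (y s) l < 1) (at_left t)" by (rule tendstoD) simp
      then obtain c where c: "c < t" "\<And>s. c < s \<Longrightarrow> s < t \<Longrightarrow> dist (y s) l < 1"
        unfolding eventually_at_left_field by blast
      have "\<bar>y s\<bar> \<le> \<bar>l\<bar> + 1" if "c < s" "s < t" for s
        using c(2)[OF that] by (simp add: dist_real_def)
      then show ?thesis using c(1) by blast
    qed
    then obtain c B where c: "c < t" "\<And>s. c < s \<Longrightarrow> s < t \<Longrightarrow> 0 \<le> s \<Longrightarrow> \<bar>y s\<bar> \<le> B" by blast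
    have "\<bar>y s\<bar> \<le> max B (\<bar>y t\<bar> + 1)" if "s \<in> {c<..<d}" "0 \<le> s" for s
    proof (cases s t rule: linorder_cases)
      case less
      then show ?thesis using c(2)[of s] that by auto
    next
      case equal
      then show ?thesis by simp
    next
      case greater
      then have "dist (y s) (y t) < 1" using d(2) that by auto
      then show ?thesis by (simp add: dist_real_def)
    qed
    then show ?thesis using c(1) d(1) by (intro exI[of _ "{c<..<d}"] conjI exI[of _ "max B (\<bar>y t\<bar> + 1)"]) auto
  qed
  define U where "U t = (SOME U. open U \<and> t \<in> U \<and> (\<exists>B. \<forall>s\<in>U. 0 \<le> s \<longrightarrow> \<bar>y s\<bar> \<le> B))" for t
  have U: "open (U t)" "t \<in> U t" "\<exists>B. \<forall>s\<in>U t. 0 \<le> s \<longrightarrow> \<bar>y s\<bar> \<le> B" if "0 \<le> t" for t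
    using someI_ex[OF ex[OF that]] by (simp_all add: U_def)
  obtain T where T: "T \<subseteq> {0..b}" "finite T" "{0..b} \<subseteq> (\<Union>t\<in>T. U t)"
    by (rule compactE_image[of "{0..b}" "{0..b}" U]) (use U in auto)
  have "\<forall>t\<in>T. \<exists>B. \<forall>s\<in>U t. 0 \<le> s \<longrightarrow> \<bar>y s\<bar> \<le> B" using T U by auto
  then obtain B where B: "\<And>t s. t \<in> T \<Longrightarrow> s \<in> U t \<Longrightarrow> 0 \<le> s \<Longrightarrow> \<bar>y s\<bar> \<le> B t" by metis
  show ?thesis
  proof
    show "0 \<le> (\<Sum>t\<in>T. \<bar>B t\<bar>)" by (simp add: sum_nonneg)
    fix s assume s: "0 \<le> s" "s \<le> b"
    then obtain t where t: "t \<in> T" "s \<in> U t" using T by auto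
    have "\<bar>y s\<bar> \<le> \<bar>B t\<bar>" using B[OF t s(1)] by simp
    also have "\<dots> \<le> (\<Sum>t\<in>T. \<bar>B t\<bar>)" using t T by (intro member_le_sum) auto
    finally show "\<bar>y s\<bar> \<le> (\<Sum>t\<in>T. \<bar>B t\<bar>)" .
  qed
qed

definition riemann_sum :: "(real \<Rightarrow> real) \<Rightarrow> (real \<Rightarrow> real) \<Rightarrow> real \<Rightarrow> real \<Rightarrow> nat \<Rightarrow> real" where
  "riemann_sum f y a \<tau> N = (\<Sum>j<N. f (a + j * (\<tau> / N)) * (y (a + Suc j * (\<tau> / N)) - y (a + j * (\<tau> / N))))"

text \<open>The integral of c * exp (\<kappa> * s) against dy(s) over [a, b] after integration by
  parts, which is meaningful for paths of unbounded variation.\<close>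

definition exp_integral :: "real \<Rightarrow> real \<Rightarrow> (real \<Rightarrow> real) \<Rightarrow> real \<Rightarrow> real \<Rightarrow> real" where
  "exp_integral c \<kappa> y a b = c * exp (\<kappa> * b) * y b - c * exp (\<kappa> * a) * y a
     - (\<integral>s. indicator {a..b} s * (\<kappa> * (c * exp (\<kappa> * s)) * y s) \<partial>lborel)"

lemma abel_summation:
  fixes f y :: "nat \<Rightarrow> real"
  shows "(\<Sum>j<N. f j * (y (Suc j) - y j)) = f N * y N - f 0 * y 0 - (\<Sum>j<N. (f (Suc j) - f j) * y (Suc j))"
  by (induction N) (auto simp: algebra_simps)

text \<open>Abel summation moves the differences from \<open>y\<close> to the smooth integrand, and
  the sum becomes an exact integral of the derivative against \<open>y\<close> sampled at the right
  ends of the cells. These lie strictly to the right of \<open>s\<close>, so right continuity gives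
  the pointwise limit and boundedness the domination.\<close>

lemma riemann_sum_exp_tendsto:
  assumes y: "cadlag y" and a: "0 \<le> a" and \<tau>: "0 < \<tau>"
  shows "riemann_sum (\<lambda>s. c * exp (\<kappa> * s)) y a \<tau> \<longlonglongrightarrow> exp_integral c \<kappa> y a (a + \<tau>)"
    and "integrable lborel (\<lambda>s. indicator {a..a + \<tau>} s * (\<kappa> * (c * exp (\<kappa> * s)) * y s))"
proof -
  define f where "f s = c * exp (\<kappa> * s)" for s
  define g where "g N j = a + real j * (\<tau> / real N)" for N j
  \<comment> \<open>Right end of the half-open grid cell containing \<open>s\<close>.\<close>
  define nx where "nx N s = a + (real_of_int \<lfloor>(s - a) * N / \<tau>\<rfloor> + 1) * (\<tau> / real N)" for N s
  have nx_cell: "nx N s = g N (Suc j)" if N: "0 < N" and s: "g N j \<le> s" "s < g N (Suc j)" for N j s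
  proof -
    have "real j \<le> (s - a) * N / \<tau>" "(s - a) * N / \<tau> < real j + 1"
      using s N \<tau> by (auto simp: g_def field_simps)
    then have "\<lfloor>(s - a) * N / \<tau>\<rfloor> = int j" by (intro floor_unique) auto
    then show ?thesis by (simp add: nx_def g_def add.commute)
  qed
  have nx_bounds: "s < nx N s" "nx N s \<le> s + \<tau> / N" if N: "0 < N" for N s
  proof -
    have "(s - a) * N / \<tau> < real_of_int \<lfloor>(s - a) * N / \<tau>\<rfloor> + 1" by linarith
    then have "(s - a) * N / \<tau> * (\<tau> / N) < (real_of_int \<lfloor>(s - a) * N / \<tau>\<rfloor> + 1) * (\<tau> / N)"
      using N \<tau> by (intro mult_strict_right_mono) auto
    then show "s < nx N s" using N \<tau> by (simp add: nx_def)
    have "real_of_int \<lfloor>(s - a) * N / \<tau>\<rfloor> + 1 \<le> (s - a) * N / \<tau> + 1" by linarith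
    then have "(real_of_int \<lfloor>(s - a) * N / \<tau>\<rfloor> + 1) * (\<tau> / N) \<le> ((s - a) * N / \<tau> + 1) * (\<tau> / N)"
      using N \<tau> by (intro mult_right_mono) auto
    also have "((s - a) * N / \<tau> + 1) * (\<tau> / N) = s - a + \<tau> / N" using N \<tau> by (simp add: field_simps)
    finally show "nx N s \<le> s + \<tau> / N" unfolding nx_def by simp
  qed
  have step_int: "has_bochner_integral lborel (\<lambda>s. indicator {a..<g N m} s * (\<kappa> * f s * y (nx N s)))
      (\<Sum>j<m. (f (g N (Suc j)) - f (g N j)) * y (g N (Suc j)))" if N: "0 < N" for N m
  proof (induction m)
    case 0
    show ?case by (simp add: g_def has_bochner_integral_zero)
  next
    case (Suc m)
    have le: "g N m \<le> g N (Suc m)" "a \<le> g N m"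
      using \<tau> unfolding g_def by (auto intro!: mult_right_mono divide_right_mono)
    have "has_bochner_integral lborel (\<lambda>s. (\<kappa> * f s) * indicator {g N m..g N (Suc m)} s) (f (g N (Suc m)) - f (g N m))"
      unfolding f_def by (rule has_bochner_integral_FTC_Icc_real) (auto intro!: derivative_eq_intros le simp: mult.commute)
    then have h: "has_bochner_integral lborel (\<lambda>s. ((\<kappa> * f s) * indicator {g N m..g N (Suc m)} s) * y (g N (Suc m)))
        ((f (g N (Suc m)) - f (g N m)) * y (g N (Suc m)))"
      by (rule has_bochner_integral_mult_left)
    have ae: "AE s in lborel. ((\<kappa> * f s) * indicator {g N m..g N (Suc m)} s) * y (g N (Suc m))
        = indicator {g N m..<g N (Suc m)} s * (\<kappa> * f s * y (nx N s))"
      using AE_lborel_singleton[of "g N (Suc m)"]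
      by eventually_elim (auto simp: indicator_def nx_cell[OF N])
    have nxm: "(\<lambda>s. y (nx N s)) \<in> borel_measurable lborel"
    proof -
      have m1: "(\<lambda>s. \<lfloor>(s - a) * N / \<tau>\<rfloor>) \<in> measurable lborel (count_space UNIV)" by measurable
      show ?thesis
        unfolding nx_def by (rule measurable_compose[OF m1, where g="\<lambda>i. y (a + (real_of_int i + 1) * (\<tau> / real N))"]) simp
    qed
    have m4: "(\<lambda>s. indicator {g N m..<g N (Suc m)} s * (\<kappa> * f s * y (nx N s))) \<in> borel_measurable lborel"
      using nxm unfolding f_def by measurable
    have m3: "(\<lambda>s. ((\<kappa> * f s) * indicator {g N m..g N (Suc m)} s) * y (g N (Suc m))) \<in> borel_measurable lborel"
      unfolding f_def by measurable
    have "has_bochner_integral lborel (\<lambda>s. indicator {g N m..<g N (Suc m)} s * (\<kappa> * f s * y (nx N s)))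
        ((f (g N (Suc m)) - f (g N m)) * y (g N (Suc m)))"
      using has_bochner_integral_cong_AE[OF m3 m4 ae] h by blast
    from has_bochner_integral_add[OF Suc.IH this]
    have "has_bochner_integral lborel (\<lambda>s. indicator {a..<g N m} s * (\<kappa> * f s * y (nx N s))
        + indicator {g N m..<g N (Suc m)} s * (\<kappa> * f s * y (nx N s)))
        (\<Sum>j<Suc m. (f (g N (Suc j)) - f (g N j)) * y (g N (Suc j)))" by simp
    moreover have "indicator {a..<g N m} s * (\<kappa> * f s * y (nx N s)) + indicator {g N m..<g N (Suc m)} s * (\<kappa> * f s * y (nx N s))
        = indicator {a..<g N (Suc m)} s * (\<kappa> * f s * y (nx N s))" for s
      using le by (auto simp: indicator_def)
    ultimately show ?case by simp
  qed
  \<comment> \<open>The crude bound nx N s \<le> s + \<tau> explains the interval up to a + 2 *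
    \<tau>.\<close>
  obtain B where B: "0 \<le> B" "\<And>s. 0 \<le> s \<Longrightarrow> s \<le> a + 2 * \<tau> \<Longrightarrow> \<bar>y s\<bar> \<le> B"
    by (rule cadlag_bounded[OF y]) blast
  define F where "F = \<bar>\<kappa>\<bar> * (\<bar>c\<bar> * exp (\<bar>\<kappa>\<bar> * (a + \<tau>))) * B"
  have F0: "0 \<le> F" using B by (simp add: F_def)
  \<comment> \<open>The shift to \<open>Suc N\<close> avoids the degenerate mesh \<tau> / 0.\<close>
  have lim_pt: "(\<lambda>N. indicator {a..<a + \<tau>} s * (\<kappa> * f s * y (nx (Suc N) s))) \<longlonglongrightarrow> indicator {a..<a + \<tau>} s * (\<kappa> * f s * y s)" for s
  proof (cases "s \<in> {a..<a + \<tau>}")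
    case True
    then have "0 \<le> s" using a by simp
    then have "(y \<longlongrightarrow> y s) (at_right s)" using y by (auto simp: cadlag_def continuous_within)
    moreover have "filterlim (\<lambda>N. nx (Suc N) s) (at_right s) sequentially"
      unfolding filterlim_at
    proof
      have "(\<lambda>N. s + \<tau> / real (Suc N)) \<longlonglongrightarrow> s + 0"
        by (intro tendsto_intros LIMSEQ_Suc[OF lim_const_over_n])
      then have lim: "(\<lambda>N. s + \<tau> / real (Suc N)) \<longlonglongrightarrow> s" by simp
      show "(\<lambda>N. nx (Suc N) s) \<longlonglongrightarrow> s"
      proof (rule tendsto_sandwich[OF _ _ tendsto_const lim])
        show "eventually (\<lambda>N. s \<le> nx (Suc N) s) sequentially"
          by (intro always_eventually allI less_imp_le nx_bounds) simp
        show "eventually (\<lambda>N. nx (Suc N) s \<le> s + \<tau> / real (Suc N)) sequentially"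
          by (intro always_eventually allI nx_bounds) simp
      qed
      show "eventually (\<lambda>N. nx (Suc N) s \<in> {s<..} \<and> nx (Suc N) s \<noteq> s) sequentially"
      proof (intro always_eventually allI conjI)
        fix N
        have "s < nx (Suc N) s" by (rule nx_bounds) simp
        then show "nx (Suc N) s \<in> {s<..}" "nx (Suc N) s \<noteq> s" by auto
      qed
    qed
    ultimately have "(\<lambda>N. y (nx (Suc N) s)) \<longlonglongrightarrow> y s" by (rule filterlim_compose)
    then show ?thesis by (intro tendsto_mult tendsto_const)
  qed simp
  have bound: "\<bar>indicator {a..<a + \<tau>} s * (\<kappa> * f s * y (nx (Suc N) s))\<bar> \<le> F * indicator {a..<a + \<tau>} s" for N s
  proof (cases "s \<in> {a..<a + \<tau>}")
    case True
    have "\<tau> / real (Suc N) \<le> \<tau>" using \<tau> by (simp add: field_simps)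
    then have "\<bar>y (nx (Suc N) s)\<bar> \<le> B"
      using nx_bounds[of "Suc N" s] True a by (intro B(2)) auto
    moreover have "\<kappa> * s \<le> \<bar>\<kappa>\<bar> * (a + \<tau>)"
      using True a by (intro mult_mono) auto
    then have "\<bar>\<kappa> * f s\<bar> \<le> \<bar>\<kappa>\<bar> * (\<bar>c\<bar> * exp (\<bar>\<kappa>\<bar> * (a + \<tau>)))"
      by (simp add: f_def abs_mult mult_left_mono)
    ultimately have "\<bar>\<kappa> * f s\<bar> * \<bar>y (nx (Suc N) s)\<bar> \<le> F"
      unfolding F_def by (intro mult_mono) auto
    then show ?thesis using True by (simp add: abs_mult)
  qed simp
  have meas: "(\<lambda>s. indicator {a..<a + \<tau>} s * (\<kappa> * f s * y (nx (Suc N) s))) \<in> borel_measurable lborel" for N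
  proof -
    have "g (Suc N) (Suc N) = a + \<tau>" by (simp add: g_def)
    then show ?thesis
      using step_int[of "Suc N" "Suc N"] by (auto simp: has_bochner_integral_iff dest: borel_measurable_integrable)
  qed
  \<comment> \<open>Measurability of the path on the interval is obtained here, as a limit of step
    functions.\<close>
  have meas_lim: "(\<lambda>s. indicator {a..<a + \<tau>} s * (\<kappa> * f s * y s)) \<in> borel_measurable lborel"
    by (rule borel_measurable_LIMSEQ_metric[OF meas lim_pt])
  have Fint: "integrable lborel (\<lambda>s. F * indicator {a..<a + \<tau>} s)" using \<tau> by simp
  have "(\<lambda>N. \<integral>s. indicator {a..<a + \<tau>} s * (\<kappa> * f s * y (nx (Suc N) s)) \<partial>lborel)
      \<longlonglongrightarrow> (\<integral>s. indicator {a..<a + \<tau>} s * (\<kappa> * f s * y s) \<partial>lborel)"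
    using bound lim_pt by (intro integral_dominated_convergence[OF meas_lim meas Fint]) auto
  moreover have ae: "AE s in lborel. indicator {a..<a + \<tau>} s * (\<kappa> * f s * y s) = indicator {a..a + \<tau>} s * (\<kappa> * f s * y s)"
    using AE_lborel_singleton[of "a + \<tau>"] by eventually_elim (auto simp: indicator_def)
  have meas2: "(\<lambda>s. indicator {a..a + \<tau>} s * (\<kappa> * f s * y s)) \<in> borel_measurable lborel"
  proof -
    have "(\<lambda>s. indicator {a..<a + \<tau>} s * (\<kappa> * f s * y s) + indicator {a + \<tau>} s * (\<kappa> * f (a + \<tau>) * y (a + \<tau>))) \<in> borel_measurable lborel"
      using meas_lim by measurable
    also have "(\<lambda>s. indicator {a..<a + \<tau>} s * (\<kappa> * f s * y s) + indicator {a + \<tau>} s * (\<kappa> * f (a + \<tau>) * y (a + \<tau>)))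
        = (\<lambda>s. indicator {a..a + \<tau>} s * (\<kappa> * f s * y s))"
      using \<tau> by (auto simp: fun_eq_iff indicator_def)
    finally show ?thesis .
  qed
  moreover have "(\<integral>s. indicator {a..<a + \<tau>} s * (\<kappa> * f s * y s) \<partial>lborel) = (\<integral>s. indicator {a..a + \<tau>} s * (\<kappa> * f s * y s) \<partial>lborel)"
    by (rule integral_cong_AE[OF meas_lim meas2 ae])
  moreover have "(\<integral>s. indicator {a..<a + \<tau>} s * (\<kappa> * f s * y (nx (Suc N) s)) \<partial>lborel)
      = f (a + \<tau>) * y (a + \<tau>) - f a * y a - riemann_sum f y a \<tau> (Suc N)" for N
  proof -
    have g: "g (Suc N) (Suc N) = a + \<tau>" "g (Suc N) 0 = a" by (simp_all add: g_def)
    have "riemann_sum f y a \<tau> (Suc N) = (\<Sum>j<Suc N. f (g (Suc N) j) * (y (g (Suc N) (Suc j)) - y (g (Suc N) j)))"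
      by (simp only: riemann_sum_def g_def)
    also have "\<dots> = f (a + \<tau>) * y (a + \<tau>) - f a * y a - (\<Sum>j<Suc N. (f (g (Suc N) (Suc j)) - f (g (Suc N) j)) * y (g (Suc N) (Suc j)))"
      by (subst abel_summation) (simp only: g)
    finally show ?thesis
      using step_int[of "Suc N" "Suc N"] unfolding g by (simp add: has_bochner_integral_iff)
  qed
  ultimately have "(\<lambda>N. f (a + \<tau>) * y (a + \<tau>) - f a * y a - riemann_sum f y a \<tau> (Suc N))
      \<longlonglongrightarrow> (\<integral>s. indicator {a..a + \<tau>} s * (\<kappa> * f s * y s) \<partial>lborel)" by simp
  from tendsto_diff[OF tendsto_const[of "f (a + \<tau>) * y (a + \<tau>) - f a * y a"] this]
  have "(\<lambda>N. riemann_sum f y a \<tau> (Suc N)) \<longlonglongrightarrow> exp_integral c \<kappa> y a (a + \<tau>)"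
    by (simp add: exp_integral_def f_def)
  then show "riemann_sum (\<lambda>s. c * exp (\<kappa> * s)) y a \<tau> \<longlonglongrightarrow> exp_integral c \<kappa> y a (a + \<tau>)"
    unfolding f_def[symmetric] by (rule LIMSEQ_imp_Suc)
  have "integrable lborel (\<lambda>s. indicator {a..<a + \<tau>} s * (\<kappa> * f s * y s))"
    by (rule integrable_dominated_convergence[OF meas_lim _ Fint,
          where s = "\<lambda>N s. indicator {a..<a + \<tau>} s * (\<kappa> * f s * y (nx (Suc N) s))"])
      (use bound lim_pt meas in auto)
  then show "integrable lborel (\<lambda>s. indicator {a..a + \<tau>} s * (\<kappa> * (c * exp (\<kappa> * s)) * y s))"
    using integrable_cong_AE[OF meas_lim meas2 ae] by (simp add: f_def)
qed

lemma exp_integral_add: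
  assumes y: "cadlag y" and "0 \<le> a" "a < b" "b < d"
  shows "exp_integral c \<kappa> y a b + exp_integral c \<kappa> y b d = exp_integral c \<kappa> y a d"
proof -
  have i: "integrable lborel (\<lambda>s. indicator {a..b} s * (\<kappa> * (c * exp (\<kappa> * s)) * y s))"
    "integrable lborel (\<lambda>s. indicator {b..d} s * (\<kappa> * (c * exp (\<kappa> * s)) * y s))"
    "integrable lborel (\<lambda>s. indicator {a..d} s * (\<kappa> * (c * exp (\<kappa> * s)) * y s))"
    using riemann_sum_exp_tendsto(2)[OF y, of a "b - a" \<kappa> c] riemann_sum_exp_tendsto(2)[OF y, of b "d - b" \<kappa> c]
      riemann_sum_exp_tendsto(2)[OF y, of a "d - a" \<kappa> c] assms by auto
  have "(\<integral>s. indicator {a..d} s * (\<kappa> * (c * exp (\<kappa> * s)) * y s) \<partial>lborel)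
    = (\<integral>s. indicator {a..b} s * (\<kappa> * (c * exp (\<kappa> * s)) * y s) + indicator {b..d} s * (\<kappa> * (c * exp (\<kappa> * s)) * y s) \<partial>lborel)"
  proof (rule integral_cong_AE)
    show "AE s in lborel. indicator {a..d} s * (\<kappa> * (c * exp (\<kappa> * s)) * y s)
      = indicator {a..b} s * (\<kappa> * (c * exp (\<kappa> * s)) * y s) + indicator {b..d} s * (\<kappa> * (c * exp (\<kappa> * s)) * y s)"
      using AE_lborel_singleton[of b] by eventually_elim (use assms in \<open>auto simp: indicator_def\<close>)
  qed (use i in \<open>auto dest: borel_measurable_integrable\<close>)
  also have "\<dots> = (\<integral>s. indicator {a..b} s * (\<kappa> * (c * exp (\<kappa> * s)) * y s) \<partial>lborel)
      + (\<integral>s. indicator {b..d} s * (\<kappa> * (c * exp (\<kappa> * s)) * y s) \<partial>lborel)"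
    by (rule Bochner_Integration.integral_add[OF i(1,2)])
  finally show ?thesis by (simp add: exp_integral_def)
qed

section \<open>The stochastic convolution\<close>

locale heat_levy = heat e lam + levy_triplet e b Q \<nu>
  for e :: "nat \<Rightarrow> 'a::{real_inner, polish_space}" and lam b Q \<nu> +
  fixes M :: "'w measure" and L :: "real \<Rightarrow> 'w \<Rightarrow> 'a" and p :: real
  assumes levy: "levy_process M L" and char: "levy_char M L b Q \<nu>" and p: "0 < p"
    and moment: "(\<integral>\<^sup>+ x. ennreal (indicator {x. norm x > 1} x * norm x powr p) \<partial>\<nu>) < \<infinity>"
begin

sublocale prob_space M
  using levy by (simp add: levy_process_def)

lemma borel_measurable_L[measurable]: "L t \<in> borel_measurable M"
  using levy by (simp add: levy_process_def)

definition incr :: "real \<Rightarrow> real \<Rightarrow> nat \<Rightarrow> nat \<Rightarrow> 'w \<Rightarrow> 'a" where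
  "incr a \<tau> N j \<omega> = L (a + Suc j * (\<tau> / N)) \<omega> - L (a + j * (\<tau> / N)) \<omega>"

lemma borel_measurable_incr[measurable]: "incr a \<tau> N j \<in> borel_measurable M"
  unfolding incr_def[abs_def] by measurable

abbreviation incr_law :: "real \<Rightarrow> nat \<Rightarrow> 'a measure" where
  "incr_law \<tau> N \<equiv> distr M borel (L (\<tau> / N))"

lemma distr_incr:
  assumes "0 \<le> a" "0 < \<tau>" "0 < N"
  shows "distr M borel (incr a \<tau> N j) = incr_law \<tau> N"
proof -
  have "\<forall>s t. 0 \<le> s \<and> 0 \<le> t \<longrightarrow> distr M borel (\<lambda>\<omega>. L (s + t) \<omega> - L s \<omega>) = distr M borel (L t)"
    using levy by (simp add: levy_process_def)
  from this[rule_format, of "a + j * (\<tau> / N)" "\<tau> / N"] assms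
  have "distr M borel (\<lambda>\<omega>. L (a + j * (\<tau> / N) + \<tau> / N) \<omega> - L (a + j * (\<tau> / N)) \<omega>) = incr_law \<tau> N"
    by simp
  moreover have "a + Suc j * (\<tau> / N) = a + j * (\<tau> / N) + \<tau> / N" by (simp add: distrib_right add_divide_distrib)
  ultimately show ?thesis by (simp only: incr_def[abs_def])
qed

lemma distr_incr_PiM:
  assumes "0 \<le> a" "0 < \<tau>" "0 < N"
  shows "distr M (PiM {..<N} (\<lambda>_. borel)) (\<lambda>\<omega>. \<lambda>j\<in>{..<N}. incr a \<tau> N j \<omega>) = PiM {..<N} (\<lambda>_. incr_law \<tau> N)"
proof -
  have ind: "\<forall>(n::nat) (t::nat \<Rightarrow> real). 0 \<le> t 0 \<and> (\<forall>i<n. t i \<le> t (Suc i)) \<longrightarrow>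
        indep_vars (\<lambda>_. borel) (\<lambda>i \<omega>. L (t (Suc i)) \<omega> - L (t i) \<omega>) {..<n}"
    using levy by (simp add: levy_process_def)
  have "indep_vars (\<lambda>_. borel) (incr a \<tau> N) {..<N}"
    unfolding incr_def[abs_def]
    by (rule ind[rule_format, of "\<lambda>i. a + real i * (\<tau> / real N)" N])
      (use assms in \<open>auto intro!: mult_right_mono divide_right_mono\<close>)
  then have "distr M (PiM {..<N} (\<lambda>_. borel)) (\<lambda>\<omega>. \<lambda>j\<in>{..<N}. incr a \<tau> N j \<omega>)
      = PiM {..<N} (\<lambda>j. distr M borel (incr a \<tau> N j))"
    using assms(3) by (subst (asm) indep_vars_iff_distr_eq_PiM) auto
  then show ?thesis using assms by (simp add: distr_incr)
qed

lemma levy_array_incr_law: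
  assumes "0 < \<tau>"
  shows "levy_array_moment e b Q \<nu> \<tau> (incr_law \<tau>) p"
proof (intro levy_array_moment.intro levy_array.intro levy_array_axioms.intro levy_array_moment_axioms.intro
    levy_triplet_axioms)
  show "0 \<le> \<tau>" using assms by simp
  show "prob_space (incr_law \<tau> N)" if "0 < N" for N by (rule prob_space_distr) simp
  show "sets (incr_law \<tau> N) = sets borel" for N by simp
  show "(\<integral>x. cis (inner u x) \<partial>incr_law \<tau> N) = exp (complex_of_real (\<tau> / N) * psi u)" if "0 < N" for N u
  proof -
    have "(\<integral>x. cis (inner u x) \<partial>incr_law \<tau> N) = (\<integral>\<omega>. cis (inner u (L (\<tau> / N) \<omega>)) \<partial>M)"
      by (rule integral_distr) (auto simp: cis_conv_exp)
    then show ?thesis using char assms by (simp add: levy_char_def)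
  qed
qed (fact p moment)+

definition weighted_sum :: "nat \<Rightarrow> (nat \<Rightarrow> nat \<Rightarrow> real) \<Rightarrow> real \<Rightarrow> real \<Rightarrow> nat \<Rightarrow> 'w \<Rightarrow> 'a" where
  "weighted_sum n \<theta> a \<tau> N \<omega> = (\<Sum>j<N. diag n (\<theta> j) (incr a \<tau> N j \<omega>))"

lemma weighted_sum_measurable[measurable]: "weighted_sum n \<theta> a \<tau> N \<in> borel_measurable M"
  unfolding weighted_sum_def[abs_def] by measurable

lemma weighted_sum_eq:
  "weighted_sum n \<theta> a \<tau> N \<omega> = (\<Sum>k<n. (\<Sum>j<N. \<theta> j k * inner (e k) (incr a \<tau> N j \<omega>)) *\<^sub>R e k)"
  unfolding weighted_sum_def diag_def scaleR_sum_left by (rule sum.swap)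

lemma nn_integral_weighted_sum:
  assumes "0 \<le> a" "0 < \<tau>" "0 < N" and [measurable]: "f \<in> borel_measurable borel"
  shows "(\<integral>\<^sup>+\<omega>. f (weighted_sum n \<theta> a \<tau> N \<omega>) \<partial>M)
    = (\<integral>\<^sup>+\<omega>. f (\<Sum>j<N. diag n (\<theta> j) (\<omega> j)) \<partial>PiM {..<N} (\<lambda>_. incr_law \<tau> N))"
proof -
  have [measurable]: "(\<lambda>\<omega>. f (\<Sum>j<N. diag n (\<theta> j) (\<omega> j))) \<in> borel_measurable (PiM {..<N} (\<lambda>_. borel))"
    by measurable
  have "(\<integral>\<^sup>+\<omega>. f (weighted_sum n \<theta> a \<tau> N \<omega>) \<partial>M)
      = (\<integral>\<^sup>+\<omega>. f (\<Sum>j<N. diag n (\<theta> j) ((\<lambda>j\<in>{..<N}. incr a \<tau> N j \<omega>) j)) \<partial>M)"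
    by (simp add: weighted_sum_def)
  also have "\<dots> = (\<integral>\<^sup>+\<omega>. f (\<Sum>j<N. diag n (\<theta> j) (\<omega> j))
      \<partial>distr M (PiM {..<N} (\<lambda>_. borel)) (\<lambda>\<omega>. \<lambda>j\<in>{..<N}. incr a \<tau> N j \<omega>))"
    by (rule nn_integral_distr[symmetric]) measurable
  finally show ?thesis unfolding distr_incr_PiM[OF assms(1-3)] .
qed

lemma integral_weighted_sum:
  fixes f :: "'a \<Rightarrow> real"
  assumes "0 \<le> a" "0 < \<tau>" "0 < N" and [measurable]: "f \<in> borel_measurable borel"
  shows "(\<integral>\<omega>. f (weighted_sum n \<theta> a \<tau> N \<omega>) \<partial>M)
    = (\<integral>\<omega>. f (\<Sum>j<N. diag n (\<theta> j) (\<omega> j)) \<partial>PiM {..<N} (\<lambda>_. incr_law \<tau> N))"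
proof -
  have [measurable]: "(\<lambda>\<omega>. f (\<Sum>j<N. diag n (\<theta> j) (\<omega> j))) \<in> borel_measurable (PiM {..<N} (\<lambda>_. borel))"
    by measurable
  have "(\<integral>\<omega>. f (weighted_sum n \<theta> a \<tau> N \<omega>) \<partial>M)
      = (\<integral>\<omega>. f (\<Sum>j<N. diag n (\<theta> j) ((\<lambda>j\<in>{..<N}. incr a \<tau> N j \<omega>) j)) \<partial>M)"
    by (simp add: weighted_sum_def)
  also have "\<dots> = (\<integral>\<omega>. f (\<Sum>j<N. diag n (\<theta> j) (\<omega> j))
      \<partial>distr M (PiM {..<N} (\<lambda>_. borel)) (\<lambda>\<omega>. \<lambda>j\<in>{..<N}. incr a \<tau> N j \<omega>))"
    by (rule integral_distr[symmetric]) measurable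
  finally show ?thesis unfolding distr_incr_PiM[OF assms(1-3)] .
qed

text \<open>The increments over a uniform grid are exchangeable, so the time reversal of the weights does not
  change the law.\<close>

lemma integral_weighted_sum_reverse:
  fixes f :: "'a \<Rightarrow> real"
  assumes "0 \<le> a" "0 < \<tau>" "0 < N" and [measurable]: "f \<in> borel_measurable borel"
  shows "(\<integral>\<omega>. f (weighted_sum n \<theta> a \<tau> N \<omega>) \<partial>M) = (\<integral>\<omega>. f (weighted_sum n (\<lambda>j. \<theta> (N - 1 - j)) a \<tau> N \<omega>) \<partial>M)"
proof -
  let ?P = "PiM {..<N} (\<lambda>_. incr_law \<tau> N)"
  have pr: "prob_space (incr_law \<tau> N)" by (rule prob_space_distr) simp
  have inj: "inj_on (\<lambda>j. N - 1 - j) {..<N}" by (auto simp: inj_on_def)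
  have reindex: "distr ?P ?P (\<lambda>\<omega>. \<lambda>j\<in>{..<N}. \<omega> (N - 1 - j)) = ?P"
    using distr_PiM_reindex[of "{..<N}" "\<lambda>_. incr_law \<tau> N" "\<lambda>j. N - 1 - j" "{..<N}"] pr inj assms(3) by auto
  have [measurable]: "(\<lambda>\<omega>. f (\<Sum>j<N. diag n (\<theta> j) (\<omega> j))) \<in> borel_measurable ?P"
    by measurable
  have rev: "(\<Sum>j<N. g (N - 1 - j)) = (\<Sum>j<N. g j)" for g :: "nat \<Rightarrow> 'a"
    using sum.nat_diff_reindex[of g N] by simp
  have "(\<integral>\<omega>. f (\<Sum>j<N. diag n (\<theta> j) (\<omega> j)) \<partial>?P)
      = (\<integral>\<omega>. f (\<Sum>j<N. diag n (\<theta> j) (\<omega> j)) \<partial>distr ?P ?P (\<lambda>\<omega>. \<lambda>j\<in>{..<N}. \<omega> (N - 1 - j)))"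
    by (simp only: reindex)
  also have "\<dots> = (\<integral>\<omega>. f (\<Sum>j<N. diag n (\<theta> j) ((\<lambda>j\<in>{..<N}. \<omega> (N - 1 - j)) j)) \<partial>?P)"
    by (rule integral_distr) (auto intro!: measurable_restrict measurable_component_singleton)
  also have "\<dots> = (\<integral>\<omega>. f (\<Sum>j<N. diag n (\<theta> (N - 1 - j)) (\<omega> j)) \<partial>?P)"
  proof (rule Bochner_Integration.integral_cong[OF refl])
    fix \<omega>
    have "(\<Sum>j<N. diag n (\<theta> j) ((\<lambda>j\<in>{..<N}. \<omega> (N - 1 - j)) j)) = (\<Sum>j<N. diag n (\<theta> j) (\<omega> (N - 1 - j)))"
      by (intro sum.cong) auto
    also have "\<dots> = (\<Sum>j<N. diag n (\<theta> (N - 1 - (N - 1 - j))) (\<omega> (N - 1 - j)))"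
      by (intro sum.cong) auto
    also have "\<dots> = (\<Sum>j<N. diag n (\<theta> (N - 1 - j)) (\<omega> j))"
      by (rule rev)
    finally show "f (\<Sum>j<N. diag n (\<theta> j) ((\<lambda>j\<in>{..<N}. \<omega> (N - 1 - j)) j)) = f (\<Sum>j<N. diag n (\<theta> (N - 1 - j)) (\<omega> j))"
      by simp
  qed
  finally show ?thesis by (simp add: integral_weighted_sum[OF assms])
qed

section \<open>Moments of limits of weighted sums of increments\<close>

definition conv_const :: "real \<Rightarrow> real" where
  "conv_const \<tau> = levy_array_moment.moment_const e b Q \<nu> \<tau> p"

text \<open>N tends to infinity first, by Fatou with the dimension and the cap fixed; then dimension
  and cap grow, by monotone convergence. Finiteness of the supremum gives the square summability,
  that is, the existence of the vector.\<close>

lemma limit_moment_bound: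
  assumes a: "0 \<le> a" and \<tau>: "0 < \<tau>" and \<theta>: "\<And>N j k. \<bar>\<theta> N j k\<bar> \<le> 1"
    and X[measurable]: "\<And>k. X k \<in> borel_measurable M"
    and lim: "\<And>k. AE \<omega> in M. (\<lambda>N. \<Sum>j<N. \<theta> N j k * inner (e k) (incr a \<tau> N j \<omega>)) \<longlonglongrightarrow> X k \<omega>"
  shows "AE \<omega> in M. summable (\<lambda>k. (X k \<omega>)\<^sup>2)"
    and "(\<integral>\<^sup>+\<omega>. ennreal (norm (vec (\<lambda>k. X k \<omega>)) powr p) \<partial>M) \<le> ennreal (conv_const \<tau>)"
proof -
  interpret A: levy_array_moment e b Q \<nu> \<tau> "incr_law \<tau>" p by (rule levy_array_incr_law[OF \<tau>])
  define S where "S n \<omega> = (\<Sum>k<n. X k \<omega> *\<^sub>R e k)" for n \<omega>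
  have [measurable]: "S n \<in> borel_measurable M" for n unfolding S_def[abs_def] by measurable
  have bound: "(\<integral>\<^sup>+\<omega>. ennreal ((min (norm (S n \<omega>)) K) powr p) \<partial>M) \<le> ennreal (conv_const \<tau>)" if K: "0 \<le> K" for n K
  proof -
    let ?f = "\<lambda>N \<omega>. ennreal ((min (norm (weighted_sum n (\<theta> N) a \<tau> N \<omega>)) K) powr p)"
    have "AE \<omega> in M. \<forall>k. (\<lambda>N. \<Sum>j<N. \<theta> N j k * inner (e k) (incr a \<tau> N j \<omega>)) \<longlonglongrightarrow> X k \<omega>"
      using lim by (simp add: AE_all_countable)
    then have "AE \<omega> in M. ennreal ((min (norm (S n \<omega>)) K) powr p) = liminf (\<lambda>N. ?f N \<omega>)"
    proof eventually_elim
      case (elim \<omega>)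
      have "(\<lambda>N. weighted_sum n (\<theta> N) a \<tau> N \<omega>) \<longlonglongrightarrow> S n \<omega>"
        unfolding weighted_sum_eq S_def using elim by (intro tendsto_intros) auto
      then have "(\<lambda>N. ?f N \<omega>) \<longlonglongrightarrow> ennreal ((min (norm (S n \<omega>)) K) powr p)"
        using p K by (intro tendsto_ennrealI tendsto_powr' tendsto_min tendsto_norm tendsto_const) auto
      then show ?case by (intro lim_imp_Liminf[symmetric]) auto
    qed
    then have "(\<integral>\<^sup>+\<omega>. ennreal ((min (norm (S n \<omega>)) K) powr p) \<partial>M) = (\<integral>\<^sup>+\<omega>. liminf (\<lambda>N. ?f N \<omega>) \<partial>M)"
      by (rule nn_integral_cong_AE)
    also have "\<dots> \<le> liminf (\<lambda>N. \<integral>\<^sup>+\<omega>. ?f N \<omega> \<partial>M)"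
      by (rule nn_integral_liminf) measurable
    also have "\<dots> \<le> liminf (\<lambda>N. ennreal (conv_const \<tau>))"
    proof (rule Liminf_mono)
      show "eventually (\<lambda>N. (\<integral>\<^sup>+\<omega>. ?f N \<omega> \<partial>M) \<le> ennreal (conv_const \<tau>)) sequentially"
        using A.array_moment_bound[of \<theta> K n, OF \<theta> K] eventually_gt_at_top[of 0]
      proof eventually_elim
        case (elim N)
        have "(\<integral>\<^sup>+\<omega>. ?f N \<omega> \<partial>M)
          = (\<integral>\<^sup>+\<omega>. ennreal ((min (norm (\<Sum>j<N. diag n (\<theta> N j) (\<omega> j))) K) powr p) \<partial>PiM {..<N} (\<lambda>_. incr_law \<tau> N))"
          by (rule nn_integral_weighted_sum[OF a \<tau> elim(2), of "\<lambda>x. ennreal ((min (norm x) K) powr p)"]) measurable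
        then show ?case using elim(1) by (simp add: conv_const_def)
      qed
    qed
    finally show ?thesis by (simp add: Liminf_const)
  qed
  \<comment> \<open>Using n both as dimension and as cap yields a single increasing
    sequence.\<close>
  let ?g = "\<lambda>n \<omega>. ennreal ((min (norm (S n \<omega>)) (real n)) powr p)"
  have Smono: "norm (S n \<omega>) \<le> norm (S m \<omega>)" if "n \<le> m" for n m \<omega>
  proof -
    have "(norm (S n \<omega>))\<^sup>2 \<le> (norm (S m \<omega>))\<^sup>2"
      unfolding S_def using that by (simp add: norm_basis_sum sum_mono2)
    then show ?thesis by (simp add: power2_le_iff_abs_le)
  qed
  have inc: "incseq ?g"
    unfolding incseq_def le_fun_def using Smono p
    by (auto intro!: ennreal_leI powr_mono2 min.mono)
  have "(\<integral>\<^sup>+\<omega>. (SUP n. ?g n \<omega>) \<partial>M) = (SUP n. \<integral>\<^sup>+\<omega>. ?g n \<omega> \<partial>M)"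
    by (rule nn_integral_monotone_convergence_SUP[OF inc]) measurable
  also have "\<dots> \<le> ennreal (conv_const \<tau>)"
    by (intro SUP_least bound) simp
  finally have sup: "(\<integral>\<^sup>+\<omega>. (SUP n. ?g n \<omega>) \<partial>M) \<le> ennreal (conv_const \<tau>)" .
  then have "(\<integral>\<^sup>+\<omega>. (SUP n. ?g n \<omega>) \<partial>M) \<noteq> \<infinity>"
    by (auto simp: top_unique)
  then have "AE \<omega> in M. (SUP n. ?g n \<omega>) \<noteq> \<infinity>"
    by (intro nn_integral_PInf_AE) measurable
  then have fin: "AE \<omega> in M. summable (\<lambda>k. (X k \<omega>)\<^sup>2) \<and> ennreal (norm (vec (\<lambda>k. X k \<omega>)) powr p) \<le> (SUP n. ?g n \<omega>)"
  proof eventually_elim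
    case (elim \<omega>)
    then obtain B where B: "0 \<le> B" "(SUP n. ?g n \<omega>) = ennreal B"
      by (cases "SUP n. ?g n \<omega>") auto
    have gB: "(min (norm (S n \<omega>)) (real n)) powr p \<le> B" for n
    proof -
      have "?g n \<omega> \<le> ennreal B" unfolding B(2)[symmetric] by (rule SUP_upper) simp
      then show ?thesis using B(1) by simp
    qed
    define C where "C = B powr (1 / p)"
    have minC: "min (norm (S n \<omega>)) (real n) \<le> C" for n
    proof -
      have "((min (norm (S n \<omega>)) (real n)) powr p) powr (1 / p) \<le> C"
        unfolding C_def using gB p by (intro powr_mono2) auto
      then show ?thesis using p by (simp add: powr_powr)
    qed
    \<comment> \<open>At an index m > C the cap is inactive, and the norms increase with the
      dimension; so \<open>C\<close> bounds the norms themselves.\<close>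
    have SC: "norm (S n \<omega>) \<le> C" for n
    proof -
      obtain m where m: "C < real m" "n \<le> m"
        using reals_Archimedean2[of "max C (real n)"] by auto
      then have "norm (S m \<omega>) \<le> C" using minC[of m] by (simp add: min_def split: if_splits)
      then show ?thesis using Smono[OF m(2), of \<omega>] by simp
    qed
    have summ: "summable (\<lambda>k. (X k \<omega>)\<^sup>2)"
    proof (rule summableI_nonneg_bounded)
      show "(\<Sum>k<n. (X k \<omega>)\<^sup>2) \<le> C\<^sup>2" for n
        using power_mono[OF SC[of n], of 2] by (simp add: S_def norm_basis_sum)
    qed simp
    have "(\<lambda>n. S n \<omega>) \<longlonglongrightarrow> vec (\<lambda>k. X k \<omega>)"
      using basis_series_sums[OF summ] by (simp add: sums_def S_def)
    then have "(\<lambda>n. norm (S n \<omega>) powr p) \<longlonglongrightarrow> norm (vec (\<lambda>k. X k \<omega>)) powr p"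
      using p by (intro tendsto_powr' tendsto_norm tendsto_const) auto
    moreover have "eventually (\<lambda>n. norm (S n \<omega>) powr p \<le> B) sequentially"
    proof -
      obtain m where m: "C < real m" using reals_Archimedean2 by blast
      show ?thesis
      proof (rule eventually_sequentiallyI[of m])
        fix n assume "m \<le> n"
        then have "norm (S n \<omega>) \<le> real n" using SC[of n] m by simp
        then show "norm (S n \<omega>) powr p \<le> B" using gB[of n] by (simp add: min_def)
      qed
    qed
    ultimately have "norm (vec (\<lambda>k. X k \<omega>)) powr p \<le> B"
      by (rule tendsto_upperbound) simp
    then show ?case using summ B by (simp add: ennreal_leI)
  qed
  then show "AE \<omega> in M. summable (\<lambda>k. (X k \<omega>)\<^sup>2)" by (rule AE_mp) auto
  have "(\<integral>\<^sup>+\<omega>. ennreal (norm (vec (\<lambda>k. X k \<omega>)) powr p) \<partial>M) \<le> (\<integral>\<^sup>+\<omega>. (SUP n. ?g n \<omega>) \<partial>M)"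
    using fin by (intro nn_integral_mono_AE) auto
  then show "(\<integral>\<^sup>+\<omega>. ennreal (norm (vec (\<lambda>k. X k \<omega>)) powr p) \<partial>M) \<le> ennreal (conv_const \<tau>)"
    using sup by (rule order_trans)
qed

section \<open>Pathwise limits defining the two stochastic integrals\<close>

lemma AE_cadlag: "AE \<omega> in M. \<forall>k. cadlag (\<lambda>s. inner (e k) (L s \<omega>))"
proof -
  have "AE \<omega> in M. \<forall>t\<ge>0. continuous (at_right t) (\<lambda>s. L s \<omega>) \<and>
                        (t > 0 \<longrightarrow> (\<exists>l. ((\<lambda>s. L s \<omega>) \<longlongrightarrow> l) (at_left t)))"
    using levy by (simp add: levy_process_def)
  then show ?thesis
  proof (rule AE_mp, intro AE_I2 impI allI)
    fix \<omega> k assume H: "\<forall>t\<ge>0. continuous (at_right t) (\<lambda>s. L s \<omega>) \<and>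
                        (t > 0 \<longrightarrow> (\<exists>l. ((\<lambda>s. L s \<omega>) \<longlongrightarrow> l) (at_left t)))"
    show "cadlag (\<lambda>s. inner (e k) (L s \<omega>))"
      unfolding cadlag_def
    proof (intro allI impI conjI)
      fix t :: real assume "0 \<le> t"
      then show "continuous (at_right t) (\<lambda>s. inner (e k) (L s \<omega>))"
        using H by (intro continuous_inner continuous_const) auto
    next
      fix t :: real assume "0 < t"
      then obtain l where "((\<lambda>s. L s \<omega>) \<longlongrightarrow> l) (at_left t)" using H by (meson less_imp_le)
      then have "((\<lambda>s. inner (e k) (L s \<omega>)) \<longlongrightarrow> inner (e k) l) (at_left t)" by (intro tendsto_intros)
      then show "\<exists>l. ((\<lambda>s. inner (e k) (L s \<omega>)) \<longlongrightarrow> l) (at_left t)" by blast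
    qed
  qed
qed

definition coord_sum :: "(real \<Rightarrow> real) \<Rightarrow> nat \<Rightarrow> real \<Rightarrow> real \<Rightarrow> nat \<Rightarrow> 'w \<Rightarrow> real" where
  "coord_sum f k a \<tau> N \<omega> = riemann_sum f (\<lambda>s. inner (e k) (L s \<omega>)) a \<tau> N"

lemma coord_sum_eq: "coord_sum f k a \<tau> N \<omega> = (\<Sum>j<N. f (a + j * (\<tau> / N)) * inner (e k) (incr a \<tau> N j \<omega>))"
  by (simp add: coord_sum_def riemann_sum_def incr_def inner_diff_right)

lemma coord_sum_measurable[measurable]: "coord_sum f k a \<tau> N \<in> borel_measurable M"
  unfolding coord_sum_eq[abs_def] by measurable

text \<open>Defined as limits of Riemann sums, the coordinates of the two stochastic integrals are measurable on
  all of \<open>M\<close>; they agree with the pathwise formula only almost surely.\<close>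

definition fwd :: "nat \<Rightarrow> real \<Rightarrow> real \<Rightarrow> 'w \<Rightarrow> real" where
  "fwd k a \<tau> \<omega> = lim (\<lambda>N. coord_sum (\<lambda>s. 1 * exp (- lam k * s)) k a \<tau> N \<omega>)"

definition bwd :: "nat \<Rightarrow> real \<Rightarrow> 'w \<Rightarrow> real" where
  "bwd k t \<omega> = lim (\<lambda>N. coord_sum (\<lambda>s. exp (- lam k * t) * exp (lam k * s)) k 0 t N \<omega>)"

lemma fwd_measurable[measurable]: "fwd k a \<tau> \<in> borel_measurable M"
  unfolding fwd_def[abs_def] by measurable

lemma bwd_measurable[measurable]: "bwd k t \<in> borel_measurable M"
  unfolding bwd_def[abs_def] by measurable

lemma fwd_limit:
  assumes "cadlag (\<lambda>s. inner (e k) (L s \<omega>))" "0 \<le> a" "0 < \<tau>"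
  shows "(\<lambda>N. coord_sum (\<lambda>s. exp (- lam k * s)) k a \<tau> N \<omega>) \<longlonglongrightarrow> fwd k a \<tau> \<omega>"
    and "fwd k a \<tau> \<omega> = exp_integral 1 (- lam k) (\<lambda>s. inner (e k) (L s \<omega>)) a (a + \<tau>)"
proof -
  have l: "(\<lambda>N. coord_sum (\<lambda>s. 1 * exp (- lam k * s)) k a \<tau> N \<omega>) \<longlonglongrightarrow> exp_integral 1 (- lam k) (\<lambda>s. inner (e k) (L s \<omega>)) a (a + \<tau>)"
    unfolding coord_sum_def using assms by (intro riemann_sum_exp_tendsto)
  then show "fwd k a \<tau> \<omega> = exp_integral 1 (- lam k) (\<lambda>s. inner (e k) (L s \<omega>)) a (a + \<tau>)"
    unfolding fwd_def by (rule limI)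
  with l show "(\<lambda>N. coord_sum (\<lambda>s. exp (- lam k * s)) k a \<tau> N \<omega>) \<longlonglongrightarrow> fwd k a \<tau> \<omega>" by simp
qed

lemma bwd_limit:
  assumes "cadlag (\<lambda>s. inner (e k) (L s \<omega>))" "0 < t"
  shows "(\<lambda>N. coord_sum (\<lambda>s. exp (- lam k * t) * exp (lam k * s)) k 0 t N \<omega>) \<longlonglongrightarrow> bwd k t \<omega>"
    and "bwd k t \<omega> = exp_integral (exp (- lam k * t)) (lam k) (\<lambda>s. inner (e k) (L s \<omega>)) 0 t"
proof -
  have l: "(\<lambda>N. coord_sum (\<lambda>s. exp (- lam k * t) * exp (lam k * s)) k 0 t N \<omega>)
        \<longlonglongrightarrow> exp_integral (exp (- lam k * t)) (lam k) (\<lambda>s. inner (e k) (L s \<omega>)) 0 (0 + t)"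
    unfolding coord_sum_def using assms by (intro riemann_sum_exp_tendsto) auto
  then have eq: "bwd k t \<omega> = exp_integral (exp (- lam k * t)) (lam k) (\<lambda>s. inner (e k) (L s \<omega>)) 0 (0 + t)"
    unfolding bwd_def by (rule limI)
  with l show "(\<lambda>N. coord_sum (\<lambda>s. exp (- lam k * t) * exp (lam k * s)) k 0 t N \<omega>) \<longlonglongrightarrow> bwd k t \<omega>" by (simp only:)
  show "bwd k t \<omega> = exp_integral (exp (- lam k * t)) (lam k) (\<lambda>s. inner (e k) (L s \<omega>)) 0 t"
    using eq by simp
qed

lemma fwd_tendsto:
  assumes "0 \<le> a" "0 < \<tau>"
  shows "AE \<omega> in M. \<forall>k. (\<lambda>N. coord_sum (\<lambda>s. exp (- lam k * s)) k a \<tau> N \<omega>) \<longlonglongrightarrow> fwd k a \<tau> \<omega>"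
  using AE_cadlag by eventually_elim (use fwd_limit(1) assms in blast)

lemma bwd_tendsto:
  assumes "0 < t"
  shows "AE \<omega> in M. \<forall>k. (\<lambda>N. coord_sum (\<lambda>s. exp (- lam k * t) * exp (lam k * s)) k 0 t N \<omega>) \<longlonglongrightarrow> bwd k t \<omega>"
  using AE_cadlag by eventually_elim (use bwd_limit(1) assms in blast)

end

text \<open>Closed sets are stable under intersection and generate the Borel sets, and the indicator
  of a nonempty one is a limit of continuous functions of the distance to it. This makes limits in
  law unique.\<close>

lemma measure_eqI_continuous_bounded:
  fixes \<mu> \<nu> :: "'a::metric_space measure"
  assumes \<mu>: "prob_space \<mu>" "sets \<mu> = sets borel" and \<nu>: "prob_space \<nu>" "sets \<nu> = sets borel"
    and eq: "\<And>f :: 'a \<Rightarrow> real. continuous_on UNIV f \<Longrightarrow> bounded (range f) \<Longrightarrow> (\<integral>x. f x \<partial>\<mu>) = (\<integral>x. f x \<partial>\<nu>)"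
  shows "\<mu> = \<nu>"
proof (rule measure_eqI_generator_eq[where E = "Collect closed" and \<Omega> = UNIV and A = "\<lambda>_. UNIV"])
  interpret M: prob_space \<mu> by fact
  interpret N: prob_space \<nu> by fact
  note [measurable_cong] = \<mu>(2) \<nu>(2)
  show "Int_stable (Collect closed :: 'a set set)" by (auto simp: Int_stable_def)
  show "sets \<mu> = sigma_sets UNIV (Collect closed)" "sets \<nu> = sigma_sets UNIV (Collect closed)"
    using \<mu>(2) \<nu>(2) by (simp_all add: borel_eq_closed)
  show "emeasure \<mu> UNIV \<noteq> \<infinity>" by simp
  fix C :: "'a set" assume "C \<in> Collect closed"
  then have C: "closed C" by simp
  then have [measurable]: "C \<in> sets borel" by (rule borel_closed)
  show "emeasure \<mu> C = emeasure \<nu> C"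
  proof (cases "C = {}")
    case False
    define f where "f n x = max 0 (1 - real n * infdist x C)" for n x
    have cont: "continuous_on UNIV (f n)" for n
      unfolding f_def by (intro continuous_intros)
    then have [measurable]: "f n \<in> borel_measurable borel" for n
      by (rule borel_measurable_continuous_onI)
    have f01: "0 \<le> f n x" "f n x \<le> 1" for n x
      by (auto simp: f_def infdist_nonneg)
    have bdd: "bounded (range (f n))" for n
      using f01 by (auto simp: bounded_iff intro!: exI[of _ 1])
    have lim: "(\<lambda>n. f n x) \<longlonglongrightarrow> indicator C x" for x
    proof (cases "x \<in> C")
      case True
      then show ?thesis by (simp add: f_def)
    next
      case False
      then have pos: "0 < infdist x C"
        using in_closed_iff_infdist_zero[OF C \<open>C \<noteq> {}\<close>] infdist_nonneg[of x C] by (auto simp: less_le)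
      then obtain N where N: "1 < real N * infdist x C"
        using reals_Archimedean3 by blast
      have "f n x = 0" if "N \<le> n" for n
      proof -
        have "real N * infdist x C \<le> real n * infdist x C" using that pos by (intro mult_right_mono) auto
        then show ?thesis using N by (simp add: f_def)
      qed
      then show ?thesis
        using False by (intro tendsto_eventually) (auto simp: eventually_sequentially)
    qed
    have *: "(\<lambda>n. \<integral>x. f n x \<partial>\<kappa>) \<longlonglongrightarrow> (\<integral>x. indicator C x \<partial>\<kappa>)"
      if "prob_space \<kappa>" and [measurable_cong]: "sets \<kappa> = sets borel" for \<kappa> :: "'a measure"
    proof -
      interpret prob_space \<kappa> by fact
      show ?thesis
        by (rule integral_dominated_convergence[of _ _ _ "\<lambda>_. 1"]) (use f01 lim in \<open>auto simp: abs_of_nonneg\<close>)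
    qed
    have "(\<integral>x. indicator C x \<partial>\<mu>) = (\<integral>x. indicator C x \<partial>\<nu> :: real)"
      using *[OF \<mu>] *[OF \<nu>] eq[OF cont bdd] by (auto intro: LIMSEQ_unique)
    moreover have "C \<in> sets \<mu>" "C \<in> sets \<nu>" using \<mu>(2) \<nu>(2) by simp_all
    ultimately show ?thesis by (simp add: M.emeasure_eq_measure N.emeasure_eq_measure)
  qed simp
qed auto

context orthonormal_basis
begin

lemma vec_scale:
  assumes "summable (\<lambda>k. (a k)\<^sup>2)"
  shows "vec (\<lambda>k. c * a k) = c *\<^sub>R vec a"
proof (rule eq_if_coordinates_eq)
  fix k
  have "summable (\<lambda>k. (c * a k)\<^sup>2)" using assms by (simp add: power_mult_distrib summable_mult)
  then show "inner (e k) (vec (\<lambda>k. c * a k)) = inner (e k) (c *\<^sub>R vec a)"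
    using assms by (simp add: coordinate_vec)
qed

text \<open>The type provides completeness in metric form, so the absolutely convergent series is
  treated through Cauchy sequences.\<close>

lemma summable_norm_imp_sums:
  fixes x :: "nat \<Rightarrow> 'a"
  assumes "summable (\<lambda>i. norm (x i))"
  obtains s where "x sums s" "norm s \<le> (\<Sum>i. norm (x i))"
proof -
  define S where "S n = (\<Sum>i<n. x i)" for n
  have "Cauchy S"
  proof (rule metric_CauchyI)
    fix \<epsilon> :: real assume \<epsilon>: "0 < \<epsilon>"
    have "Cauchy (\<lambda>n. \<Sum>i<n. norm (x i))"
      using assms by (simp add: summable_iff_convergent convergent_Cauchy)
    then obtain N where N: "\<And>m n. N \<le> m \<Longrightarrow> N \<le> n \<Longrightarrow> \<bar>(\<Sum>k<m. norm (x k)) - (\<Sum>k<n. norm (x k))\<bar> < \<epsilon>"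
      using \<epsilon> unfolding Cauchy_def dist_real_def by metis
    have *: "dist (S m) (S n) < \<epsilon>" if "N \<le> m" "m \<le> n" for m n
    proof -
      have d: "(\<Sum>k<n. f k) - (\<Sum>k<m. f k) = (\<Sum>k\<in>{m..<n}. f k)" for f :: "nat \<Rightarrow> 'b::ab_group_add"
        using that by (metis sum_diff_nat_ivl le0 atLeast0LessThan)
      have "norm (S n - S m) \<le> (\<Sum>k\<in>{m..<n}. norm (x k))" unfolding S_def d by (rule norm_sum)
      also have "\<dots> < \<epsilon>" using N[of n m] that by (simp add: d[symmetric])
      finally show ?thesis by (simp add: dist_norm norm_minus_commute)
    qed
    show "\<exists>M. \<forall>m\<ge>M. \<forall>n\<ge>M. dist (S m) (S n) < \<epsilon>"
      using * by (metis dist_commute linear)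
  qed
  then obtain s where s: "S \<longlonglongrightarrow> s" using Cauchy_convergent[of S] unfolding convergent_def by blast
  show ?thesis
  proof
    show "x sums s" using s by (simp add: sums_def S_def[abs_def])
    show "norm s \<le> (\<Sum>i. norm (x i))"
    proof (rule tendsto_upperbound[OF tendsto_norm[OF s]])
      show "eventually (\<lambda>n. norm (S n) \<le> (\<Sum>i. norm (x i))) sequentially"
        unfolding S_def
        by (intro always_eventually allI order_trans[OF norm_sum] sum_le_suminf assms) auto
    qed simp
  qed
qed

end

section \<open>Forward and backward convolutions and their laws\<close>

context heat_levy
begin

definition fwd_conv :: "real \<Rightarrow> real \<Rightarrow> 'w \<Rightarrow> 'a" where
  "fwd_conv a \<tau> \<omega> = vec (\<lambda>k. fwd k a \<tau> \<omega>)"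

definition bwd_conv :: "real \<Rightarrow> 'w \<Rightarrow> 'a" where
  "bwd_conv t \<omega> = vec (\<lambda>k. bwd k t \<omega>)"

lemma fwd_conv_measurable[measurable]: "fwd_conv a \<tau> \<in> borel_measurable M"
  unfolding fwd_conv_def[abs_def] by measurable

lemma bwd_conv_measurable[measurable]: "bwd_conv t \<in> borel_measurable M"
  unfolding bwd_conv_def[abs_def] by measurable

text \<open>On [a, a + \<tau>] all weights are at most exp (- lam 0 * a). Multiplication by
  \<open>c\<close> brings them below 1, and the p-th power of 1 / c reappears as the decay of the
  moment.\<close>

lemma fwd_conv_moment:
  assumes a: "0 \<le> a" and \<tau>: "0 < \<tau>"
  shows "AE \<omega> in M. summable (\<lambda>k. (fwd k a \<tau> \<omega>)\<^sup>2)"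
    "(\<integral>\<^sup>+\<omega>. ennreal (norm (fwd_conv a \<tau> \<omega>) powr p) \<partial>M) \<le> ennreal (exp (- (lam 0 * a * p)) * conv_const \<tau>)"
proof -
  define c where "c = exp (lam 0 * a)"
  have c: "0 < c" by (simp add: c_def)
  define \<theta> where "\<theta> N j k = c * exp (- lam k * (a + real j * (\<tau> / real N)))" for N j k
  have \<theta>: "\<bar>\<theta> N j k\<bar> \<le> 1" for N j k
  proof -
    have "0 \<le> real j * (\<tau> / real N)" using \<tau> by simp
    then have "lam 0 * a \<le> lam k * (a + real j * (\<tau> / real N))"
      using a lam_ge[of k] lam_pos by (intro mult_mono) (auto intro: less_imp_le)
    then show ?thesis by (simp add: \<theta>_def c_def exp_add[symmetric])
  qed
  have lim: "AE \<omega> in M. (\<lambda>N. \<Sum>j<N. \<theta> N j k * inner (e k) (incr a \<tau> N j \<omega>)) \<longlonglongrightarrow> c * fwd k a \<tau> \<omega>" for k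
    using fwd_tendsto[OF a \<tau>]
  proof eventually_elim
    case (elim \<omega>)
    then have "(\<lambda>N. c * coord_sum (\<lambda>s. exp (- lam k * s)) k a \<tau> N \<omega>) \<longlonglongrightarrow> c * fwd k a \<tau> \<omega>"
      by (intro tendsto_intros) auto
    then show ?case unfolding coord_sum_eq \<theta>_def by (simp add: sum_distrib_left mult.assoc)
  qed
  have m: "(\<lambda>\<omega>. c * fwd k a \<tau> \<omega>) \<in> borel_measurable M" for k by measurable
  have s: "AE \<omega> in M. summable (\<lambda>k. (c * fwd k a \<tau> \<omega>)\<^sup>2)"
    by (rule limit_moment_bound(1)[OF a \<tau> \<theta> m lim])
  then show s': "AE \<omega> in M. summable (\<lambda>k. (fwd k a \<tau> \<omega>)\<^sup>2)"
  proof eventually_elim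
    case (elim \<omega>)
    then have "summable (\<lambda>k. c\<^sup>2 * (fwd k a \<tau> \<omega>)\<^sup>2)" by (simp add: power_mult_distrib)
    then show ?case using c by (auto dest: summable_mult_D)
  qed
  have "(\<integral>\<^sup>+\<omega>. ennreal (norm (vec (\<lambda>k. c * fwd k a \<tau> \<omega>)) powr p) \<partial>M) \<le> ennreal (conv_const \<tau>)"
    by (rule limit_moment_bound(2)[OF a \<tau> \<theta> m lim])
  also have "(\<integral>\<^sup>+\<omega>. ennreal (norm (vec (\<lambda>k. c * fwd k a \<tau> \<omega>)) powr p) \<partial>M)
      = (\<integral>\<^sup>+\<omega>. ennreal (c powr p) * ennreal (norm (fwd_conv a \<tau> \<omega>) powr p) \<partial>M)"
    using s' by (intro nn_integral_cong_AE)
      (auto elim!: eventually_mono simp: vec_scale fwd_conv_def powr_mult ennreal_mult abs_of_pos[OF c])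
  also have "\<dots> = ennreal (c powr p) * (\<integral>\<^sup>+\<omega>. ennreal (norm (fwd_conv a \<tau> \<omega>) powr p) \<partial>M)"
    by (rule nn_integral_cmult) measurable
  finally have "ennreal (c powr (- p)) * (ennreal (c powr p) * (\<integral>\<^sup>+\<omega>. ennreal (norm (fwd_conv a \<tau> \<omega>) powr p) \<partial>M))
      \<le> ennreal (c powr (- p)) * ennreal (conv_const \<tau>)"
    by (rule mult_left_mono) simp
  moreover have "ennreal (c powr (- p)) * ennreal (c powr p) = 1"
    using c by (simp add: ennreal_mult[symmetric] powr_add[symmetric])
  moreover have "c powr (- p) = exp (- (lam 0 * a * p))"
    by (simp add: c_def powr_def mult.commute)
  ultimately show "(\<integral>\<^sup>+\<omega>. ennreal (norm (fwd_conv a \<tau> \<omega>) powr p) \<partial>M) \<le> ennreal (exp (- (lam 0 * a * p)) * conv_const \<tau>)"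
    by (simp add: mult.assoc[symmetric] ennreal_mult')
qed

lemma summable_bwd:
  assumes t: "0 < t"
  shows "AE \<omega> in M. summable (\<lambda>k. (bwd k t \<omega>)\<^sup>2)"
proof -
  define \<theta> where "\<theta> N j k = exp (- lam k * t) * exp (lam k * (0 + real j * (t / real N)))" for N j k
  \<comment> \<open>The moment bound asks for weights at most 1 for all j, but the backward weights
    keep growing beyond j = N; they are cut off where the sum does not reach.\<close>
  define \<theta>' where "\<theta>' N j k = (if j < N then \<theta> N j k else 0)" for N j k
  have \<theta>': "\<bar>\<theta>' N j k\<bar> \<le> 1" for N j k
  proof (cases "j < N")
    case True
    then have "real j * (t / real N) \<le> t" using t by (simp add: field_simps)
    then have "lam k * (real j * (t / real N)) \<le> lam k * t" using lam_pos[of k] by (intro mult_left_mono) auto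
    then show ?thesis using True by (simp add: \<theta>'_def \<theta>_def exp_add[symmetric])
  qed (simp add: \<theta>'_def)
  have lim: "AE \<omega> in M. (\<lambda>N. \<Sum>j<N. \<theta>' N j k * inner (e k) (incr 0 t N j \<omega>)) \<longlonglongrightarrow> bwd k t \<omega>" for k
    using bwd_tendsto[OF t]
  proof eventually_elim
    case (elim \<omega>)
    have "(\<Sum>j<N. \<theta>' N j k * inner (e k) (incr 0 t N j \<omega>)) = coord_sum (\<lambda>s. exp (- lam k * t) * exp (lam k * s)) k 0 t N \<omega>" for N
      unfolding coord_sum_eq by (intro sum.cong) (auto simp: \<theta>'_def \<theta>_def)
    then show ?case using elim by simp
  qed
  show ?thesis
    by (rule limit_moment_bound(1)[OF order_refl t \<theta>' bwd_measurable lim])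
qed

text \<open>For a cadlag path starting at 0 the boundary term at 0 vanishes and the weight at
  \<open>t\<close> is 1, so integration by parts reproduces the pathwise formula in every
  coordinate.\<close>

lemma stoch_conv_AE_eq:
  assumes t: "0 < t"
  shows "AE \<omega> in M. stoch_conv e lam L t \<omega> = bwd_conv t \<omega>"
proof -
  have "AE \<omega> in M. L 0 \<omega> = 0" using levy by (simp add: levy_process_def)
  then show ?thesis
    using AE_cadlag summable_bwd[OF t]
  proof eventually_elim
    case (elim \<omega>)
    have "inner (e n) (L t \<omega>) - lam n * set_lebesgue_integral lborel {0..t} (\<lambda>s. exp (- lam n * (t - s)) * inner (e n) (L s \<omega>))
        = bwd n t \<omega>" for n
    proof -
      have "bwd n t \<omega> = exp_integral (exp (- lam n * t)) (lam n) (\<lambda>s. inner (e n) (L s \<omega>)) 0 t"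
        using elim(2) t by (intro bwd_limit(2)) auto
      also have "\<dots> = inner (e n) (L t \<omega>)
          - (\<integral>s. lam n * (indicator {0..t} s * (exp (- lam n * (t - s)) * inner (e n) (L s \<omega>))) \<partial>lborel)"
        using elim(1) unfolding exp_integral_def
        by (simp add: exp_add[symmetric] algebra_simps)
      finally show ?thesis by (simp add: set_lebesgue_integral_def)
    qed
    then show ?case using elim(3) by (simp add: stoch_conv_def bwd_conv_def vec_def)
  qed
qed

lemma bounded_convergence:
  fixes f :: "'a \<Rightarrow> real"
  assumes f: "continuous_on UNIV f" "bounded (range f)"
    and [measurable]: "\<And>n. X n \<in> borel_measurable M" "Y \<in> borel_measurable M"
    and lim: "AE \<omega> in M. (\<lambda>n. X n \<omega>) \<longlonglongrightarrow> Y \<omega>"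
  shows "(\<lambda>n. \<integral>\<omega>. f (X n \<omega>) \<partial>M) \<longlonglongrightarrow> (\<integral>\<omega>. f (Y \<omega>) \<partial>M)"
proof -
  have [measurable]: "f \<in> borel_measurable borel" using f(1) by (rule borel_measurable_continuous_onI)
  obtain B where B: "\<And>x. \<bar>f x\<bar> \<le> B" using f(2) by (auto simp: bounded_iff)
  show ?thesis
  proof (rule integral_dominated_convergence[of _ _ _ "\<lambda>_. B"])
    show "AE \<omega> in M. (\<lambda>n. f (X n \<omega>)) \<longlonglongrightarrow> f (Y \<omega>)"
      using lim by eventually_elim (use f(1) in \<open>auto intro: continuous_on_tendsto_compose\<close>)
  qed (use B in auto)
qed

text \<open>Reversal is exact for Riemann sums in finitely many coordinates. First the mesh and then
  the dimension go to the limit, tested against bounded continuous functions.\<close>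

lemma distr_fwd_conv_eq_bwd_conv:
  assumes t: "0 < t"
  shows "distr M borel (fwd_conv 0 t) = distr M borel (bwd_conv t)"
proof (rule measure_eqI_continuous_bounded)
  fix f :: "'a \<Rightarrow> real" assume f: "continuous_on UNIV f" "bounded (range f)"
  then have [measurable]: "f \<in> borel_measurable borel" by (intro borel_measurable_continuous_onI)
  have fin: "(\<integral>\<omega>. f (proj n (fwd_conv 0 t \<omega>)) \<partial>M) = (\<integral>\<omega>. f (proj n (bwd_conv t \<omega>)) \<partial>M)" for n
  proof -
    define \<theta>W where "\<theta>W N j k = exp (- lam k * t) * exp (lam k * (0 + real j * (t / real N)))" for N j k
    \<comment> \<open>Reversal by j \<mapsto> N - 1 - j turns left endpoints into right ones, as t -
      (N - 1 - j) t / N = (j + 1) t / N. The additional factor exp (- lam k * t / N) accounts for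
      this shift and tends to 1.\<close>
    define \<theta>Z where "\<theta>Z N j k = exp (- lam k * (t / real N)) * exp (- lam k * (0 + real j * (t / real N)))" for N j k
    have limW: "AE \<omega> in M. (\<lambda>N. weighted_sum n (\<theta>W N) 0 t N \<omega>) \<longlonglongrightarrow> proj n (bwd_conv t \<omega>)"
      using bwd_tendsto[OF t] summable_bwd[OF t]
    proof eventually_elim
      case (elim \<omega>)
      have "weighted_sum n (\<theta>W N) 0 t N \<omega> = (\<Sum>k<n. coord_sum (\<lambda>s. exp (- lam k * t) * exp (lam k * s)) k 0 t N \<omega> *\<^sub>R e k)" for N
        unfolding weighted_sum_eq coord_sum_eq \<theta>W_def ..
      then show ?case using elim unfolding bwd_conv_def by (simp add: proj_vec) (intro tendsto_intros, auto)
    qed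
    have limZ: "AE \<omega> in M. (\<lambda>N. weighted_sum n (\<theta>Z N) 0 t N \<omega>) \<longlonglongrightarrow> proj n (fwd_conv 0 t \<omega>)"
      using fwd_tendsto[OF order_refl t] fwd_conv_moment(1)[OF order_refl t]
    proof eventually_elim
      case (elim \<omega>)
      have eq: "weighted_sum n (\<theta>Z N) 0 t N \<omega>
          = (\<Sum>k<n. (exp (- lam k * (t / real N)) * coord_sum (\<lambda>s. exp (- lam k * s)) k 0 t N \<omega>) *\<^sub>R e k)" for N
        unfolding weighted_sum_eq coord_sum_eq \<theta>Z_def by (simp add: sum_distrib_left mult.assoc)
      have "(\<lambda>N. exp (- lam k * (t / real N))) \<longlonglongrightarrow> exp (- lam k * 0)" for k
        by (intro tendsto_intros lim_const_over_n)
      then have "(\<lambda>N. weighted_sum n (\<theta>Z N) 0 t N \<omega>) \<longlonglongrightarrow> (\<Sum>k<n. (exp (- lam k * 0) * fwd k 0 t \<omega>) *\<^sub>R e k)"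
        unfolding eq using elim(1) by (intro tendsto_sum tendsto_scaleR tendsto_mult tendsto_const) auto
      then show ?case using elim(2) unfolding fwd_conv_def by (simp add: proj_vec)
    qed
    have "eventually (\<lambda>N. (\<integral>\<omega>. f (weighted_sum n (\<theta>W N) 0 t N \<omega>) \<partial>M) = (\<integral>\<omega>. f (weighted_sum n (\<theta>Z N) 0 t N \<omega>) \<partial>M)) sequentially"
      using eventually_gt_at_top[of 0]
    proof eventually_elim
      case (elim N)
      have "weighted_sum n (\<lambda>j. \<theta>W N (N - 1 - j)) 0 t N \<omega> = weighted_sum n (\<theta>Z N) 0 t N \<omega>" for \<omega>
        unfolding weighted_sum_def
      proof (intro sum.cong refl)
        fix j assume "j \<in> {..<N}"
        then have "real (N - 1 - j) = real N - 1 - real j" by auto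
        then have "\<theta>W N (N - 1 - j) = \<theta>Z N j"
          using elim by (auto simp: \<theta>W_def \<theta>Z_def fun_eq_iff exp_add[symmetric] field_simps)
        then show "diag n (\<theta>W N (N - 1 - j)) (incr 0 t N j \<omega>) = diag n (\<theta>Z N j) (incr 0 t N j \<omega>)" by simp
      qed
      then show ?case using integral_weighted_sum_reverse[OF order_refl t elim, of f n "\<theta>W N"] by simp
    qed
    then have "(\<lambda>N. \<integral>\<omega>. f (weighted_sum n (\<theta>Z N) 0 t N \<omega>) \<partial>M) \<longlonglongrightarrow> (\<integral>\<omega>. f (proj n (bwd_conv t \<omega>)) \<partial>M)"
      using bounded_convergence[OF f _ _ limW] by (auto elim: Lim_transform_eventually)
    moreover have "(\<lambda>N. \<integral>\<omega>. f (weighted_sum n (\<theta>Z N) 0 t N \<omega>) \<partial>M) \<longlonglongrightarrow> (\<integral>\<omega>. f (proj n (fwd_conv 0 t \<omega>)) \<partial>M)"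
      by (rule bounded_convergence[OF f _ _ limZ]) measurable
    ultimately show ?thesis by (rule LIMSEQ_unique[symmetric])
  qed
  have "(\<lambda>n. \<integral>\<omega>. f (proj n (fwd_conv 0 t \<omega>)) \<partial>M) \<longlonglongrightarrow> (\<integral>\<omega>. f (fwd_conv 0 t \<omega>) \<partial>M)"
    by (rule bounded_convergence[OF f]) (auto simp: proj_tendsto)
  moreover have "(\<lambda>n. \<integral>\<omega>. f (proj n (bwd_conv t \<omega>)) \<partial>M) \<longlonglongrightarrow> (\<integral>\<omega>. f (bwd_conv t \<omega>) \<partial>M)"
    by (rule bounded_convergence[OF f]) (auto simp: proj_tendsto)
  ultimately have "(\<integral>\<omega>. f (fwd_conv 0 t \<omega>) \<partial>M) = (\<integral>\<omega>. f (bwd_conv t \<omega>) \<partial>M)"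
    unfolding fin by (rule LIMSEQ_unique)
  then show "(\<integral>x. f x \<partial>distr M borel (fwd_conv 0 t)) = (\<integral>x. f x \<partial>distr M borel (bwd_conv t))"
    by (simp add: integral_distr)
qed (auto intro!: prob_space_distr)

text \<open>One null set serves all \<open>m\<close>, so for almost every path convergence along the
  times t + m becomes convergence of a series of unit blocks.\<close>

lemma fwd_conv_add:
  assumes t: "0 < t"
  shows "AE \<omega> in M. \<forall>m. fwd_conv 0 (t + real m) \<omega> = fwd_conv 0 t \<omega> + (\<Sum>i<m. fwd_conv (t + real i) 1 \<omega>)"
proof -
  have pos: "0 < t + real m" for m using t by simp
  have "AE \<omega> in M. \<forall>m. summable (\<lambda>k. (fwd k 0 (t + real m) \<omega>)\<^sup>2)"
    unfolding AE_all_countable using fwd_conv_moment(1)[OF order_refl pos] by auto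
  moreover have "AE \<omega> in M. \<forall>m. summable (\<lambda>k. (fwd k (t + real m) 1 \<omega>)\<^sup>2)"
    unfolding AE_all_countable using fwd_conv_moment(1)[of "t + real _" 1] t by auto
  ultimately show ?thesis
    using AE_cadlag
  proof eventually_elim
    case (elim \<omega>)
    have step: "fwd_conv 0 (t + real (Suc m)) \<omega> = fwd_conv 0 (t + real m) \<omega> + fwd_conv (t + real m) 1 \<omega>" for m
    proof (rule eq_if_coordinates_eq)
      fix k
      have s: "summable (\<lambda>k. (fwd k 0 (t + real (Suc m)) \<omega>)\<^sup>2)" "summable (\<lambda>k. (fwd k 0 (t + real m) \<omega>)\<^sup>2)"
        "summable (\<lambda>k. (fwd k (t + real m) 1 \<omega>)\<^sup>2)"
        using elim(1,2) by blast+
      have "fwd k 0 (t + real (Suc m)) \<omega> = exp_integral 1 (- lam k) (\<lambda>s. inner (e k) (L s \<omega>)) 0 (t + real (Suc m))"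
        using fwd_limit(2)[of k \<omega> 0 "t + real (Suc m)"] elim(3) t by simp
      also have "\<dots> = exp_integral 1 (- lam k) (\<lambda>s. inner (e k) (L s \<omega>)) 0 (t + real m)
          + exp_integral 1 (- lam k) (\<lambda>s. inner (e k) (L s \<omega>)) (t + real m) (t + real (Suc m))"
        using elim(3) t by (intro exp_integral_add[symmetric]) auto
      also have "\<dots> = fwd k 0 (t + real m) \<omega> + fwd k (t + real m) 1 \<omega>"
        using fwd_limit(2)[of k \<omega> 0 "t + real m"] fwd_limit(2)[of k \<omega> "t + real m" 1] elim(3) t
        by (simp add: add.assoc add.commute[of 1])
      finally show "inner (e k) (fwd_conv 0 (t + real (Suc m)) \<omega>) = inner (e k) (fwd_conv 0 (t + real m) \<omega> + fwd_conv (t + real m) 1 \<omega>)"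
        unfolding fwd_conv_def inner_add_right coordinate_vec[OF s(1)] coordinate_vec[OF s(2)] coordinate_vec[OF s(3)] .
    qed
    show ?case
    proof
      fix m
      show "fwd_conv 0 (t + real m) \<omega> = fwd_conv 0 t \<omega> + (\<Sum>i<m. fwd_conv (t + real i) 1 \<omega>)"
        by (induction m) (simp_all only: step of_nat_0 add_0_right lessThan_0 sum.empty sum.lessThan_Suc add.assoc)
    qed
  qed
qed

end

text \<open>The paths of \<open>L\<close> are regular only almost surely and \<open>M\<close> need not be complete, so \<open>stoch_conv\<close> may
  fail to be measurable. In that case \<open>distr\<close> is the null measure, which weak convergence to a
  probability measure excludes for large times.\<close>

lemma measurable_if_distr_nonzero:
  fixes f :: "'w \<Rightarrow> 'a::topological_space"
  assumes M: "prob_space M" and nz: "emeasure (distr M borel f) UNIV \<noteq> 0"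
  shows "f \<in> borel_measurable M"
proof (rule measurableI)
  interpret prob_space M by fact
  define \<mu> where "\<mu> A = emeasure M (f -` A \<inter> space M)" for A
  \<comment> \<open>\<open>distr\<close> carries the set function \<open>\<mu>\<close> only if this
    is a measure, and is identically 0 otherwise; being nonzero, it forces additivity.\<close>
  have "measure_space UNIV (sigma_sets UNIV (sets borel)) \<mu>"
    using nz unfolding distr_def \<mu>_def[abs_def, symmetric] emeasure_measure_of_conv by (auto split: if_splits)
  then have ms: "measure_space UNIV (sets borel) \<mu>"
    using sets.sigma_sets_eq[of "borel :: 'a measure"] by simp
  have "additive (sets borel) \<mu>"
    using ms ring_of_sets.countably_additive_additive[of UNIV "sets borel" \<mu>]
    by (auto simp: measure_space_def sigma_algebra_def algebra_def)
  fix B :: "'a set" assume B: "B \<in> sets borel"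
  \<comment> \<open>\<open>emeasure\<close> is 0 outside the \<sigma>-algebra, and the preimages of
    B and of its complement are measurable or not together; two zeros cannot add up to 1.\<close>
  have "\<mu> B + \<mu> (- B) = \<mu> (B \<union> - B)"
    using \<open>additive (sets borel) \<mu>\<close> B by (intro additiveD[symmetric]) auto
  also have "\<dots> = 1" by (simp add: \<mu>_def emeasure_space_1)
  finally have sum: "\<mu> B + \<mu> (- B) = 1" .
  show "f -` B \<inter> space M \<in> sets M"
  proof (rule ccontr)
    assume n: "f -` B \<inter> space M \<notin> sets M"
    have "f -` (- B) \<inter> space M \<notin> sets M"
    proof
      assume "f -` (- B) \<inter> space M \<in> sets M"
      then have "space M - (f -` (- B) \<inter> space M) \<in> sets M" by auto
      also have "space M - (f -` (- B) \<inter> space M) = f -` B \<inter> space M" by auto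
      finally show False using n by simp
    qed
    with n sum show False by (simp add: \<mu>_def emeasure_notin_sets)
  qed
qed simp

text \<open>The order of choices matters: a level above or below \<open>c\<close> fixes \<eta>, this
  fixes \<open>C\<close>, and only then is \<open>d\<close> made small.\<close>

lemma ennreal_tendsto_of_mutual_bounds:
  fixes c :: ennreal and f d :: "'b \<Rightarrow> ennreal"
  assumes c: "c < \<top>" and d: "(d \<longlongrightarrow> 0) F"
    and bounds: "\<And>\<eta> :: real. 0 < \<eta> \<Longrightarrow> \<exists>C::real. \<forall>x. f x \<le> ennreal (1 + \<eta>) * c + ennreal C * d x
        \<and> c \<le> ennreal (1 + \<eta>) * f x + ennreal C * d x"
  shows "(f \<longlongrightarrow> c) F"
proof (rule order_tendstoI)
  obtain r where r: "0 \<le> r" "c = ennreal r" using c by (cases c) auto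
  have lim: "((\<lambda>x. a + ennreal C * d x) \<longlongrightarrow> a) F" for C :: real and a :: ennreal
  proof -
    have "((\<lambda>x. a + ennreal C * d x) \<longlongrightarrow> a + ennreal C * 0) F"
      by (intro tendsto_add tendsto_const ennreal_tendsto_cmult d) simp
    then show ?thesis by simp
  qed
  {
    fix a assume a: "c < a"
    obtain s where s: "r < s" "ennreal s \<le> a"
    proof (cases a)
      case (real u)
      then show ?thesis using a r that[of u] by (simp add: ennreal_less_iff)
    next
      case top
      then show ?thesis using that[of "r + 1"] by simp
    qed
    \<comment> \<open>This makes \<eta> r at most half of the distance s - r; the denominator r + 1
      also covers r = 0.\<close>
    define \<eta> where "\<eta> = (s - r) / (2 * (r + 1))"
    have \<eta>: "0 < \<eta>" using s r by (simp add: \<eta>_def)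
    have "(1 + \<eta>) * r < s"
    proof -
      have "\<eta> * r \<le> (s - r) / 2 * (r / (r + 1))" using r by (simp add: \<eta>_def)
      also have "\<dots> \<le> (s - r) / 2 * 1" using s r by (intro mult_left_mono) auto
      also have "\<dots> < s - r" using s by simp
      finally show ?thesis by (simp add: algebra_simps)
    qed
    then have "ennreal (1 + \<eta>) * c < a"
    proof -
      have "ennreal (1 + \<eta>) * c = ennreal ((1 + \<eta>) * r)"
        unfolding r(2) using r(1) \<eta> by (intro ennreal_mult[symmetric]) auto
      also have "\<dots> < ennreal s" using \<open>(1 + \<eta>) * r < s\<close> s(1) r(1) by (intro ennreal_lessI) auto
      also have "\<dots> \<le> a" by (rule s(2))
      finally show ?thesis .
    qed
    obtain C where C: "\<And>x. f x \<le> ennreal (1 + \<eta>) * c + ennreal C * d x" using bounds[OF \<eta>] by blast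
    show "eventually (\<lambda>x. f x < a) F"
      using order_tendstoD(2)[OF lim \<open>ennreal (1 + \<eta>) * c < a\<close>, of C]
      by eventually_elim (rule order_le_less_trans[OF C])
  next
    fix a assume a: "a < c"
    obtain s where s: "0 \<le> s" "a = ennreal s" "s < r"
      using a r by (cases a) (auto simp: ennreal_less_iff)
    define \<eta> where "\<eta> = (r - s) / (2 * (s + 1))"
    have \<eta>: "0 < \<eta>" using s by (simp add: \<eta>_def)
    have "(1 + \<eta>) * s < r"
    proof -
      have "\<eta> * s \<le> (r - s) / 2 * (s / (s + 1))" using s by (simp add: \<eta>_def)
      also have "\<dots> \<le> (r - s) / 2 * 1" using s by (intro mult_left_mono) auto
      also have "\<dots> < r - s" using s by simp
      finally show ?thesis by (simp add: algebra_simps)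
    qed
    then have *: "ennreal (1 + \<eta>) * a < c"
    proof -
      have "ennreal (1 + \<eta>) * a = ennreal ((1 + \<eta>) * s)"
        unfolding s(2) using s(1) \<eta> by (intro ennreal_mult[symmetric]) auto
      also have "\<dots> < c" unfolding r(2) using \<open>(1 + \<eta>) * s < r\<close> s by (intro ennreal_lessI) auto
      finally show ?thesis .
    qed
    obtain C where C: "\<And>x. c \<le> ennreal (1 + \<eta>) * f x + ennreal C * d x" using bounds[OF \<eta>] by blast
    show "eventually (\<lambda>x. a < f x) F"
      using order_tendstoD(2)[OF lim *, of C]
    proof eventually_elim
      case (elim x)
      show ?case
      proof (rule ccontr)
        assume "\<not> a < f x"
        then have "f x \<le> a" by simp
        then have "c \<le> ennreal (1 + \<eta>) * a + ennreal C * d x"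
          by (intro order_trans[OF C[of x]] add_right_mono mult_left_mono) auto
        then show False using elim by simp
      qed
    qed
  }
qed

section \<open>The remainder of the forward integral after time t\<close>

context heat_levy
begin

text \<open>The integral of S(s) dL_s from time \<open>t\<close> to infinity, in blocks of length 1;
  the default 0 keeps it measurable on all of \<open>M\<close>.\<close>

definition fwd_tail :: "real \<Rightarrow> 'w \<Rightarrow> 'a" where
  "fwd_tail t \<omega> = (if summable (\<lambda>i. norm (fwd_conv (t + real i) 1 \<omega>)) then \<Sum>i. fwd_conv (t + real i) 1 \<omega> else 0)"

lemma fwd_tail_sums:
  assumes "summable (\<lambda>i. norm (fwd_conv (t + real i) 1 \<omega>))"
  shows "(\<lambda>i. fwd_conv (t + real i) 1 \<omega>) sums fwd_tail t \<omega>" "norm (fwd_tail t \<omega>) \<le> (\<Sum>i. norm (fwd_conv (t + real i) 1 \<omega>))"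
proof -
  obtain s where s: "(\<lambda>i. fwd_conv (t + real i) 1 \<omega>) sums s" "norm s \<le> (\<Sum>i. norm (fwd_conv (t + real i) 1 \<omega>))"
    by (rule summable_norm_imp_sums[OF assms])
  moreover have "fwd_tail t \<omega> = s" using s(1) assms by (simp add: fwd_tail_def sums_iff)
  ultimately show "(\<lambda>i. fwd_conv (t + real i) 1 \<omega>) sums fwd_tail t \<omega>" "norm (fwd_tail t \<omega>) \<le> (\<Sum>i. norm (fwd_conv (t + real i) 1 \<omega>))"
    by simp_all
qed

lemma fwd_tail_measurable[measurable]: "fwd_tail t \<in> borel_measurable M"
proof -
  define G where "G = {\<omega> \<in> space M. summable (\<lambda>i. norm (fwd_conv (t + real i) 1 \<omega>))}"
  have [measurable]: "G \<in> sets M"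
  proof -
    have "summable (\<lambda>i. norm (fwd_conv (t + real i) 1 \<omega>)) \<longleftrightarrow> (\<Sum>i. ennreal (norm (fwd_conv (t + real i) 1 \<omega>))) \<noteq> \<top>" for \<omega>
    proof
      assume "summable (\<lambda>i. norm (fwd_conv (t + real i) 1 \<omega>))"
      then show "(\<Sum>i. ennreal (norm (fwd_conv (t + real i) 1 \<omega>))) \<noteq> \<top>" by (rule ennreal_suminf_neq_top) simp
    next
      assume "(\<Sum>i. ennreal (norm (fwd_conv (t + real i) 1 \<omega>))) \<noteq> \<top>"
      then show "summable (\<lambda>i. norm (fwd_conv (t + real i) 1 \<omega>))" by (rule summable_suminf_not_top[rotated]) simp
    qed
    then have "G = {\<omega> \<in> space M. (\<Sum>i. ennreal (norm (fwd_conv (t + real i) 1 \<omega>))) \<noteq> \<top>}" by (simp add: G_def)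
    also have "\<dots> \<in> sets M" by measurable
    finally show ?thesis .
  qed
  show ?thesis
  proof (rule borel_measurable_LIMSEQ_metric)
    fix n :: nat
    show "(\<lambda>\<omega>. indicator G \<omega> *\<^sub>R (\<Sum>i<n. fwd_conv (t + real i) 1 \<omega>)) \<in> borel_measurable M" by measurable
  next
    fix \<omega> assume \<omega>: "\<omega> \<in> space M"
    show "(\<lambda>n. indicator G \<omega> *\<^sub>R (\<Sum>i<n. fwd_conv (t + real i) 1 \<omega>)) \<longlonglongrightarrow> fwd_tail t \<omega>"
    proof (cases "\<omega> \<in> G")
      case True
      then show ?thesis using fwd_tail_sums(1)[of t \<omega>] by (simp add: G_def sums_def)
    next
      case False
      then show ?thesis using \<omega> by (simp add: G_def fwd_tail_def)
    qed
  qed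
qed

text \<open>The first factor is the p-th power of a geometric series of ratio exp (- lam 0 / 2); the
  second sums the block moments after the weights \<beta>^(i p) have used up half of the
  decay.\<close>

definition fwd_tail_const :: real where
  "fwd_tail_const = (1 / (1 - exp (- (lam 0 / 2)))) powr p * (conv_const 1 / (1 - exp (- (lam 0 * p / 2))))"

lemma conv_const_nonneg: "0 < \<tau> \<Longrightarrow> 0 \<le> conv_const \<tau>"
proof -
  assume \<tau>: "0 < \<tau>"
  interpret A: levy_array_moment e b Q \<nu> \<tau> "incr_law \<tau>" p by (rule levy_array_incr_law[OF \<tau>])
  show ?thesis unfolding conv_const_def A.moment_const_def by simp
qed

text \<open>With \<open>\<beta> > 1\<close> and \<open>T = (\<Sum>i. (\<beta>^i |Z_i|)^p)\<close> one has \<open>|Z_i| \<le> T^(1/p) \<beta>^(-i)\<close>, so the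
  tail series is controlled by \<open>T\<close> for \<open>p < 1\<close> and \<open>p \<ge> 1\<close> alike.\<close>

lemma fwd_tail_moment:
  assumes t: "0 < t"
  shows "AE \<omega> in M. summable (\<lambda>i. norm (fwd_conv (t + real i) 1 \<omega>))"
    "(\<integral>\<^sup>+\<omega>. ennreal (norm (fwd_tail t \<omega>) powr p) \<partial>M) \<le> ennreal (fwd_tail_const * exp (- (lam 0 * p * t)))"
proof -
  \<comment> \<open>The p-th moments of the blocks decay like exp (- lam 0 p i). Weights \<beta>^(i
    p) at half of this rate leave the summable r^i, while \<beta>^(- i) makes the norms
    summable.\<close>
  define \<beta> where "\<beta> = exp (lam 0 / 2)"
  define r where "r = exp (- (lam 0 * p / 2))"
  have r: "0 < r" "r < 1" using lam0 p by (simp_all add: r_def)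
  have \<beta>: "1 < \<beta>" using lam0 by (simp add: \<beta>_def)
  define T where "T \<omega> = (\<Sum>i. ennreal ((\<beta> ^ i * norm (fwd_conv (t + real i) 1 \<omega>)) powr p))" for \<omega>
  have Tm[measurable]: "T \<in> borel_measurable M" unfolding T_def[abs_def] by measurable
  have "(\<integral>\<^sup>+\<omega>. T \<omega> \<partial>M) = (\<Sum>i. \<integral>\<^sup>+\<omega>. ennreal ((\<beta> ^ i * norm (fwd_conv (t + real i) 1 \<omega>)) powr p) \<partial>M)"
    unfolding T_def by (rule nn_integral_suminf) measurable
  also have "\<dots> \<le> (\<Sum>i. ennreal (exp (- (lam 0 * p * t)) * conv_const 1 * r ^ i))"
  proof (intro suminf_le allI summableI)
    fix i
    have \<beta>i: "(\<beta> ^ i) powr p = exp (lam 0 / 2 * real i * p)"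
      unfolding \<beta>_def by (simp add: exp_of_nat_mult[symmetric] powr_def ac_simps)
    have "(\<integral>\<^sup>+\<omega>. ennreal ((\<beta> ^ i * norm (fwd_conv (t + real i) 1 \<omega>)) powr p) \<partial>M)
        = (\<integral>\<^sup>+\<omega>. ennreal ((\<beta> ^ i) powr p) * ennreal (norm (fwd_conv (t + real i) 1 \<omega>) powr p) \<partial>M)"
      using \<beta> by (intro nn_integral_cong) (simp add: powr_mult ennreal_mult)
    also have "\<dots> = ennreal ((\<beta> ^ i) powr p) * (\<integral>\<^sup>+\<omega>. ennreal (norm (fwd_conv (t + real i) 1 \<omega>) powr p) \<partial>M)"
      by (rule nn_integral_cmult) measurable
    also have "\<dots> \<le> ennreal ((\<beta> ^ i) powr p) * ennreal (exp (- (lam 0 * (t + real i) * p)) * conv_const 1)"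
      using t by (intro mult_left_mono fwd_conv_moment(2)) auto
    also have "\<dots> = ennreal ((\<beta> ^ i) powr p * (exp (- (lam 0 * (t + real i) * p)) * conv_const 1))"
      by (simp add: ennreal_mult conv_const_nonneg)
    also have "(\<beta> ^ i) powr p * (exp (- (lam 0 * (t + real i) * p)) * conv_const 1)
        = exp (- (lam 0 * p * t)) * conv_const 1 * r ^ i"
    proof -
      have "r ^ i = exp (- (lam 0 * p / 2) * real i)" unfolding r_def by (simp add: exp_of_nat_mult[symmetric] ac_simps)
      moreover have "exp (lam 0 / 2 * real i * p) * exp (- (lam 0 * (t + real i) * p))
          = exp (- (lam 0 * p * t)) * exp (- (lam 0 * p / 2) * real i)"
        by (simp add: exp_add[symmetric] field_simps)
      ultimately show ?thesis by (simp only: \<beta>i mult.assoc[symmetric]) (simp only: mult_ac)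
    qed
    finally show "(\<integral>\<^sup>+\<omega>. ennreal ((\<beta> ^ i * norm (fwd_conv (t + real i) 1 \<omega>)) powr p) \<partial>M)
        \<le> ennreal (exp (- (lam 0 * p * t)) * conv_const 1 * r ^ i)" .
  qed
  also have "\<dots> = ennreal (\<Sum>i. exp (- (lam 0 * p * t)) * conv_const 1 * r ^ i)"
    using r by (intro suminf_ennreal2 summable_mult summable_geometric) (auto simp: conv_const_nonneg)
  also have "(\<Sum>i. exp (- (lam 0 * p * t)) * conv_const 1 * r ^ i) = exp (- (lam 0 * p * t)) * conv_const 1 * (1 / (1 - r))"
    using r by (subst suminf_mult) (auto simp: suminf_geometric summable_geometric)
  finally have IT: "(\<integral>\<^sup>+\<omega>. T \<omega> \<partial>M) \<le> ennreal (exp (- (lam 0 * p * t)) * conv_const 1 * (1 / (1 - r)))" .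
  then have "(\<integral>\<^sup>+\<omega>. T \<omega> \<partial>M) \<noteq> \<infinity>" by (auto simp: top_unique)
  then have fin: "AE \<omega> in M. T \<omega> \<noteq> \<infinity>" by (intro nn_integral_PInf_AE) measurable
  define c where "c = 1 / (1 - 1 / \<beta>)"
  have c: "0 < c" using \<beta> by (simp add: c_def)
  have main: "AE \<omega> in M. summable (\<lambda>i. norm (fwd_conv (t + real i) 1 \<omega>)) \<and> ennreal (norm (fwd_tail t \<omega>) powr p) \<le> ennreal (c powr p) * T \<omega>"
    using fin
  proof eventually_elim
    case (elim \<omega>)
    then obtain B where B: "0 \<le> B" "T \<omega> = ennreal B" by (cases "T \<omega>") auto
    have le: "norm (fwd_conv (t + real i) 1 \<omega>) \<le> B powr (1 / p) * (1 / \<beta>) ^ i" for i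
    proof -
      have "ennreal ((\<beta> ^ i * norm (fwd_conv (t + real i) 1 \<omega>)) powr p) \<le> T \<omega>"
      proof -
        have "(\<Sum>i\<in>{i}. ennreal ((\<beta> ^ i * norm (fwd_conv (t + real i) 1 \<omega>)) powr p)) \<le> T \<omega>"
          unfolding T_def by (rule sum_le_suminf) (auto intro: summableI)
        then show ?thesis by (subst (asm) sum.insert) (simp_all only: finite.emptyI empty_iff not_False_eq_True sum.empty add_0_right)
      qed
      then have "(\<beta> ^ i * norm (fwd_conv (t + real i) 1 \<omega>)) powr p \<le> B"
        unfolding B(2) by (subst (asm) ennreal_le_iff[OF B(1)])
      then have "((\<beta> ^ i * norm (fwd_conv (t + real i) 1 \<omega>)) powr p) powr (1 / p) \<le> B powr (1 / p)"
        using p by (intro powr_mono2) auto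
      then have "\<beta> ^ i * norm (fwd_conv (t + real i) 1 \<omega>) \<le> B powr (1 / p)"
        using p \<beta> by (simp add: powr_powr)
      then show ?thesis using \<beta> by (simp add: power_one_over field_simps)
    qed
    have geo: "summable (\<lambda>i. B powr (1 / p) * (1 / \<beta>) ^ i)"
      using \<beta> by (intro summable_mult summable_geometric) auto
    have summ: "summable (\<lambda>i. norm (fwd_conv (t + real i) 1 \<omega>))"
      by (rule summable_comparison_test'[OF geo, of 0]) (use le in simp)
    have "norm (fwd_tail t \<omega>) \<le> (\<Sum>i. norm (fwd_conv (t + real i) 1 \<omega>))" by (rule fwd_tail_sums(2)[OF summ])
    also have "\<dots> \<le> (\<Sum>i. B powr (1 / p) * (1 / \<beta>) ^ i)" by (intro suminf_le le summ geo)
    also have "\<dots> = B powr (1 / p) * c"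
      using \<beta> unfolding c_def by (subst suminf_mult) (auto simp: suminf_geometric summable_geometric)
    finally have "norm (fwd_tail t \<omega>) powr p \<le> (B powr (1 / p) * c) powr p" using p by (intro powr_mono2) auto
    also have "\<dots> = c powr p * B" using B p c by (simp add: powr_mult powr_powr)
    finally show ?case using summ B by (simp add: ennreal_mult[symmetric] ennreal_leI)
  qed
  then show "AE \<omega> in M. summable (\<lambda>i. norm (fwd_conv (t + real i) 1 \<omega>))" by (rule AE_mp) auto
  have "(\<integral>\<^sup>+\<omega>. ennreal (norm (fwd_tail t \<omega>) powr p) \<partial>M) \<le> (\<integral>\<^sup>+\<omega>. ennreal (c powr p) * T \<omega> \<partial>M)"
    using main by (intro nn_integral_mono_AE) auto
  also have "\<dots> = ennreal (c powr p) * (\<integral>\<^sup>+\<omega>. T \<omega> \<partial>M)" by (rule nn_integral_cmult) measurable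
  also have "\<dots> \<le> ennreal (c powr p) * ennreal (exp (- (lam 0 * p * t)) * conv_const 1 * (1 / (1 - r)))"
    by (rule mult_left_mono[OF IT]) simp
  also have "\<dots> = ennreal (c powr p * (exp (- (lam 0 * p * t)) * conv_const 1 * (1 / (1 - r))))"
    using r by (intro ennreal_mult[symmetric]) (auto simp: conv_const_nonneg)
  also have "c powr p * (exp (- (lam 0 * p * t)) * conv_const 1 * (1 / (1 - r))) = fwd_tail_const * exp (- (lam 0 * p * t))"
    by (simp add: fwd_tail_const_def c_def r_def \<beta>_def exp_minus inverse_eq_divide)
  finally show "(\<integral>\<^sup>+\<omega>. ennreal (norm (fwd_tail t \<omega>) powr p) \<partial>M) \<le> ennreal (fwd_tail_const * exp (- (lam 0 * p * t)))" .
qed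

end

section \<open>Coupling with the limit law\<close>

locale heat_levy_stationary = heat_levy e lam b Q \<nu> M L p
  for e :: "nat \<Rightarrow> 'a::{real_inner, polish_space}" and lam b Q \<nu> and M :: "'w measure" and L p +
  fixes \<mu> :: "'a measure"
  assumes sets_mu[measurable_cong]: "sets \<mu> = sets borel" and prob_mu: "prob_space \<mu>"
    and conv: "weak_conv_at_top (\<lambda>t. distr M borel (stoch_conv e lam L t)) \<mu>"
begin

text \<open>Weak convergence tested with the constant 1: total masses tend to 1, so the image
  measures are eventually nonzero.\<close>

lemma eventually_stoch_conv_measurable:
  "eventually (\<lambda>t. 0 < t \<and> stoch_conv e lam L t \<in> borel_measurable M) at_top"
proof -
  interpret mu: prob_space \<mu> by (rule prob_mu)
  have "((\<lambda>t. \<integral>x. (1::real) \<partial>distr M borel (stoch_conv e lam L t)) \<longlongrightarrow> (\<integral>x. 1 \<partial>\<mu>)) at_top"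
    using conv unfolding weak_conv_at_top_def by (elim allE[of _ "\<lambda>_. 1"]) (auto simp: bounded_iff)
  then have "((\<lambda>t. measure (distr M borel (stoch_conv e lam L t)) UNIV) \<longlongrightarrow> 1) at_top"
    by (simp add: mu.prob_space)
  then have "eventually (\<lambda>t. 0 < measure (distr M borel (stoch_conv e lam L t)) UNIV) at_top"
    by (rule order_tendstoD) simp
  then show ?thesis
    using eventually_gt_at_top[of "0::real"]
  proof eventually_elim
    case (elim t)
    then have "emeasure (distr M borel (stoch_conv e lam L t)) UNIV \<noteq> 0" by (auto simp: measure_def)
    then show ?case using elim(2) measurable_if_distr_nonzero[OF prob_space_axioms] by blast
  qed
qed

lemma distr_stoch_conv:
  assumes "0 < t" "stoch_conv e lam L t \<in> borel_measurable M"
  shows "distr M borel (stoch_conv e lam L t) = distr M borel (fwd_conv 0 t)"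
  unfolding distr_fwd_conv_eq_bwd_conv[OF assms(1)]
  using stoch_conv_AE_eq[OF assms(1)] assms(2) by (intro distr_cong_AE) auto

text \<open>Along the times t + m the forward integrals converge almost surely, and their laws are
  eventually those of the convolution, which tend to \<mu>. Thus \<mu> is realised on the same space
  as the integral up to time \<open>t\<close>, and this supplies the coupling.\<close>

lemma distr_fwd_conv_plus_tail:
  assumes t: "0 < t"
  shows "distr M borel (\<lambda>\<omega>. fwd_conv 0 t \<omega> + fwd_tail t \<omega>) = \<mu>"
proof (rule measure_eqI_continuous_bounded)
  fix f :: "'a \<Rightarrow> real" assume f: "continuous_on UNIV f" "bounded (range f)"
  then have [measurable]: "f \<in> borel_measurable borel" by (intro borel_measurable_continuous_onI)
  have "AE \<omega> in M. (\<lambda>m. fwd_conv 0 (t + real m) \<omega>) \<longlonglongrightarrow> fwd_conv 0 t \<omega> + fwd_tail t \<omega>"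
    using fwd_conv_add[OF t] fwd_tail_moment(1)[OF t]
  proof eventually_elim
    case (elim \<omega>)
    have "(\<lambda>m. fwd_conv 0 t \<omega> + (\<Sum>i<m. fwd_conv (t + real i) 1 \<omega>)) \<longlonglongrightarrow> fwd_conv 0 t \<omega> + fwd_tail t \<omega>"
      using fwd_tail_sums(1)[OF elim(2)] unfolding sums_def by (intro tendsto_intros)
    then show ?case using elim(1) by simp
  qed
  then have "(\<lambda>m. \<integral>\<omega>. f (fwd_conv 0 (t + real m) \<omega>) \<partial>M) \<longlonglongrightarrow> (\<integral>\<omega>. f (fwd_conv 0 t \<omega> + fwd_tail t \<omega>) \<partial>M)"
    by (intro bounded_convergence[OF f]) auto
  moreover have "(\<lambda>m. \<integral>\<omega>. f (fwd_conv 0 (t + real m) \<omega>) \<partial>M) \<longlonglongrightarrow> (\<integral>x. f x \<partial>\<mu>)"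
  proof -
    have tm: "filterlim (\<lambda>m. t + real m) at_top sequentially"
      by (intro filterlim_tendsto_add_at_top[OF tendsto_const] filterlim_real_sequentially)
    have "((\<lambda>t. \<integral>x. f x \<partial>distr M borel (stoch_conv e lam L t)) \<longlongrightarrow> (\<integral>x. f x \<partial>\<mu>)) at_top"
      using conv f unfolding weak_conv_at_top_def by blast
    from filterlim_compose[OF this tm]
    have "(\<lambda>m. \<integral>x. f x \<partial>distr M borel (stoch_conv e lam L (t + real m))) \<longlonglongrightarrow> (\<integral>x. f x \<partial>\<mu>)" .
    moreover have "eventually (\<lambda>m. (\<integral>x. f x \<partial>distr M borel (stoch_conv e lam L (t + real m)))
        = (\<integral>\<omega>. f (fwd_conv 0 (t + real m) \<omega>) \<partial>M)) sequentially"
      using filterlim_iff[THEN iffD1, OF tm, rule_format, OF eventually_stoch_conv_measurable]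
      by eventually_elim (simp add: distr_stoch_conv integral_distr)
    ultimately show ?thesis by (rule Lim_transform_eventually)
  qed
  ultimately have "(\<integral>\<omega>. f (fwd_conv 0 t \<omega> + fwd_tail t \<omega>) \<partial>M) = (\<integral>x. f x \<partial>\<mu>)" by (rule LIMSEQ_unique)
  then show "(\<integral>x. f x \<partial>distr M borel (\<lambda>\<omega>. fwd_conv 0 t \<omega> + fwd_tail t \<omega>)) = (\<integral>x. f x \<partial>\<mu>)"
    by (simp add: integral_distr)
qed (auto intro!: prob_space_distr prob_mu simp: sets_mu)

text \<open>Both laws are realised with the same integral up to time \<open>t\<close>, so the
  difference is the fixed vector u - w minus the tail.\<close>

lemma Wcost_stoch_conv_le:
  assumes t: "0 < t" and m[measurable]: "stoch_conv e lam L t \<in> borel_measurable M"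
  shows "Wcost p (distr M borel (\<lambda>\<omega>. u + stoch_conv e lam L t \<omega>)) (distr \<mu> borel (\<lambda>x. w + x))
    \<le> ennreal (2 powr p) * (ennreal (norm (u - w) powr p) + ennreal (fwd_tail_const * exp (- (lam 0 * p * t))))"
proof -
  have "distr M borel (\<lambda>\<omega>. u + stoch_conv e lam L t \<omega>) = distr (distr M borel (stoch_conv e lam L t)) borel (\<lambda>x. u + x)"
    by (simp add: distr_distr comp_def)
  also have "\<dots> = distr M borel (\<lambda>\<omega>. u + fwd_conv 0 t \<omega>)"
    unfolding distr_stoch_conv[OF t m] by (simp add: distr_distr comp_def)
  finally have 1: "distr M borel (\<lambda>\<omega>. u + stoch_conv e lam L t \<omega>) = distr M borel (\<lambda>\<omega>. u + fwd_conv 0 t \<omega>)" .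
  have 2: "distr \<mu> borel (\<lambda>x. w + x) = distr M borel (\<lambda>\<omega>. w + (fwd_conv 0 t \<omega> + fwd_tail t \<omega>))"
    unfolding distr_fwd_conv_plus_tail[OF t, symmetric] by (simp add: distr_distr comp_def)
  have "Wcost p (distr M borel (\<lambda>\<omega>. u + fwd_conv 0 t \<omega>)) (distr M borel (\<lambda>\<omega>. w + (fwd_conv 0 t \<omega> + fwd_tail t \<omega>)))
      \<le> (\<integral>\<^sup>+\<omega>. ennreal (dist (u + fwd_conv 0 t \<omega>) (w + (fwd_conv 0 t \<omega> + fwd_tail t \<omega>)) powr p) \<partial>M)"
    by (rule Wcost_le_joint_law[OF prob_space_axioms]) measurable
  also have "\<dots> \<le> (\<integral>\<^sup>+\<omega>. ennreal (2 powr p) * (ennreal (norm (u - w) powr p) + ennreal (norm (fwd_tail t \<omega>) powr p)) \<partial>M)"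
  proof (rule nn_integral_mono)
    fix \<omega>
    have "dist (u + fwd_conv 0 t \<omega>) (w + (fwd_conv 0 t \<omega> + fwd_tail t \<omega>)) = norm ((u - w) - fwd_tail t \<omega>)"
      unfolding dist_norm by (rule arg_cong[where f=norm]) (simp add: algebra_simps)
    also have "\<dots> \<le> norm (u - w) + norm (fwd_tail t \<omega>)" by (rule norm_triangle_ineq4)
    finally have "dist (u + fwd_conv 0 t \<omega>) (w + (fwd_conv 0 t \<omega> + fwd_tail t \<omega>)) powr p \<le> (norm (u - w) + norm (fwd_tail t \<omega>)) powr p"
      using p by (intro powr_mono2) auto
    also have "\<dots> \<le> 2 powr p * (norm (u - w) powr p + norm (fwd_tail t \<omega>) powr p)"
      using p by (intro powr_add_le) auto
    finally show "ennreal (dist (u + fwd_conv 0 t \<omega>) (w + (fwd_conv 0 t \<omega> + fwd_tail t \<omega>)) powr p)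
        \<le> ennreal (2 powr p) * (ennreal (norm (u - w) powr p) + ennreal (norm (fwd_tail t \<omega>) powr p))"
      by (simp add: ennreal_mult[symmetric] ennreal_plus[symmetric] ennreal_leI del: ennreal_plus)
  qed
  also have "\<dots> = ennreal (2 powr p) * (ennreal (norm (u - w) powr p) + (\<integral>\<^sup>+\<omega>. ennreal (norm (fwd_tail t \<omega>) powr p) \<partial>M))"
    by (simp add: nn_integral_cmult nn_integral_add emeasure_space_1)
  also have "\<dots> \<le> ennreal (2 powr p) * (ennreal (norm (u - w) powr p) + ennreal (fwd_tail_const * exp (- (lam 0 * p * t))))"
    by (intro mult_left_mono add_left_mono fwd_tail_moment(2)[OF t]) simp
  finally show ?thesis unfolding 1 2 .
qed

end

section \<open>The limit profile\<close>

theorem mainTheorem7: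
  fixes e :: "nat \<Rightarrow> 'a::{real_inner, polish_space}"
    and lam :: "nat \<Rightarrow> real"
    and M :: "'w measure" and L :: "real \<Rightarrow> 'w \<Rightarrow> 'a"
    and b :: 'a and Q :: "'a \<Rightarrow> 'a" and \<nu> :: "'a measure"
    and p :: real and h :: 'a and mu_inf :: "'a measure" and \<rho> :: real
  assumes heat: "heat_hyp e lam"
    and levy: "levy_process M L"
    and char: "levy_char M L b Q \<nu>"
    and Q: "cov_operator e Q"
    and nu: "levy_measure \<nu>"
    and p: "p > 0"
    and moment: "(\<integral>\<^sup>+ x. ennreal (indicator {x. norm x > 1} x * norm x powr p) \<partial>\<nu>) < \<infinity>"
    and limit: "sets mu_inf = sets borel"
    and limit_prob: "prob_space mu_inf"
    and conv: "weak_conv_at_top (\<lambda>t. distr M borel (stoch_conv e lam L t)) mu_inf"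
    and h: "h \<noteq> 0"
  shows "(let lamN = lam (Nidx e h);
              P = Wass p (distr mu_inf borel (\<lambda>x. exp (- \<rho> * lamN) *\<^sub>R vvec e lam h + x)) mu_inf
          in ((\<lambda>\<epsilon>. Wass p (distr M borel (\<lambda>\<omega>. heat_sg e lam (\<bar>ln \<epsilon>\<bar> / lamN + \<rho>) h
                                            + \<epsilon> *\<^sub>R stoch_conv e lam L (\<bar>ln \<epsilon>\<bar> / lamN + \<rho>) \<omega>))
                              (distr mu_inf borel (\<lambda>x. \<epsilon> *\<^sub>R x))
                      / ennreal (\<epsilon> powr min 1 p)) \<longlongrightarrow> P) (at_right 0)
             \<and> 0 < P \<and> P < \<top>)"
proof -
  interpret heat_levy_stationary e lam b Q \<nu> M L p mu_inf
  proof (intro heat_levy_stationary.intro heat_levy.intro heat.intro levy_triplet.intro orthonormal_basis.intro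
      heat_levy_stationary_axioms.intro heat_levy_axioms.intro heat_axioms.intro levy_triplet_axioms.intro)
    show "inner (e i) (e j) = (if i = j then 1 else 0)" "inner (e i) (e j) = (if i = j then 1 else 0)" for i j
      using heat by (auto simp: heat_hyp_def)
    show "(\<lambda>n. \<Sum>k<n. inner (e k) x *\<^sub>R e k) \<longlonglongrightarrow> x" "(\<lambda>n. \<Sum>k<n. inner (e k) x *\<^sub>R e k) \<longlonglongrightarrow> x" for x
      using heat by (auto simp: heat_hyp_def)
    show "0 < lam 0" "mono lam" "filterlim lam at_top sequentially"
      using heat by (auto simp: heat_hyp_def)
  qed fact+
  interpret mu: prob_space mu_inf by (rule limit_prob)
  define N where "N = lam (Nidx e h)"
  have N: "0 < N" by (simp add: N_def lam_pos)
  define w where "w = exp (- \<rho> * N) *\<^sub>R vvec e lam h"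
  have w: "w \<noteq> 0" using vvec_nonzero[OF h] by (simp add: w_def)
  define \<mu>w where "\<mu>w = distr mu_inf borel (\<lambda>x. w + x)"
  define T where "T \<epsilon> = \<bar>ln \<epsilon>\<bar> / N + \<rho>" for \<epsilon> :: real
  have T: "filterlim T at_top (at_right 0)"
    unfolding T_def[abs_def] by (rule filterlim_log_time[OF N])
  define u where "u \<epsilon> = (1 / \<epsilon>) *\<^sub>R heat_sg e lam (T \<epsilon>) h" for \<epsilon>
  have u: "(u \<longlongrightarrow> w) (at_right 0)"
    using rescaled_heat_sg_tendsto[OF h, of \<rho>] unfolding u_def[abs_def] T_def w_def N_def .
  define \<mu>s where "\<mu>s \<epsilon> = distr M borel (\<lambda>\<omega>. u \<epsilon> + stoch_conv e lam L (T \<epsilon>) \<omega>)" for \<epsilon>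
  have good: "eventually (\<lambda>\<epsilon>. 0 < \<epsilon> \<and> 0 < T \<epsilon> \<and> stoch_conv e lam L (T \<epsilon>) \<in> borel_measurable M) (at_right 0)"
    using filterlim_iff[THEN iffD1, OF T, rule_format, OF eventually_stoch_conv_measurable]
      eventually_at_right_less[of "0::real"] by eventually_elim simp
  \<comment> \<open>Scaling by \<epsilon> turns \<open>u \<epsilon>\<close> plus the convolution
    into the mild solution, and the homogeneity of the distance absorbs the normalisation.\<close>
  have eq: "eventually (\<lambda>\<epsilon>. Wass p (\<mu>s \<epsilon>) mu_inf
      = Wass p (distr M borel (\<lambda>\<omega>. heat_sg e lam (T \<epsilon>) h + \<epsilon> *\<^sub>R stoch_conv e lam L (T \<epsilon>) \<omega>))
          (distr mu_inf borel (\<lambda>x. \<epsilon> *\<^sub>R x)) / ennreal (\<epsilon> powr min 1 p)) (at_right 0)"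
    using good
  proof eventually_elim
    case (elim \<epsilon>)
    then have [measurable]: "stoch_conv e lam L (T \<epsilon>) \<in> borel_measurable M" by simp
    have "distr (\<mu>s \<epsilon>) borel (\<lambda>x. \<epsilon> *\<^sub>R x) = distr M borel (\<lambda>\<omega>. heat_sg e lam (T \<epsilon>) h + \<epsilon> *\<^sub>R stoch_conv e lam L (T \<epsilon>) \<omega>)"
      using elim by (simp add: \<mu>s_def u_def distr_distr comp_def scaleR_add_right)
    then show ?case
      using Wass_scaleR[of \<epsilon> p "\<mu>s \<epsilon>" mu_inf] elim p limit by (simp add: \<mu>s_def)
  qed
  have c_pos: "0 < Wcost p \<mu>w mu_inf"
    unfolding \<mu>w_def by (rule Wcost_translate_pos[OF limit_prob limit w p])
  \<comment> \<open>The shift itself is a coupling, of cost |w|^p.\<close>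
  have c_fin: "Wcost p \<mu>w mu_inf < \<top>"
  proof -
    have "Wcost p (distr mu_inf borel (\<lambda>x. w + x)) (distr mu_inf borel (\<lambda>x. x))
        \<le> (\<integral>\<^sup>+x. ennreal (dist (w + x) x powr p) \<partial>mu_inf)"
      by (rule Wcost_le_joint_law[OF limit_prob]) measurable
    also have "\<dots> = ennreal (norm w powr p)" by (simp add: dist_norm mu.emeasure_space_1)
    finally have "Wcost p \<mu>w mu_inf \<le> ennreal (norm w powr p)"
      by (simp add: \<mu>w_def distr_id2[OF limit[symmetric]])
    then show ?thesis by (rule order_le_less_trans) simp
  qed
  \<comment> \<open>The profile is the distance of the shifted limit law \<open>\<mu>w\<close> from
    \<open>mu_inf\<close>; it remains to see that the rescaled process and \<open>\<mu>w\<close>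
    merge.\<close>
  define d where "d \<epsilon> = Wcost p (\<mu>s \<epsilon>) \<mu>w" for \<epsilon>
  have d: "(d \<longlongrightarrow> 0) (at_right 0)"
  proof (rule tendsto_sandwich[OF _ _ tendsto_const])
    define B where "B \<epsilon> = ennreal (2 powr p) * (ennreal (norm (u \<epsilon> - w) powr p) + ennreal (fwd_tail_const * exp (- (lam 0 * p * T \<epsilon>))))" for \<epsilon>
    show "eventually (\<lambda>\<epsilon>. 0 \<le> d \<epsilon>) (at_right 0)" by simp
    show "eventually (\<lambda>\<epsilon>. d \<epsilon> \<le> B \<epsilon>) (at_right 0)"
      using good by eventually_elim (auto simp: d_def B_def \<mu>s_def \<mu>w_def intro!: Wcost_stoch_conv_le)
    have "((\<lambda>\<epsilon>. norm (u \<epsilon> - w)) \<longlongrightarrow> 0) (at_right 0)"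
      using tendsto_norm[OF tendsto_diff[OF u tendsto_const[of w]]] by simp
    then have "((\<lambda>\<epsilon>. norm (u \<epsilon> - w) powr p) \<longlongrightarrow> 0 powr p) (at_right 0)"
      using p by (intro tendsto_powr' tendsto_const) auto
    moreover have "((\<lambda>\<epsilon>. fwd_tail_const * exp (- (lam 0 * p * T \<epsilon>))) \<longlongrightarrow> fwd_tail_const * 0) (at_right 0)"
    proof -
      have "filterlim (\<lambda>\<epsilon>. lam 0 * p * T \<epsilon>) at_top (at_right 0)"
        using lam0 p by (intro filterlim_tendsto_pos_mult_at_top[OF tendsto_const _ T]) auto
      then have "filterlim (\<lambda>\<epsilon>. - (lam 0 * p * T \<epsilon>)) at_bot (at_right 0)"
        by (simp add: filterlim_uminus_at_top)
      then show ?thesis by (intro tendsto_mult tendsto_const filterlim_compose[OF exp_at_bot])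
    qed
    ultimately have "(B \<longlongrightarrow> ennreal (2 powr p) * (ennreal (0 powr p) + ennreal (fwd_tail_const * 0))) (at_right 0)"
      unfolding B_def by (intro ennreal_tendsto_cmult tendsto_add tendsto_ennrealI) simp_all
    then show "(B \<longlongrightarrow> 0) (at_right 0)" by simp
  qed
  have cost_lim: "((\<lambda>\<epsilon>. Wcost p (\<mu>s \<epsilon>) mu_inf) \<longlongrightarrow> Wcost p \<mu>w mu_inf) (at_right 0)"
  proof (rule ennreal_tendsto_of_mutual_bounds[OF c_fin d])
    fix \<eta> :: real assume \<eta>: "0 < \<eta>"
    obtain C :: real where "0 < C" and C: "\<And>\<alpha> \<beta> \<gamma> :: 'a measure.
        Wcost p \<alpha> \<gamma> \<le> ennreal (1 + \<eta>) * Wcost p \<alpha> \<beta> + ennreal C * Wcost p \<beta> \<gamma>"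
      by (rule Wcost_quasi_triangle[OF p \<eta>]) blast
    show "\<exists>C::real. \<forall>\<epsilon>. Wcost p (\<mu>s \<epsilon>) mu_inf \<le> ennreal (1 + \<eta>) * Wcost p \<mu>w mu_inf + ennreal C * d \<epsilon>
        \<and> Wcost p \<mu>w mu_inf \<le> ennreal (1 + \<eta>) * Wcost p (\<mu>s \<epsilon>) mu_inf + ennreal C * d \<epsilon>"
    proof (intro exI[of _ C] allI conjI)
      fix \<epsilon>
      \<comment> \<open>Starting from \<open>mu_inf\<close> puts the vanishing cost on the leg with
        the constant \<open>C\<close> and the cost to be compared on the leg with the factor 1 +
        \<eta>.\<close>
      show "Wcost p (\<mu>s \<epsilon>) mu_inf \<le> ennreal (1 + \<eta>) * Wcost p \<mu>w mu_inf + ennreal C * d \<epsilon>"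
        using C[of mu_inf "\<mu>s \<epsilon>" \<mu>w] by (simp only: d_def Wcost_commute[of p mu_inf] Wcost_commute[of p \<mu>w "\<mu>s \<epsilon>"])
      show "Wcost p \<mu>w mu_inf \<le> ennreal (1 + \<eta>) * Wcost p (\<mu>s \<epsilon>) mu_inf + ennreal C * d \<epsilon>"
        using C[of mu_inf \<mu>w "\<mu>s \<epsilon>"] by (simp only: d_def Wcost_commute[of p mu_inf])
    qed
  qed
  have "((\<lambda>\<epsilon>. Wass p (\<mu>s \<epsilon>) mu_inf) \<longlongrightarrow> Wass p \<mu>w mu_inf) (at_right 0)"
    using c_fin by (intro tendsto_Wass[OF p _ cost_lim]) auto
  from Lim_transform_eventually[OF this eq]
  have "((\<lambda>\<epsilon>. Wass p (distr M borel (\<lambda>\<omega>. heat_sg e lam (T \<epsilon>) h + \<epsilon> *\<^sub>R stoch_conv e lam L (T \<epsilon>) \<omega>))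
          (distr mu_inf borel (\<lambda>x. \<epsilon> *\<^sub>R x)) / ennreal (\<epsilon> powr min 1 p)) \<longlongrightarrow> Wass p \<mu>w mu_inf) (at_right 0)" .
  moreover have "0 < Wass p \<mu>w mu_inf" "Wass p \<mu>w mu_inf < \<top>"
    using c_pos c_fin by (auto simp: Wass_def enn2real_eq_0_iff)
  ultimately show ?thesis
    unfolding Let_def N_def[symmetric] T_def \<mu>w_def w_def by blast
qed

end
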